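(* Consider a random walk on the triangular lattice, with parameters $\alpha,\alpha',\beta,\beta',\gamma,\gamma'$ and $\kappa$, satisfying the standing assumptions in the context. Realize the lattice in $\mathbb{R}^2$ along the two vectors $\mathbf{e}_1=\mathbf{h}_1$, $\mathbf{e}_2=\mathbf{h}_2$ defined in the context, so that $V=\{x_1\mathbf{h}_1+x_2\mathbf{h}_2 : (x_1,x_2)\in\mathbb{Z}^2\}$. (1) Suppose $0\le \kappa<1/3$. There are polynomials $P_j=P_j(y)$, $j\in\mathbb{N}$ (not depending on $n,N$ or the vertices), in the variables $y_1,y_2$ (where $y=y_1\mathbf{h}_1+y_2\mathbf{h}_2\in\mathbb{R}^2$), such that $P_j$ has degree at most $3j$ and is an odd or even function according as $j$ is odd or even, and such that for every $N\in\mathbb{N}\cup\{0\}$ $$2\pi n\, p(n,x,y)=3A(G)\exp\Big(-\frac{3}{2n}\|y-x\|_{\mathbb{R}^2}^2\Big)\Big(1+\sum_{j=1}^{N}n^{-j/2}P_j\Big(\frac{y-x}{\sqrt n}\Big)\Big)+O_N\big(n^{-\frac{N+1}{2}}\big)$$ as $n\to\infty$, uniformly for all $x,y\in V$. Furthermore, for $N\ge 2$ let $a_1(y-x;\kappa)n^{-1}$ denote the leading term of $\sum_{j=1}^N n^{-j/2}P_j\big(\frac{y-x}{\sqrt n}\big)$, i.e. $$\lim_{n\to\infty} n\Big(\sum_{j=1}^{N}n^{-j/2}P_j\Big(\frac{y-x}{\sqrt n}\Big)-a_1(y-x;\kappa)n^{-1}\Big)=0,\qquad x,y\in V.$$ Then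 the coefficient $a_1(y;\kappa)$ is explicitly given by $$a_1(y;\kappa)=a_1^{(0)}+\kappa\, a_1^{(1)}(y)+\kappa^2 a_1^{(2)},$$ where $$a_1^{(0)}=-1+\frac{1}{8\Gamma(p)^2}\Big\{\widehat\alpha(\widehat\beta+\widehat\gamma)^2+\widehat\beta(\widehat\gamma+\widehat\alpha)^2+\widehat\gamma(\widehat\alpha+\widehat\beta)^2\Big\},$$ $$a_1^{(1)}(y)=\frac{1}{\Gamma(p)^2}\Big\{(\widehat\alpha\widehat\beta-2\widehat\beta\widehat\gamma+\widehat\gamma\widehat\alpha)y_1+(-\widehat\alpha\widehat\beta-\widehat\beta\widehat\gamma+2\widehat\gamma\widehat\alpha)y_2\Big\},\qquad y=y_1\mathbf{h}_1+y_2\mathbf{h}_2,$$ $$a_1^{(2)}=\frac{3}{8\Gamma(p)^2}\Big(-1+\frac{5\widehat\alpha\widehat\beta\widehat\gamma}{\Gamma(p)}\Big).$$ (2) Suppose $\kappa=1/3$, i.e. $\alpha=\beta=\gamma=1/3$ and $\alpha'=\beta'=\gamma'=0$; then $\mathbf{h}_1={}^t(\sqrt{2/3},0)$, $\mathbf{h}_2={}^t(1/\sqrt6,1/\sqrt2)$ and $A(G)=1/\sqrt3$. Set $\widetilde{\mathbf{h}}_1=2\mathbf{h}_1-\mathbf{h}_2$, $\widetilde{\mathbf{h}}_2=\mathbf{h}_1+\mathbf{h}_2$ and $$V_k:=\{x_1\widetilde{\mathbf{h}}_1+x_2\widetilde{\mathbf{h}}_2 : (x_1,x_2)\in\mathbb{Z}^2\}+k\mathbf{h}_1,\qquad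 k=0,1,2.$$ Then there are polynomials $P_j$, $j\in\mathbb{N}$ (with the degree and parity properties of part (1)), such that for $k,s\in\{0,1,2\}$, $x\in V_k$, $y\in V_s$, and every $N\in\mathbb{N}\cup\{0\}$, $$2\pi n\, p(n,x,y)=9A(G)\exp\Big(-\frac{3}{2n}\|y-x\|_{\mathbb{R}^2}^2\Big)\Big(1+\sum_{j=1}^{N}n^{-j/2}P_j\Big(\frac{y-x}{\sqrt n}\Big)\Big)+O_N\big(n^{-\frac{N+1}{2}}\big)$$ as $n=3m+(s-k)\to\infty$ ($m$ integer), uniformly for all such $x$ and $y$; and the coefficient of the leading term (defined by the same limit as in part (1)) is $a_1(y-x;1/3)=-\frac23$.
   Context: Triangular lattice: for linearly independent $\mathbf{e}_1,\mathbf{e}_2\in\mathbb{R}^2$ and $\mathbf{e}_3:=\mathbf{e}_2-\mathbf{e}_1$, the graph $G=(V,E)$ has $V=\{x_1\mathbf{e}_1+x_2\mathbf{e}_2:(x_1,x_2)\in\mathbb{Z}^2\}$ and oriented edges $E=\{(x,y)\in V\times V: x-y\in\{\pm\mathbf{e}_1,\pm\mathbf{e}_2,\pm\mathbf{e}_3\}\}$. Random walk (standing assumptions): the 1-step transition probability $p:E\to[0,\infty)$ is translation invariant, with, for every $x\in V$, $p((x,x+\mathbf{e}_1))=\alpha$, $p((x,x-\mathbf{e}_1))=\alpha'$, $p((x,x+\mathbf{e}_2))=\beta'$, $p((x,x-\mathbf{e}_2))=\beta$, $p((x,x+\mathbf{e}_3))=\gamma$, $p((x,x-\mathbf{e}_3))=\gamma'$,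 where $\alpha,\alpha',\beta,\beta',\gamma,\gamma'\ge0$ and $\alpha+\alpha'+\beta+\beta'+\gamma+\gamma'=1$. The zero mean condition holds: $\sum_{e}p(e)e=0$, the sum being over the edges starting at the origin, identified with vectors; equivalently, $\alpha-\alpha'=\beta-\beta'=\gamma-\gamma'=\kappa$ for a constant $0\le\kappa\le1/3$. With $\widehat\alpha:=\alpha+\alpha'$, $\widehat\beta:=\beta+\beta'$, $\widehat\gamma:=\gamma+\gamma'$, one assumes $\Gamma(p):=\widehat\alpha\widehat\beta+\widehat\beta\widehat\gamma+\widehat\gamma\widehat\alpha>0$. $p(n,x,y)$ is the $n$-step transition probability: the sum over all paths $(e_1,\dots,e_n)$ of consecutive oriented edges from $x$ to $y$ of $p(e_1)\cdots p(e_n)$. Constants and vectors: $A(G):=\frac{1}{3\Gamma(p)^{1/2}}$, $l:=\Big(\frac{\widehat\beta+\widehat\gamma}{3\Gamma(p)}\Big)^{1/2}$, $\mathbf{h}_1:={}^t(l,0)$, $\mathbf{h}_2:={}^t\Big(\frac{\widehat\gamma}{\widehat\beta+\widehat\gamma}l,\ \frac{\Gamma(p)^{1/2}}{\widehat\beta+\widehat\gamma}l\Big)$. $O_N(\cdot)$ is the Landau symbol with implied constant allowed to depend on $N$ (and on $p$), but not on $x,y$.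
   Formalization: Part (1) also assumes α̂, β̂, γ̂ > 0 (if one vanishes, κ=0, the walk has period 2 and the expansion fails for odd n), and the prefactor of a_1^{(1)} is corrected from 1/Γ(p)² to 1/(2Γ(p)²), since the expansion determines a_1 and the printed value is false. *)

theory Defs
  imports "HOL-Analysis.Analysis"
begin

definition tri_lattice :: "real^2 \<Rightarrow> real^2 \<Rightarrow> (real^2) set" where
  "tri_lattice e1 e2 = {of_int m *\<^sub>R e1 + of_int n *\<^sub>R e2 | m n :: int. True}"

definition tri_edges :: "real^2 \<Rightarrow> real^2 \<Rightarrow> ((real^2) \<times> (real^2)) set" where
  "tri_edges e1 e2 = {(x, y). x \<in> tri_lattice e1 e2 \<and> y \<in> tri_lattice e1 e2 \<and>
     x - y \<in> {e1, - e1, e2, - e2, e2 - e1, - (e2 - e1)}}"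

fun edge_path :: "('v \<times> 'v) set \<Rightarrow> 'v \<Rightarrow> ('v \<times> 'v) list \<Rightarrow> 'v \<Rightarrow> bool" where
  "edge_path E x [] y \<longleftrightarrow> x = y"
| "edge_path E x (e # es) y \<longleftrightarrow> e \<in> E \<and> fst e = x \<and> edge_path E (snd e) es y"

text \<open>For the lattice graph the set of paths below is finite, so the sum is a genuine one.\<close>
definition nstep_prob ::
  "('v \<times> 'v) set \<Rightarrow> ('v \<times> 'v \<Rightarrow> real) \<Rightarrow> nat \<Rightarrow> 'v \<Rightarrow> 'v \<Rightarrow> real" where
  "nstep_prob E p n x y =
     (\<Sum>es | length es = n \<and> edge_path E x es y. prod_list (map p es))"

text \<open>Note the asymmetric naming: the step \<open>+e2\<close> has probability \<open>\<beta>'\<close> and \<open>-e2\<close> has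
  \<open>\<beta>\<close>. The zero mean condition is recorded both as the vanishing of the drift and in its
  equivalent form in terms of \<open>\<kappa>\<close>.\<close>
definition zero_mean_walk ::
  "real^2 \<Rightarrow> real^2 \<Rightarrow> ((real^2) \<times> (real^2) \<Rightarrow> real) \<Rightarrow>
   real \<Rightarrow> real \<Rightarrow> real \<Rightarrow> real \<Rightarrow> real \<Rightarrow> real \<Rightarrow> real \<Rightarrow> bool" where
  "zero_mean_walk e1 e2 p \<alpha> \<alpha>' \<beta> \<beta>' \<gamma> \<gamma>' \<kappa> \<longleftrightarrow>
     0 \<le> \<alpha> \<and> 0 \<le> \<alpha>' \<and> 0 \<le> \<beta> \<and> 0 \<le> \<beta>' \<and> 0 \<le> \<gamma> \<and> 0 \<le> \<gamma>' \<and>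
     \<alpha> + \<alpha>' + \<beta> + \<beta>' + \<gamma> + \<gamma>' = 1 \<and>
     (\<forall>x \<in> tri_lattice e1 e2.
        p (x, x + e1) = \<alpha> \<and> p (x, x - e1) = \<alpha>' \<and>
        p (x, x + e2) = \<beta>' \<and> p (x, x - e2) = \<beta> \<and>
        p (x, x + (e2 - e1)) = \<gamma> \<and> p (x, x - (e2 - e1)) = \<gamma>') \<and>
     (\<Sum>e | e \<in> tri_edges e1 e2 \<and> fst e = 0. p e *\<^sub>R (snd e - fst e)) = 0 \<and>
     \<alpha> - \<alpha>' = \<kappa> \<and> \<beta> - \<beta>' = \<kappa> \<and> \<gamma> - \<gamma>' = \<kappa> \<and> 0 \<le> \<kappa> \<and> \<kappa> \<le> 1/3"

text \<open>From here on \<open>a\<close>, \<open>b\<close>, \<open>c\<close> stand for \<open>\<alpha> + \<alpha>'\<close>, \<open>\<beta> + \<beta>'\<close>, \<open>\<gamma> + \<gamma>'\<close>.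
  Positivity of \<open>Gam a b c\<close> lets one of \<open>a\<close>, \<open>b\<close>, \<open>c\<close> vanish; then \<open>\<kappa> = 0\<close> and the walk is a
  symmetric nearest-neighbour walk on the square lattice, which has period 2, so an expansion
  along all \<open>n\<close> needs \<open>a\<close>, \<open>b\<close>, \<open>c\<close> positive.\<close>

definition Gam :: "real \<Rightarrow> real \<Rightarrow> real \<Rightarrow> real" where
  "Gam a b c = a * b + b * c + c * a"

definition A_G :: "real \<Rightarrow> real \<Rightarrow> real \<Rightarrow> real" where
  "A_G a b c = 1 / (3 * sqrt (Gam a b c))"

definition l_const :: "real \<Rightarrow> real \<Rightarrow> real \<Rightarrow> real" where
  "l_const a b c = sqrt ((b + c) / (3 * Gam a b c))"

definition h1_vec :: "real \<Rightarrow> real \<Rightarrow> real \<Rightarrow> real^2" where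
  "h1_vec a b c = vector [l_const a b c, 0]"

definition h2_vec :: "real \<Rightarrow> real \<Rightarrow> real \<Rightarrow> real^2" where
  "h2_vec a b c = vector [c / (b + c) * l_const a b c,
                          sqrt (Gam a b c) / (b + c) * l_const a b c]"

text \<open>\<open>f\<close> is a polynomial of total degree at most \<open>d\<close> in the coordinates with respect to the
  basis \<open>u\<close>, \<open>v\<close>.\<close>
definition poly_deg_le :: "real^2 \<Rightarrow> real^2 \<Rightarrow> nat \<Rightarrow> (real^2 \<Rightarrow> real) \<Rightarrow> bool" where
  "poly_deg_le u v d f \<longleftrightarrow> (\<exists>q :: nat \<Rightarrow> nat \<Rightarrow> real. \<forall>y1 y2.
     f (y1 *\<^sub>R u + y2 *\<^sub>R v) = (\<Sum>i\<le>d. \<Sum>k\<le>d - i. q i k * y1 ^ i * y2 ^ k))"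

definition expansion_polys :: "real^2 \<Rightarrow> real^2 \<Rightarrow> (nat \<Rightarrow> real^2 \<Rightarrow> real) \<Rightarrow> bool" where
  "expansion_polys u v P \<longleftrightarrow>
     (\<forall>j\<ge>1. poly_deg_le u v (3 * j) (P j) \<and>
        (odd j \<longrightarrow> (\<forall>y. P j (- y) = - P j y)) \<and>
        (even j \<longrightarrow> (\<forall>y. P j (- y) = P j y)))"

definition correction_sum :: "(nat \<Rightarrow> real^2 \<Rightarrow> real) \<Rightarrow> nat \<Rightarrow> nat \<Rightarrow> real^2 \<Rightarrow> real" where
  "correction_sum P N n v =
     (\<Sum>j = 1..N. real n powr (- real j / 2) * P j ((1 / sqrt (real n)) *\<^sub>R v))"

definition a1_0 :: "real \<Rightarrow> real \<Rightarrow> real \<Rightarrow> real" where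
  "a1_0 a b c = - 1 + 1 / (8 * (Gam a b c)\<^sup>2) *
     (a * (b + c)\<^sup>2 + b * (c + a)\<^sup>2 + c * (a + b)\<^sup>2)"

text \<open>The factor 2 in the denominator is missing in the published formula. The linear part in \<open>y\<close> of the
  third-cumulant (Edgeworth) term is \<open>- 1/2\<close> times the sum over \<open>i, j, k\<close> of
  \<open>m i j k * W i j * (W y) k\<close>, where \<open>m\<close> are the third moments of a step in lattice
  coordinates (\<open>m 1 1 2 = \<kappa>\<close>, \<open>m 1 2 2 = - \<kappa>\<close>, \<open>m 1 1 1 = m 2 2 2 = 0\<close>) and \<open>W\<close> is the
  inverse covariance matrix, with rows \<open>(b + c, c)\<close> and \<open>(c, a + c)\<close> divided by
  \<open>Gam a b c\<close>; this gives \<open>\<kappa>\<close> times the expression below.\<close>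
definition a1_1 :: "real \<Rightarrow> real \<Rightarrow> real \<Rightarrow> real \<Rightarrow> real \<Rightarrow> real" where
  "a1_1 a b c y1 y2 = 1 / (2 * (Gam a b c)\<^sup>2) *
     ((a * b - 2 * b * c + c * a) * y1 + (- a * b - b * c + 2 * c * a) * y2)"

definition a1_2 :: "real \<Rightarrow> real \<Rightarrow> real \<Rightarrow> real" where
  "a1_2 a b c = 3 / (8 * (Gam a b c)\<^sup>2) * (- 1 + 5 * a * b * c / Gam a b c)"

definition a1 :: "real \<Rightarrow> real \<Rightarrow> real \<Rightarrow> real \<Rightarrow> real \<Rightarrow> real \<Rightarrow> real" where
  "a1 a b c \<kappa> y1 y2 = a1_0 a b c + \<kappa> * a1_1 a b c y1 y2 + \<kappa>\<^sup>2 * a1_2 a b c"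

definition class_lattice :: "real^2 \<Rightarrow> real^2 \<Rightarrow> nat \<Rightarrow> (real^2) set" where
  "class_lattice h1 h2 k =
     {of_int m *\<^sub>R (2 *\<^sub>R h1 - h2) + of_int n *\<^sub>R (h1 + h2) + real k *\<^sub>R h1 | m n :: int. True}"

end

theory Submission
  imports Defs "HOL-Probability.Characteristic_Functions"
begin

text \<open>The walk is a sum of independent steps, so \<open>p(n, x, y)\<close> is a Fourier coefficient of the \<open>n\<close>-th
  power of the characteristic function of one step. Only frequencies of order \<open>1 / sqrt n\<close>
  matter, and there the power is a Gaussian times a series in \<open>1 / sqrt n\<close> whose coefficients
  are polynomials. Fourier inversion turns these into polynomials times a Gaussian again.

  The basis \<open>h1\<close>, \<open>h2\<close> is the one in which a step has covariance matrix one third of the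
  identity. Stretching by \<open>sqrt 3\<close> makes the covariance matrix the identity; in the dual
  coordinates \<open>u\<close> the Gaussian is \<open>exp (- norm u\<^sup>2 / 2)\<close>, a product of two one-dimensional
  ones, and its Fourier transforms with polynomial weights are given by Hermite polynomials
  (\<open>gauss_transform_monom\<close>, \<open>parity_poly_gauss_transform\<close>).

  The series is found without logarithms. Write the characteristic function as
  \<open>exp (- norm v\<^sup>2 / 2) * (1 + rem v)\<close>. The first two moments of a step agree with those of the
  Gaussian, so \<open>rem v\<close> is of third order, and \<open>chi ^ n\<close> is the Gaussian times
  \<open>(1 + rem) ^ n\<close>, a binomial sum. Its \<open>k\<close>-th term is of size \<open>(n * rem) ^ k\<close>, that is
  \<open>n ^ (- k / 2)\<close> at \<open>v = u / sqrt n\<close>, so finitely many terms suffice for a given accuracy, and each of them is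
  expanded by multiplying power series (\<open>expands_mult\<close>, \<open>chi_power_expansion\<close>). At order
  \<open>n ^ (- j / 2)\<close> this produces monomials of degree at most \<open>3 j\<close> with the parity of \<open>j\<close>, which is
  the degree and parity asserted of \<open>P j\<close>. The expansion is used where \<open>norm u ^ 3 \<le> sqrt n\<close>.
  For larger \<open>u\<close> both the power and its approximation have Gaussian decay, because away from the
  origin the characteristic function is bounded away from 1 in modulus
  (\<open>chi_gaussian_bound\<close>, \<open>chi_power_error\<close>).

  The last point needs aperiodicity. A unit modulus means that all steps of positive probability
  have the same phase. If \<open>\<kappa> < 1/3\<close> and \<open>a\<close>, \<open>b\<close>, \<open>c\<close> are positive, this happens only at the
  origin of the torus. If
  \<open>\<kappa> = 1/3\<close>, it happens at three points, which are the translates of each other by a shift under which the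
  integrand is invariant when \<open>n\<close> and \<open>y - x\<close> are in compatible classes modulo 3. Hence one may
  integrate over a third of the torus, where the origin is the only such point, and multiply by 3. Both parts
  are thus the cases \<open>q = 1\<close> and \<open>q = 3\<close> of \<open>nstep_prob_expansion\<close>, with the same polynomials.

  The leading coefficient collects the linear part of \<open>P 1\<close>, from the third moment of a step, and
  the value of \<open>P 2\<close> at the origin, from the fourth moment and the square of the third
  (\<open>edgeworth_poly_1\<close>, \<open>edgeworth_poly_2_at_0\<close>).\<close>

section \<open>Polynomials of bounded degree and fixed parity\<close>

text \<open>The complex span of the monomials \<open>x\<^sup>i y\<^sup>k\<close> with \<open>i + k \<le> d\<close> and \<open>i + k \<equiv> d\<close> modulo 2.
  Recording degree and parity in one number makes the predicate additive under products; since
  \<open>3 * j\<close> and \<open>j\<close> have the same parity, \<open>parity_poly (3 * j)\<close> is what is needed for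
  the \<open>j\<close>-th correction.\<close>
inductive parity_poly :: "nat \<Rightarrow> (real \<times> real \<Rightarrow> complex) \<Rightarrow> bool" where
  const: "parity_poly 0 (\<lambda>_. c)"
| fst: "parity_poly d f \<Longrightarrow> parity_poly (Suc d) (\<lambda>u. of_real (fst u) * f u)"
| snd: "parity_poly d f \<Longrightarrow> parity_poly (Suc d) (\<lambda>u. of_real (snd u) * f u)"
| add: "parity_poly d f \<Longrightarrow> parity_poly d g \<Longrightarrow> parity_poly d (\<lambda>u. f u + g u)"
| lift: "parity_poly d f \<Longrightarrow> parity_poly (Suc (Suc d)) f"

lemma parity_poly_zero: "parity_poly d (\<lambda>_. 0)"
proof (induction d)
  case 0 show ?case by (rule parity_poly.const)
next
  case (Suc d) from parity_poly.fst[OF this] show ?case by simp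
qed

lemma parity_poly_mult:
  assumes "parity_poly d f" "parity_poly e g"
  shows "parity_poly (d + e) (\<lambda>u. f u * g u)"
  using assms(1)
proof induction
  case (const c)
  show ?case using assms(2)
  proof induction
    case (const c') show ?case using parity_poly.const[of "c * c'"] by simp
  next
    case (fst d f) from parity_poly.fst[OF fst.IH] show ?case by (simp add: mult_ac)
  next
    case (snd d f) from parity_poly.snd[OF snd.IH] show ?case by (simp add: mult_ac)
  next
    case (add d f g) from parity_poly.add[OF add.IH] show ?case by (simp add: ring_distribs)
  next
    case (lift d f) from parity_poly.lift[OF lift.IH] show ?case by simp
  qed
next
  case (fst d f) from parity_poly.fst[OF fst.IH] show ?case by (simp add: mult_ac)
next
  case (snd d f) from parity_poly.snd[OF snd.IH] show ?case by (simp add: mult_ac)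
next
  case (add d f g) from parity_poly.add[OF add.IH] show ?case by (simp add: ring_distribs)
next
  case (lift d f) from parity_poly.lift[OF lift.IH] show ?case by simp
qed

lemma parity_poly_scale: "parity_poly d f \<Longrightarrow> parity_poly d (\<lambda>u. c * f u)"
  using parity_poly_mult[OF parity_poly.const, of d f c] by simp

lemma parity_poly_divide: "parity_poly d f \<Longrightarrow> parity_poly d (\<lambda>u. f u / c)"
  using parity_poly_scale[of d f "1 / c"] by simp

lemma parity_poly_diff:
  "parity_poly d f \<Longrightarrow> parity_poly d g \<Longrightarrow> parity_poly d (\<lambda>u. f u - g u)"
  using parity_poly.add[of d f "\<lambda>u. -1 * g u"] parity_poly_scale[of d g "-1"] by simp

lemma parity_poly_sum:
  "(\<And>k. k \<in> K \<Longrightarrow> parity_poly d (f k)) \<Longrightarrow> parity_poly d (\<lambda>u. \<Sum>k\<in>K. f k u)"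
  by (induction K rule: infinite_finite_induct) (auto intro: parity_poly_zero parity_poly.add)

lemma parity_poly_power: "parity_poly d f \<Longrightarrow> parity_poly (k * d) (\<lambda>u. f u ^ k)"
  by (induction k) (use parity_poly.const[of 1] in \<open>auto intro: parity_poly_mult\<close>)

lemma parity_poly_mono:
  assumes "parity_poly d f" "d \<le> e" "even (e - d)"
  shows "parity_poly e f"
proof -
  have "parity_poly (d + 2 * m) f" for m
    by (induction m) (use assms(1) in \<open>auto intro: parity_poly.lift\<close>)
  then show ?thesis using assms(2,3) by (metis evenE le_add_diff_inverse)
qed

lemma parity_poly_linear: "parity_poly 1 (\<lambda>u. of_real (x \<bullet> u))"
proof -
  have "parity_poly (Suc 0) (\<lambda>u. of_real (fst u) * of_real (fst x) + of_real (snd u) * of_real (snd x))"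
    by (intro parity_poly.intros)
  then show ?thesis by (simp add: inner_prod_def mult.commute)
qed

lemma parity_poly_norm_sq: "parity_poly 2 (\<lambda>u. of_real ((norm u)\<^sup>2))"
proof -
  have "parity_poly (Suc (Suc 0))
      (\<lambda>u. of_real (fst u) * (of_real (fst u) * 1) + of_real (snd u) * (of_real (snd u) * 1))"
    by (intro parity_poly.intros)
  moreover have "complex_of_real ((norm u)\<^sup>2) = of_real (fst u) * (of_real (fst u) * 1) + of_real (snd u) * (of_real (snd u) * 1)"
    for u :: "real \<times> real"
    by (simp only: power2_norm_eq_inner inner_prod_def) simp
  ultimately show ?thesis by (simp only: numeral_2_eq_2)
qed

lemma parity_poly_subst:
  assumes "parity_poly d f"
  shows "parity_poly d (\<lambda>u. f (p \<bullet> u, q \<bullet> u))"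
  using assms
proof induction
  case (fst d f)
  from parity_poly_mult[OF parity_poly_linear[of p] fst.IH] show ?case by simp
next
  case (snd d f)
  from parity_poly_mult[OF parity_poly_linear[of q] snd.IH] show ?case by simp
qed (auto intro: parity_poly.intros)

lemma parity_poly_uminus: "parity_poly d f \<Longrightarrow> f (- u) = (-1) ^ d * f u"
  by (induction rule: parity_poly.induct) (auto simp: algebra_simps)

lemma parity_poly_continuous: "parity_poly d f \<Longrightarrow> continuous_on A f"
  by (induction rule: parity_poly.induct) (auto intro!: continuous_intros)

lemma parity_poly_bound:
  assumes "parity_poly d f"
  shows "\<exists>C\<ge>0. \<exists>M. \<forall>u. norm (f u) \<le> C * (1 + norm u) ^ M"
  using assms
proof induction
  case (const c)
  show ?case by (rule exI[of _ "norm c"]) (auto intro!: exI[of _ 0])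
next
  case (fst d f)
  then obtain C M where C: "C \<ge> 0" "\<And>u. norm (f u) \<le> C * (1 + norm u) ^ M" by blast
  have "norm (of_real (fst u) * f u) \<le> C * (1 + norm u) ^ Suc M" for u
  proof -
    have "\<bar>fst u\<bar> \<le> 1 + norm u" using norm_fst_le[of "fst u" "snd u"] by simp
    then have "\<bar>fst u\<bar> * norm (f u) \<le> (1 + norm u) * (C * (1 + norm u) ^ M)"
      by (intro mult_mono C) auto
    then show ?thesis by (simp add: norm_mult mult_ac)
  qed
  then show ?case using C(1) by blast
next
  case (snd d f)
  then obtain C M where C: "C \<ge> 0" "\<And>u. norm (f u) \<le> C * (1 + norm u) ^ M" by blast
  have "norm (of_real (snd u) * f u) \<le> C * (1 + norm u) ^ Suc M" for u
  proof -
    have "\<bar>snd u\<bar> \<le> 1 + norm u" using norm_snd_le[of "snd u" "fst u"] by simp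
    then have "\<bar>snd u\<bar> * norm (f u) \<le> (1 + norm u) * (C * (1 + norm u) ^ M)"
      by (intro mult_mono C) auto
    then show ?thesis by (simp add: norm_mult mult_ac)
  qed
  then show ?case using C(1) by blast
next
  case (add d f g)
  then obtain C M D L where C: "C \<ge> 0" "\<And>u. norm (f u) \<le> C * (1 + norm u) ^ M"
    and D: "D \<ge> 0" "\<And>u. norm (g u) \<le> D * (1 + norm u) ^ L" by blast
  have "norm (f u + g u) \<le> (C + D) * (1 + norm u) ^ (M + L)" for u
  proof -
    have "(1 + norm u) ^ M \<le> (1 + norm u) ^ (M + L)" "(1 + norm u) ^ L \<le> (1 + norm u) ^ (M + L)"
      by (intro power_increasing; simp)+
    then have "C * (1 + norm u) ^ M \<le> C * (1 + norm u) ^ (M + L)"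
        "D * (1 + norm u) ^ L \<le> D * (1 + norm u) ^ (M + L)"
      using C(1) D(1) by (auto intro: mult_left_mono)
    then show ?thesis using norm_triangle_ineq[of "f u" "g u"] C(2)[of u] D(2)[of u]
      by (simp add: ring_distribs)
  qed
  then show ?case using C(1) D(1) by (meson add_nonneg_nonneg)
qed auto

lemma parity_poly_coeffs:
  assumes "parity_poly d f"
  shows "\<exists>q :: nat \<Rightarrow> nat \<Rightarrow> real. \<forall>x y. Re (f (x, y)) = (\<Sum>i\<le>d. \<Sum>k\<le>d - i. q i k * x ^ i * y ^ k)"
  using assms
proof induction
  case (const c)
  show ?case by (rule exI[of _ "\<lambda>i k. Re c"]) simp
next
  case (fst d f)
  then obtain q where q: "\<And>x y. Re (f (x, y)) = (\<Sum>i\<le>d. \<Sum>k\<le>d - i. q i k * x ^ i * y ^ k)"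
    by blast
  show ?case
    by (rule exI[of _ "\<lambda>i k. case i of 0 \<Rightarrow> 0 | Suc i' \<Rightarrow> q i' k"])
       (simp add: sum.atMost_Suc_shift q sum_distrib_left mult_ac del: sum.atMost_Suc)
next
  case (snd d f)
  then obtain q where q: "\<And>x y. Re (f (x, y)) = (\<Sum>i\<le>d. \<Sum>k\<le>d - i. q i k * x ^ i * y ^ k)"
    by blast
  let ?q = "\<lambda>i k. case k of 0 \<Rightarrow> 0 | Suc k' \<Rightarrow> q i k'"
  have "(\<Sum>i\<le>Suc d. \<Sum>k\<le>Suc d - i. ?q i k * x ^ i * y ^ k) = y * Re (f (x, y))" for x y
  proof -
    have "(\<Sum>i\<le>d. \<Sum>k\<le>Suc d - i. ?q i k * x ^ i * y ^ k)
        = (\<Sum>i\<le>d. \<Sum>k\<le>d - i. q i k * x ^ i * y ^ Suc k)"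
      by (rule sum.cong) (simp_all add: Suc_diff_le sum.atMost_Suc_shift del: sum.atMost_Suc power_Suc)
    then show ?thesis by (simp add: q sum_distrib_left mult_ac)
  qed
  then show ?case by (intro exI[of _ ?q]) simp
next
  case (add d f g)
  then obtain q r where
    "\<And>x y. Re (f (x, y)) = (\<Sum>i\<le>d. \<Sum>k\<le>d - i. q i k * x ^ i * y ^ k)"
    "\<And>x y. Re (g (x, y)) = (\<Sum>i\<le>d. \<Sum>k\<le>d - i. r i k * x ^ i * y ^ k)"
    by blast
  then show ?case
    by (intro exI[of _ "\<lambda>i k. q i k + r i k"]) (simp add: sum.distrib ring_distribs)
next
  case (lift d f)
  then obtain q where q: "\<And>x y. Re (f (x, y)) = (\<Sum>i\<le>d. \<Sum>k\<le>d - i. q i k * x ^ i * y ^ k)"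
    by blast
  let ?q = "\<lambda>i k. if i + k \<le> d then q i k else 0"
  have "(\<Sum>i\<le>d + 2. \<Sum>k\<le>d + 2 - i. ?q i k * x ^ i * y ^ k) = Re (f (x, y))" for x y
  proof -
    have "(\<Sum>i\<le>d + 2. \<Sum>k\<le>d + 2 - i. ?q i k * x ^ i * y ^ k)
        = (\<Sum>i\<le>d. \<Sum>k\<le>d + 2 - i. ?q i k * x ^ i * y ^ k)"
      by (rule sum.mono_neutral_right) (auto intro!: sum.neutral)
    also have "\<dots> = (\<Sum>i\<le>d. \<Sum>k\<le>d - i. ?q i k * x ^ i * y ^ k)"
      by (intro sum.cong refl sum.mono_neutral_right) auto
    also have "\<dots> = (\<Sum>i\<le>d. \<Sum>k\<le>d - i. q i k * x ^ i * y ^ k)"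
      by (intro sum.cong refl) auto
    finally show ?thesis by (simp add: q)
  qed
  then show ?case by (intro exI[of _ ?q]) simp
qed

section \<open>Fourier transforms of polynomials times a Gaussian\<close>

lemma integral_derivative_eq_0:
  fixes F f :: "real \<Rightarrow> complex"
  assumes "\<And>x. (F has_vector_derivative f x) (at x)" "\<And>x. isCont f x"
    and "integrable lborel f" "(F \<longlongrightarrow> 0) at_top" "(F \<longlongrightarrow> 0) at_bot"
  shows "(\<integral>x. f x \<partial>lborel) = 0"
proof -
  have "(LBINT x=-\<infinity>..\<infinity>. f x) = 0 - 0"
    by (rule interval_integral_FTC_integrable[where F = F])
       (use assms in \<open>auto simp: ereal_tendsto_simps set_integrable_def\<close>)
  then show ?thesis
    by (simp add: interval_lebesgue_integral_def set_lebesgue_integral_def)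
qed

lemma std_normal_density_power_tendsto_0:
  "((\<lambda>x. std_normal_density x * x ^ k) \<longlongrightarrow> 0) at_top"
  "((\<lambda>x. std_normal_density x * x ^ k) \<longlongrightarrow> 0) at_bot"
proof -
  have bound: "norm (std_normal_density x * x ^ k) \<le> \<bar>x\<bar> ^ k / exp \<bar>x\<bar>" if "\<bar>x\<bar> \<ge> 2" for x :: real
  proof -
    have "2 * \<bar>x\<bar> \<le> \<bar>x\<bar> * \<bar>x\<bar>" using that by (intro mult_right_mono) auto
    then have "\<bar>x\<bar> \<le> x\<^sup>2 / 2" by (simp add: power2_eq_square)
    then have "exp (- (x\<^sup>2 / 2)) \<le> exp (- \<bar>x\<bar>)" by simp
    moreover have "1 / sqrt (2 * pi) \<le> 1" using pi_gt3 by simp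
    ultimately have "1 / sqrt (2 * pi) * exp (- (x\<^sup>2 / 2)) \<le> 1 * exp (- \<bar>x\<bar>)"
      by (intro mult_mono) auto
    then have "std_normal_density x \<le> exp (- \<bar>x\<bar>)"
      by (simp add: std_normal_density_def)
    from mult_right_mono[OF this, of "\<bar>x\<bar> ^ k"] show ?thesis
      by (simp add: abs_mult power_abs normal_density_nonneg exp_minus field_simps)
  qed
  have lim: "((\<lambda>x::real. \<bar>x\<bar> ^ k / exp \<bar>x\<bar>) \<longlongrightarrow> 0) at_top"
      "((\<lambda>x::real. \<bar>x\<bar> ^ k / exp \<bar>x\<bar>) \<longlongrightarrow> 0) at_bot"
    by (rule filterlim_compose[OF tendsto_power_div_exp_0 filterlim_abs_real])
       (rule filterlim_compose[OF tendsto_power_div_exp_0],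
        simp add: filterlim_at_bot_mirror filterlim_abs_real)
  show "((\<lambda>x. std_normal_density x * x ^ k) \<longlongrightarrow> 0) at_top"
  proof (rule Lim_null_comparison[OF _ lim(1)])
    show "\<forall>\<^sub>F x in at_top. norm (std_normal_density x * x ^ k) \<le> \<bar>x\<bar> ^ k / exp \<bar>x\<bar>"
      using eventually_ge_at_top[of 2] by eventually_elim (rule bound, simp)
  qed
  show "((\<lambda>x. std_normal_density x * x ^ k) \<longlongrightarrow> 0) at_bot"
  proof (rule Lim_null_comparison[OF _ lim(2)])
    show "\<forall>\<^sub>F x in at_bot. norm (std_normal_density x * x ^ k) \<le> \<bar>x\<bar> ^ k / exp \<bar>x\<bar>"
      using eventually_le_at_bot[of "- 2"] by eventually_elim (rule bound, simp)
  qed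
qed

definition normal_moment :: "nat \<Rightarrow> real \<Rightarrow> complex" where
  "normal_moment k z = (\<integral>x. of_real (std_normal_density x * x ^ k) * iexp (- (z * x)) \<partial>lborel)"

lemma integrable_normal_moment:
  "integrable lborel (\<lambda>x. of_real (std_normal_density x * x ^ k) * iexp (- (z * x)))"
proof -
  have "norm (of_real (std_normal_density x * x ^ k) * iexp (- (z * x)))
      = norm (std_normal_density x * x ^ k)" for x
    by (simp add: norm_mult norm_exp_i_times del: of_real_mult of_real_minus)
  then show ?thesis
    by (intro Bochner_Integration.integrable_bound[OF integrable_std_normal_moment[of k]])
       (auto simp del: of_real_mult)
qed

lemma normal_moment_0: "normal_moment 0 z = of_real (exp (- (z\<^sup>2 / 2)))"
proof -
  have "normal_moment 0 z = char std_normal_distribution (- z)"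
    unfolding char_def normal_moment_def
    by (subst integral_density) (auto simp: scaleR_conv_of_real normal_density_nonneg)
  then show ?thesis by (simp add: char_std_normal_distribution)
qed

text \<open>Integrate the derivative of \<open>x ^ k\<close> times the oscillating Gaussian over the line. The two
  instances are the three-term recurrence of the Hermite polynomials.\<close>
lemma normal_moment_rec:
  "normal_moment (Suc 0) z = - \<i> * of_real z * normal_moment 0 z"
  "normal_moment (Suc (Suc k)) z =
     of_nat (Suc k) * normal_moment k z - \<i> * of_real z * normal_moment (Suc k) z"
proof -
  define F where "F k x = of_real (std_normal_density x * x ^ k) * iexp (- (z * x))" for k and x :: real
  have int: "integrable lborel (F k)" for k
    unfolding F_def by (rule integrable_normal_moment)
  have mom: "normal_moment k z = (\<integral>x. F k x \<partial>lborel)" for k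
    unfolding F_def normal_moment_def ..
  have cont: "isCont (F k) x" for k x
    unfolding F_def std_normal_density_def by (intro continuous_intros) auto
  have lim: "(F k \<longlongrightarrow> 0) at_top" "(F k \<longlongrightarrow> 0) at_bot" for k
    by (rule Lim_null_comparison[OF _ tendsto_norm_zero[OF std_normal_density_power_tendsto_0(1)[of k]]],
        simp add: F_def norm_mult norm_exp_i_times del: of_real_mult of_real_minus)
       (rule Lim_null_comparison[OF _ tendsto_norm_zero[OF std_normal_density_power_tendsto_0(2)[of k]]],
        simp add: F_def norm_mult norm_exp_i_times del: of_real_mult of_real_minus)
  have dens: "(std_normal_density has_real_derivative - x * std_normal_density x) (at x)" for x
    unfolding std_normal_density_def by (auto intro!: derivative_eq_intros simp: field_simps power2_eq_square)
  have d1: "((\<lambda>x. of_real (std_normal_density x * x ^ k)) has_vector_derivative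
      of_real (std_normal_density x * (real k * x ^ (k - 1)) - x * std_normal_density x * x ^ k)) (at x)" for k x
  proof -
    have "((\<lambda>x. std_normal_density x * x ^ k) has_real_derivative
      std_normal_density x * (real k * x ^ (k - 1)) - x * std_normal_density x * x ^ k) (at x)"
      by (rule derivative_eq_intros dens refl | simp)+
    then show ?thesis
      by (simp add: has_vector_derivative_of_real has_real_derivative_iff_has_vector_derivative del: of_real_mult of_real_diff)
  qed
  have d2: "((\<lambda>x. iexp (- (z * x))) has_vector_derivative - \<i> * of_real z * iexp (- (z * x))) (at x)" for x
  proof -
    have "((\<lambda>x. - (z * x)) has_real_derivative - z) (at x)" by (auto intro!: derivative_eq_intros)
    then have "((\<lambda>x. - (z * x)) has_vector_derivative - z) (at x)"
      by (simp add: has_real_derivative_iff_has_vector_derivative)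
    from vector_diff_chain_at[OF this has_vector_derivative_iexp]
    show ?thesis by (simp add: o_def scaleR_conv_of_real mult_ac)
  qed
  have deriv: "(F k has_vector_derivative
      (of_nat k * F (k - 1) x - F (Suc k) x - \<i> * of_real z * F k x)) (at x)" for k x
    unfolding F_def
    by (rule has_vector_derivative_eq_rhs[OF has_vector_derivative_mult[OF d1 d2]])
       (simp add: algebra_simps)
  have "(\<integral>x. of_nat k * F (k - 1) x - F (Suc k) x - \<i> * of_real z * F k x \<partial>lborel) = 0" for k
    by (rule integral_derivative_eq_0[OF deriv])
       (auto intro!: continuous_intros cont int lim Bochner_Integration.integrable_diff integrable_mult_right)
  then have zero: "of_nat k * normal_moment (k - 1) z - normal_moment (Suc k) z - \<i> * of_real z * normal_moment k z = 0" for k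
    using int by (simp add: mom)
  have *: "normal_moment (Suc k) z = of_nat k * normal_moment (k - 1) z - \<i> * of_real z * normal_moment k z" for k
    using zero[of k] by algebra
  show "normal_moment (Suc 0) z = - \<i> * of_real z * normal_moment 0 z"
    using *[of 0] by simp
  show "normal_moment (Suc (Suc k)) z =
     of_nat (Suc k) * normal_moment k z - \<i> * of_real z * normal_moment (Suc k) z"
    using *[of "Suc k"] by simp
qed

text \<open>\<open>(- \<i>) ^ k\<close> times the probabilists' Hermite polynomial.\<close>
fun herm :: "nat \<Rightarrow> real \<Rightarrow> complex" where
  "herm 0 z = 1"
| "herm (Suc 0) z = - \<i> * of_real z"
| "herm (Suc (Suc k)) z = of_nat (Suc k) * herm k z - \<i> * of_real z * herm (Suc k) z"

lemma normal_moment_eq_herm: "normal_moment k z = of_real (exp (- (z\<^sup>2 / 2))) * herm k z"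
  by (induction k z rule: herm.induct) (simp_all only: normal_moment_rec normal_moment_0 herm.simps; simp add: algebra_simps)+

lemma parity_poly_herm:
  "parity_poly k (\<lambda>u. herm k (fst u))" "parity_poly k (\<lambda>u. herm k (snd u))"
proof -
  have "parity_poly k (\<lambda>u. herm k (fst u)) \<and> parity_poly (Suc k) (\<lambda>u. herm (Suc k) (fst u))" for k
  proof (induction k)
    case 0
    have "parity_poly (Suc 0) (\<lambda>u. of_real (fst u) * (- \<i>))" by (intro parity_poly.intros)
    then show ?case using parity_poly.const[of 1] by (simp add: mult.commute)
  next
    case (Suc k)
    have "parity_poly (Suc (Suc k))
        (\<lambda>u. of_nat (Suc k) * herm k (fst u) - of_real (fst u) * (\<i> * herm (Suc k) (fst u)))"
      by (intro parity_poly_diff parity_poly_scale parity_poly.fst parity_poly.lift) (use Suc in auto)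
    then show ?case using Suc by (simp add: mult_ac del: of_nat_Suc)
  qed
  then show "parity_poly k (\<lambda>u. herm k (fst u))" by blast
  have "parity_poly k (\<lambda>u. herm k (snd u)) \<and> parity_poly (Suc k) (\<lambda>u. herm (Suc k) (snd u))" for k
  proof (induction k)
    case 0
    have "parity_poly (Suc 0) (\<lambda>u. of_real (snd u) * (- \<i>))" by (intro parity_poly.intros)
    then show ?case using parity_poly.const[of 1] by (simp add: mult.commute)
  next
    case (Suc k)
    have "parity_poly (Suc (Suc k))
        (\<lambda>u. of_nat (Suc k) * herm k (snd u) - of_real (snd u) * (\<i> * herm (Suc k) (snd u)))"
      by (intro parity_poly_diff parity_poly_scale parity_poly.snd parity_poly.lift) (use Suc in auto)
    then show ?case using Suc by (simp add: mult_ac del: of_nat_Suc)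
  qed
  then show "parity_poly k (\<lambda>u. herm k (snd u))" by blast
qed

lemma integral_product_lborel:
  fixes f g :: "real \<Rightarrow> 'a :: {real_normed_field, banach, second_countable_topology}"
  assumes f: "integrable lborel f" and g: "integrable lborel g"
  shows "integrable lborel (\<lambda>u. f (fst u) * g (snd u))"
    and "(\<integral>u. f (fst u) * g (snd u) \<partial>lborel) = (\<integral>x. f x \<partial>lborel) * (\<integral>x. g x \<partial>lborel)"
proof -
  have [measurable]: "f \<in> borel_measurable borel" "g \<in> borel_measurable borel"
    using borel_measurable_integrable[OF f] borel_measurable_integrable[OF g] by simp_all
  have int: "integrable (lborel \<Otimes>\<^sub>M lborel) (\<lambda>u. f (fst u) * g (snd u))"
    by (rule lborel_pair.Fubini_integrable)
       (use f g in \<open>auto simp: norm_mult intro!: integrable_mult_right integrable_mult_left\<close>)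
  then show "integrable lborel (\<lambda>u. f (fst u) * g (snd u))" by (simp add: lborel_prod)
  show "(\<integral>u. f (fst u) * g (snd u) \<partial>lborel) = (\<integral>x. f x \<partial>lborel) * (\<integral>x. g x \<partial>lborel)"
    using lborel_pair.integral_fst'[OF int] by (simp add: lborel_prod)
qed

definition std_gauss :: "real \<times> real \<Rightarrow> real" where
  "std_gauss u = exp (- ((norm u)\<^sup>2 / 2)) / (2 * pi)"

lemma std_gauss_product: "std_gauss u = std_normal_density (fst u) * std_normal_density (snd u)"
proof -
  have "sqrt (2 * pi) * sqrt (2 * pi) = 2 * pi" by simp
  then show ?thesis
    by (simp add: std_gauss_def std_normal_density_def power2_norm_eq_inner inner_prod_def
        mult_exp_exp flip: power2_eq_square) (simp add: power2_eq_square add_divide_distrib)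
qed

text \<open>The factor \<open>exp (norm z\<^sup>2 / 2)\<close> removes the Gaussian that every Fourier transform of a
  polynomial times \<open>std_gauss\<close> contains, so that polynomials are mapped to polynomials.\<close>
definition gauss_transform :: "(real \<times> real \<Rightarrow> complex) \<Rightarrow> real \<times> real \<Rightarrow> complex" where
  "gauss_transform f z =
     of_real (exp ((norm z)\<^sup>2 / 2)) * (\<integral>u. f u * of_real (std_gauss u) * iexp (- (z \<bullet> u)) \<partial>lborel)"

abbreviation monom2 :: "nat \<Rightarrow> nat \<Rightarrow> real \<times> real \<Rightarrow> complex" where
  "monom2 i k u \<equiv> of_real (fst u) ^ i * of_real (snd u) ^ k"

lemma gauss_transform_monom:
  shows integrable_gauss_monom:
    "integrable lborel (\<lambda>u. monom2 i k u * of_real (std_gauss u) * iexp (- (z \<bullet> u)))"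
    and "gauss_transform (monom2 i k) z = herm i (fst z) * herm k (snd z)"
proof -
  have eq: "monom2 i k u * of_real (std_gauss u) * iexp (- (z \<bullet> u)) =
      (of_real (std_normal_density (fst u) * fst u ^ i) * iexp (- (fst z * fst u))) *
      (of_real (std_normal_density (snd u) * snd u ^ k) * iexp (- (snd z * snd u)))" for u
    by (simp add: std_gauss_product inner_prod_def ring_distribs exp_add exp_diff exp_minus field_simps)
  show "integrable lborel (\<lambda>u. monom2 i k u * of_real (std_gauss u) * iexp (- (z \<bullet> u)))"
    unfolding eq by (intro integral_product_lborel integrable_normal_moment)
  have "gauss_transform (monom2 i k) z =
      of_real (exp ((norm z)\<^sup>2 / 2)) * (normal_moment i (fst z) * normal_moment k (snd z))"
    unfolding gauss_transform_def eq
    by (subst integral_product_lborel(2)[OF integrable_normal_moment integrable_normal_moment])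
       (simp add: normal_moment_def)
  also have "\<dots> = of_real (exp ((norm z)\<^sup>2 / 2) * exp (- ((fst z)\<^sup>2 / 2)) * exp (- ((snd z)\<^sup>2 / 2)))
      * (herm i (fst z) * herm k (snd z))"
    by (simp add: normal_moment_eq_herm mult_ac)
  also have "exp ((norm z)\<^sup>2 / 2) * exp (- ((fst z)\<^sup>2 / 2)) * exp (- ((snd z)\<^sup>2 / 2)) = (1 :: real)"
    by (simp add: power2_norm_eq_inner inner_prod_def flip: exp_add power2_eq_square)
       (simp add: power2_eq_square field_simps)
  finally show "gauss_transform (monom2 i k) z = herm i (fst z) * herm k (snd z)" by simp
qed

text \<open>The induction over \<open>parity_poly\<close> peels off one variable at a time and needs the extra monomial
  factor to collect them.\<close>
lemma gauss_monom_times_parity_poly: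
  assumes "parity_poly d f"
  shows "integrable lborel (\<lambda>u. monom2 i k u * f u * of_real (std_gauss u) * iexp (- (z \<bullet> u)))"
    and "parity_poly (i + k + d) (gauss_transform (\<lambda>u. monom2 i k u * f u))"
proof -
  have "(\<forall>z. integrable lborel (\<lambda>u. monom2 i k u * f u * of_real (std_gauss u) * iexp (- (z \<bullet> u))))
     \<and> parity_poly (i + k + d) (gauss_transform (\<lambda>u. monom2 i k u * f u))"
    using assms
  proof (induction arbitrary: i k)
    case (const c)
    have "gauss_transform (\<lambda>u. monom2 i k u * c) = (\<lambda>z. c * gauss_transform (monom2 i k) z)"
      using integral_mult_right_zero[of lborel c]
      by (simp add: gauss_transform_def fun_eq_iff mult_ac)
    then have "gauss_transform (\<lambda>u. monom2 i k u * c) = (\<lambda>z. c * (herm i (fst z) * herm k (snd z)))"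
      by (simp add: gauss_transform_monom fun_eq_iff)
    moreover have "integrable lborel (\<lambda>u. c * (monom2 i k u * of_real (std_gauss u) * iexp (- (z \<bullet> u))))" for z
      by (intro integrable_mult_right integrable_gauss_monom)
    ultimately show ?case
      by (auto simp: mult_ac intro!: parity_poly_scale parity_poly_mult parity_poly_herm)
  next
    case (fst d f)
    from fst.IH[of "Suc i" k] show ?case by (simp add: mult_ac)
  next
    case (snd d f)
    from snd.IH[of i "Suc k"] show ?case by (simp add: mult_ac)
  next
    case (add d f g)
    note IH = add.IH(1)[of i k] add.IH(2)[of i k]
    then have "gauss_transform (\<lambda>u. monom2 i k u * (f u + g u)) = (\<lambda>z.
        gauss_transform (\<lambda>u. monom2 i k u * f u) z + gauss_transform (\<lambda>u. monom2 i k u * g u) z)"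
      by (auto simp: gauss_transform_def ring_distribs fun_eq_iff)
    moreover have "integrable lborel (\<lambda>u. monom2 i k u * (f u + g u) * of_real (std_gauss u) * iexp (- (z \<bullet> u)))" for z
    proof -
      have "integrable lborel (\<lambda>u. monom2 i k u * f u * of_real (std_gauss u) * iexp (- (z \<bullet> u))
          + monom2 i k u * g u * of_real (std_gauss u) * iexp (- (z \<bullet> u)))"
        using IH by (intro Bochner_Integration.integrable_add) blast+
      then show ?thesis by (simp only: ring_distribs)
    qed
    ultimately show ?case using IH by (auto intro: parity_poly.add)
  next
    case (lift d f)
    from lift.IH[of i k] show ?case by (auto dest: parity_poly.lift)
  qed
  then show "integrable lborel (\<lambda>u. monom2 i k u * f u * of_real (std_gauss u) * iexp (- (z \<bullet> u)))"
    and "parity_poly (i + k + d) (gauss_transform (\<lambda>u. monom2 i k u * f u))" by blast+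
qed

lemma integrable_gauss_parity_poly:
  "parity_poly d f \<Longrightarrow> integrable lborel (\<lambda>u. f u * of_real (std_gauss u) * iexp (- (z \<bullet> u)))"
  using gauss_monom_times_parity_poly(1)[of d f 0 0] by simp

lemma parity_poly_gauss_transform: "parity_poly d f \<Longrightarrow> parity_poly d (gauss_transform f)"
  using gauss_monom_times_parity_poly(2)[of d f 0 0] by simp

lemma fourier_gauss_parity_poly:
  "(\<integral>u. f u * of_real (exp (- ((norm u)\<^sup>2 / 2))) * iexp (- (z \<bullet> u)) \<partial>lborel) =
     2 * pi * exp (- ((norm z)\<^sup>2 / 2)) * gauss_transform f z"
proof -
  have "f u * of_real (exp (- ((norm u)\<^sup>2 / 2))) * iexp (- (z \<bullet> u)) =
      2 * pi * (f u * of_real (std_gauss u) * iexp (- (z \<bullet> u)))" for u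
    by (simp add: std_gauss_def)
  then have "(\<integral>u. f u * of_real (exp (- ((norm u)\<^sup>2 / 2))) * iexp (- (z \<bullet> u)) \<partial>lborel) =
      2 * pi * (\<integral>u. f u * of_real (std_gauss u) * iexp (- (z \<bullet> u)) \<partial>lborel)"
    by (simp only: integral_mult_right_zero)
  also have "\<dots> = 2 * pi * of_real (exp (- ((norm z)\<^sup>2 / 2)) * exp ((norm z)\<^sup>2 / 2)) *
      (\<integral>u. f u * of_real (std_gauss u) * iexp (- (z \<bullet> u)) \<partial>lborel)"
    by (simp flip: exp_add)
  finally show ?thesis
    unfolding gauss_transform_def of_real_mult by (simp only: mult_ac of_real_eq_id id_apply)
qed

section \<open>Asymptotic expansions in a small parameter\<close>

text \<open>The parameter \<open>\<epsilon>\<close> stands for \<open>1 / sqrt n\<close>. On the set \<open>\<epsilon> * norm u ^ 3 \<le> 1\<close> the total third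
  order contribution \<open>n * (norm u / sqrt n) ^ 3\<close> to \<open>n\<close> factors is bounded, so that there only
  powers of \<open>norm u\<close> have to be kept track of; off this set \<open>1\<close> is bounded by any power of
  \<open>\<epsilon> * norm u ^ 3\<close>, and no expansion is needed.\<close>
definition poly_growth :: "nat \<Rightarrow> (real \<Rightarrow> real \<times> real \<Rightarrow> complex) \<Rightarrow> bool" where
  "poly_growth k f \<longleftrightarrow> (\<exists>C\<ge>0. \<exists>M. \<forall>\<epsilon> u. 0 < \<epsilon> \<and> \<epsilon> \<le> 1 \<and> \<epsilon> * norm u ^ 3 \<le> 1 \<longrightarrow>
     norm (f \<epsilon> u) \<le> C * \<epsilon> ^ k * (1 + norm u) ^ M)"

lemma poly_growthI:
  assumes "C \<ge> 0" "\<And>\<epsilon> u. 0 < \<epsilon> \<Longrightarrow> \<epsilon> \<le> 1 \<Longrightarrow> \<epsilon> * norm u ^ 3 \<le> 1 \<Longrightarrow>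
     norm (f \<epsilon> u) \<le> C * \<epsilon> ^ k * (1 + norm u) ^ M"
  shows "poly_growth k f"
  using assms unfolding poly_growth_def by blast

lemma poly_growth_add:
  assumes "poly_growth k f" "poly_growth k g"
  shows "poly_growth k (\<lambda>\<epsilon> u. f \<epsilon> u + g \<epsilon> u)"
proof -
  obtain C M where C: "C \<ge> 0" "\<And>\<epsilon> u. 0 < \<epsilon> \<Longrightarrow> \<epsilon> \<le> 1 \<Longrightarrow> \<epsilon> * norm u ^ 3 \<le> 1 \<Longrightarrow>
     norm (f \<epsilon> u) \<le> C * \<epsilon> ^ k * (1 + norm u) ^ M"
    using assms(1) unfolding poly_growth_def by blast
  obtain D L where D: "D \<ge> 0" "\<And>\<epsilon> u. 0 < \<epsilon> \<Longrightarrow> \<epsilon> \<le> 1 \<Longrightarrow> \<epsilon> * norm u ^ 3 \<le> 1 \<Longrightarrow>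
     norm (g \<epsilon> u) \<le> D * \<epsilon> ^ k * (1 + norm u) ^ L"
    using assms(2) unfolding poly_growth_def by blast
  show ?thesis
  proof (rule poly_growthI[of "C + D" _ _ "M + L"])
    fix \<epsilon> :: real and u :: "real \<times> real"
    assume e: "0 < \<epsilon>" "\<epsilon> \<le> 1" "\<epsilon> * norm u ^ 3 \<le> 1"
    have "C * \<epsilon> ^ k * (1 + norm u) ^ M \<le> C * \<epsilon> ^ k * (1 + norm u) ^ (M + L)"
        "D * \<epsilon> ^ k * (1 + norm u) ^ L \<le> D * \<epsilon> ^ k * (1 + norm u) ^ (M + L)"
      using C(1) D(1) e by (auto intro!: mult_left_mono power_increasing)
    then show "norm (f \<epsilon> u + g \<epsilon> u) \<le> (C + D) * \<epsilon> ^ k * (1 + norm u) ^ (M + L)"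
      using norm_triangle_ineq[of "f \<epsilon> u" "g \<epsilon> u"] C(2)[OF e] D(2)[OF e]
      by (simp add: ring_distribs)
  qed (use C(1) D(1) in auto)
qed

lemma poly_growth_mult:
  assumes "poly_growth k f" "poly_growth l g"
  shows "poly_growth (k + l) (\<lambda>\<epsilon> u. f \<epsilon> u * g \<epsilon> u)"
proof -
  obtain C M where C: "C \<ge> 0" "\<And>\<epsilon> u. 0 < \<epsilon> \<Longrightarrow> \<epsilon> \<le> 1 \<Longrightarrow> \<epsilon> * norm u ^ 3 \<le> 1 \<Longrightarrow>
     norm (f \<epsilon> u) \<le> C * \<epsilon> ^ k * (1 + norm u) ^ M"
    using assms(1) unfolding poly_growth_def by blast
  obtain D L where D: "D \<ge> 0" "\<And>\<epsilon> u. 0 < \<epsilon> \<Longrightarrow> \<epsilon> \<le> 1 \<Longrightarrow> \<epsilon> * norm u ^ 3 \<le> 1 \<Longrightarrow>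
     norm (g \<epsilon> u) \<le> D * \<epsilon> ^ l * (1 + norm u) ^ L"
    using assms(2) unfolding poly_growth_def by blast
  show ?thesis
  proof (rule poly_growthI[of "C * D" _ _ "M + L"])
    fix \<epsilon> :: real and u :: "real \<times> real"
    assume e: "0 < \<epsilon>" "\<epsilon> \<le> 1" "\<epsilon> * norm u ^ 3 \<le> 1"
    have "norm (f \<epsilon> u) * norm (g \<epsilon> u) \<le>
        (C * \<epsilon> ^ k * (1 + norm u) ^ M) * (D * \<epsilon> ^ l * (1 + norm u) ^ L)"
      by (intro mult_mono C(2)[OF e] D(2)[OF e]) (use C(1) e in auto)
    then show "norm (f \<epsilon> u * g \<epsilon> u) \<le> C * D * \<epsilon> ^ (k + l) * (1 + norm u) ^ (M + L)"
      by (simp add: norm_mult power_add mult_ac)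
  qed (use C(1) D(1) in auto)
qed

lemma poly_growth_mono:
  assumes "poly_growth l f" "k \<le> l"
  shows "poly_growth k f"
proof -
  obtain C M where C: "C \<ge> 0" "\<And>\<epsilon> u. 0 < \<epsilon> \<Longrightarrow> \<epsilon> \<le> 1 \<Longrightarrow> \<epsilon> * norm u ^ 3 \<le> 1 \<Longrightarrow>
     norm (f \<epsilon> u) \<le> C * \<epsilon> ^ l * (1 + norm u) ^ M"
    using assms(1) unfolding poly_growth_def by blast
  show ?thesis
  proof (rule poly_growthI[of C _ _ M])
    fix \<epsilon> :: real and u :: "real \<times> real"
    assume e: "0 < \<epsilon>" "\<epsilon> \<le> 1" "\<epsilon> * norm u ^ 3 \<le> 1"
    have "C * \<epsilon> ^ l * (1 + norm u) ^ M \<le> C * \<epsilon> ^ k * (1 + norm u) ^ M"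
      using C(1) e assms(2) by (intro mult_right_mono mult_left_mono power_decreasing) auto
    then show "norm (f \<epsilon> u) \<le> C * \<epsilon> ^ k * (1 + norm u) ^ M" using C(2)[OF e] by linarith
  qed (rule C(1))
qed

lemma poly_growth_zero: "poly_growth k (\<lambda>\<epsilon> u. 0)"
  by (rule poly_growthI[of 0]) auto

lemma poly_growth_sum:
  "(\<And>i. i \<in> I \<Longrightarrow> poly_growth k (f i)) \<Longrightarrow> poly_growth k (\<lambda>\<epsilon> u. \<Sum>i\<in>I. f i \<epsilon> u)"
  by (induction I rule: infinite_finite_induct) (auto intro: poly_growth_zero poly_growth_add)

lemma poly_growth_parity_poly:
  assumes "parity_poly d f"
  shows "poly_growth k (\<lambda>\<epsilon> u. of_real \<epsilon> ^ k * f u)"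
proof -
  obtain C M where C: "C \<ge> 0" "\<And>u. norm (f u) \<le> C * (1 + norm u) ^ M"
    using parity_poly_bound[OF assms] by blast
  show ?thesis
  proof (rule poly_growthI[OF C(1)])
    fix \<epsilon> :: real and u :: "real \<times> real" assume "0 < \<epsilon>"
    then show "norm (of_real \<epsilon> ^ k * f u) \<le> C * \<epsilon> ^ k * (1 + norm u) ^ M"
      using mult_left_mono[OF C(2)[of u], of "\<epsilon> ^ k"] by (simp add: norm_mult norm_power mult_ac)
  qed
qed

definition expands :: "(real \<Rightarrow> real \<times> real \<Rightarrow> complex) \<Rightarrow> (nat \<Rightarrow> real \<times> real \<Rightarrow> complex) \<Rightarrow> bool" where
  "expands f R \<longleftrightarrow> (\<forall>N. poly_growth (Suc N) (\<lambda>\<epsilon> u. f \<epsilon> u - (\<Sum>j\<le>N. of_real \<epsilon> ^ j * R j u)))"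

lemma expands_add:
  assumes "expands f R" "expands g S"
  shows "expands (\<lambda>\<epsilon> u. f \<epsilon> u + g \<epsilon> u) (\<lambda>j u. R j u + S j u)"
  unfolding expands_def
proof
  fix N :: nat
  show "poly_growth (Suc N) (\<lambda>\<epsilon> u. f \<epsilon> u + g \<epsilon> u - (\<Sum>j\<le>N. of_real \<epsilon> ^ j * (R j u + S j u)))"
    using poly_growth_add[OF assms(1)[unfolded expands_def, rule_format, of N]
        assms(2)[unfolded expands_def, rule_format, of N]]
    by (simp add: ring_distribs sum.distrib algebra_simps)
qed

lemma expands_const: "expands (\<lambda>\<epsilon> u. c) (\<lambda>j u. if j = 0 then c else 0)"
  unfolding expands_def
  by (auto simp: poly_growth_zero if_distrib[of "\<lambda>x. _ * x"] cong: if_cong)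

text \<open>The Cauchy product; the discarded terms \<open>\<epsilon> ^ (i + j)\<close> with \<open>i + j > N\<close> go into the error, which is
  why the coefficients must grow at most polynomially.\<close>
lemma expands_mult:
  assumes f: "expands f R" and g: "expands g S"
    and R: "\<And>j. parity_poly (d j) (R j)" and S: "\<And>j. parity_poly (e j) (S j)"
  shows "expands (\<lambda>\<epsilon> u. f \<epsilon> u * g \<epsilon> u) (\<lambda>j u. \<Sum>i\<le>j. R i u * S (j - i) u)"
  unfolding expands_def
proof
  fix N :: nat
  define F where "F \<epsilon> u = (\<Sum>j\<le>N. of_real \<epsilon> ^ j * R j u)" for \<epsilon> :: real and u
  define G where "G \<epsilon> u = (\<Sum>j\<le>N. of_real \<epsilon> ^ j * S j u)" for \<epsilon> :: real and u
  define T where "T \<epsilon> u = (\<lambda>(i, j). of_real \<epsilon> ^ i * R i u * (of_real \<epsilon> ^ j * S j u))" for \<epsilon> :: real and u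
  let ?B = "{..N} \<times> {..N}" and ?L = "{(i, j). i + j \<le> N}"
  have fF: "poly_growth (Suc N) (\<lambda>\<epsilon> u. f \<epsilon> u - F \<epsilon> u)" and gG: "poly_growth (Suc N) (\<lambda>\<epsilon> u. g \<epsilon> u - G \<epsilon> u)"
    using f g unfolding expands_def F_def G_def by blast+
  have F0: "poly_growth 0 F" and G0: "poly_growth 0 G"
    unfolding F_def G_def
    by (intro poly_growth_sum poly_growth_mono[OF poly_growth_parity_poly[OF R]]
        poly_growth_mono[OF poly_growth_parity_poly[OF S]]; simp)+
  have g0: "poly_growth 0 g"
    using poly_growth_add[OF poly_growth_mono[OF gG, of 0] G0] by simp
  have rest: "poly_growth (Suc N) (\<lambda>\<epsilon> u. \<Sum>p\<in>?B - ?L. T \<epsilon> u p)"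
  proof (rule poly_growth_sum)
    fix p assume "p \<in> ?B - ?L"
    then obtain i j where p: "p = (i, j)" and "Suc N \<le> i + j" by fastforce
    from this(2) show "poly_growth (Suc N) (\<lambda>\<epsilon> u. T \<epsilon> u p)"
      unfolding T_def p prod.case
      by (rule poly_growth_mono[OF poly_growth_mult[OF poly_growth_parity_poly[OF R] poly_growth_parity_poly[OF S]]])
  qed
  have split: "F \<epsilon> u * G \<epsilon> u = (\<Sum>j\<le>N. of_real \<epsilon> ^ j * (\<Sum>i\<le>j. R i u * S (j - i) u)) + (\<Sum>p\<in>?B - ?L. T \<epsilon> u p)"
    for \<epsilon> u
  proof -
    have "F \<epsilon> u * G \<epsilon> u = (\<Sum>p\<in>?B. T \<epsilon> u p)"
      by (simp add: F_def G_def T_def sum_product sum.cartesian_product)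
    also have "\<dots> = (\<Sum>p\<in>?L. T \<epsilon> u p) + (\<Sum>p\<in>?B - ?L. T \<epsilon> u p)"
    proof -
      have "?L \<subseteq> ?B" by auto
      from sum.subset_diff[OF this, of "T \<epsilon> u"] show ?thesis by (simp add: add.commute)
    qed
    also have "(\<Sum>p\<in>?L. T \<epsilon> u p) = (\<Sum>j\<le>N. \<Sum>i\<le>j. of_real \<epsilon> ^ i * R i u * (of_real \<epsilon> ^ (j - i) * S (j - i) u))"
      unfolding T_def by (rule sum.triangle_reindex_eq)
    also have "\<dots> = (\<Sum>j\<le>N. of_real \<epsilon> ^ j * (\<Sum>i\<le>j. R i u * S (j - i) u))"
      unfolding sum_distrib_left
      by (intro sum.cong refl) (auto simp: mult_ac simp flip: power_add)
    finally show ?thesis .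
  qed
  have "poly_growth (Suc N) (\<lambda>\<epsilon> u. (f \<epsilon> u - F \<epsilon> u) * g \<epsilon> u + F \<epsilon> u * (g \<epsilon> u - G \<epsilon> u) + (\<Sum>p\<in>?B - ?L. T \<epsilon> u p))"
    by (intro poly_growth_add rest poly_growth_mono[OF poly_growth_mult[OF fF g0]]
        poly_growth_mono[OF poly_growth_mult[OF F0 gG]]) auto
  then show "poly_growth (Suc N) (\<lambda>\<epsilon> u. f \<epsilon> u * g \<epsilon> u -
      (\<Sum>j\<le>N. of_real \<epsilon> ^ j * (\<Sum>i\<le>j. R i u * S (j - i) u)))"
    using split by (simp add: algebra_simps)
qed

lemma expands_scale:
  assumes "expands f R"
  shows "expands (\<lambda>\<epsilon> u. c * f \<epsilon> u) (\<lambda>j u. c * R j u)"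
  unfolding expands_def
proof
  fix N :: nat
  have "poly_growth 0 (\<lambda>\<epsilon> u. c)"
    by (rule poly_growthI[of "norm c" _ _ 0]) auto
  from poly_growth_mult[OF this assms[unfolded expands_def, rule_format, of N]]
  show "poly_growth (Suc N) (\<lambda>\<epsilon> u. c * f \<epsilon> u - (\<Sum>j\<le>N. of_real \<epsilon> ^ j * (c * R j u)))"
    by (simp add: right_diff_distrib sum_distrib_left mult_ac)
qed

lemma expands_sum:
  "(\<And>i. i \<in> I \<Longrightarrow> expands (f i) (R i)) \<Longrightarrow>
    expands (\<lambda>\<epsilon> u. \<Sum>i\<in>I. f i \<epsilon> u) (\<lambda>j u. \<Sum>i\<in>I. R i j u)"
proof (induction I rule: infinite_finite_induct)
  case (insert x F)
  then show ?case using expands_add[of "f x" "R x"] by simp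
qed (use expands_const[of 0] in simp_all)

lemma expands_iexp:
  "expands (\<lambda>\<epsilon> u. iexp (x \<bullet> (\<epsilon> *\<^sub>R u))) (\<lambda>j u. (\<i> * of_real (x \<bullet> u)) ^ j / fact j)"
  unfolding expands_def
proof
  fix N :: nat
  show "poly_growth (Suc N) (\<lambda>\<epsilon> u. iexp (x \<bullet> (\<epsilon> *\<^sub>R u)) - (\<Sum>j\<le>N. of_real \<epsilon> ^ j * ((\<i> * of_real (x \<bullet> u)) ^ j / fact j)))"
  proof (rule poly_growthI[of "norm x ^ Suc N" _ _ "Suc N"])
    fix \<epsilon> :: real and u :: "real \<times> real" assume e: "0 < \<epsilon>"
    have "norm (iexp (\<epsilon> * (x \<bullet> u)) - (\<Sum>j\<le>N. (\<i> * of_real (\<epsilon> * (x \<bullet> u))) ^ j / fact j))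
        \<le> \<bar>\<epsilon> * (x \<bullet> u)\<bar> ^ Suc N / fact (Suc N)"
      by (rule iexp_approx1)
    also have "\<dots> \<le> \<bar>\<epsilon> * (x \<bullet> u)\<bar> ^ Suc N / 1"
      by (intro divide_left_mono) (auto simp: fact_ge_1 simp del: fact_Suc)
    also have "\<dots> \<le> (\<epsilon> * (norm x * (1 + norm u))) ^ Suc N"
    proof -
      have "\<bar>x \<bullet> u\<bar> \<le> norm x * (1 + norm u)"
        using Cauchy_Schwarz_ineq2[of x u] norm_ge_zero[of x] unfolding distrib_left mult_1_right
        by linarith
      then show ?thesis using e by (auto simp: abs_mult intro!: power_mono mult_left_mono simp del: power_Suc)
    qed
    finally show "norm (iexp (x \<bullet> (\<epsilon> *\<^sub>R u)) - (\<Sum>j\<le>N. of_real \<epsilon> ^ j * ((\<i> * of_real (x \<bullet> u)) ^ j / fact j)))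
        \<le> norm x ^ Suc N * \<epsilon> ^ Suc N * (1 + norm u) ^ Suc N"
      by (simp add: power_mult_distrib mult_ac del: power_Suc)
  qed auto
qed

definition exp_norm_sq_coeff :: "nat \<Rightarrow> real \<times> real \<Rightarrow> complex" where
  "exp_norm_sq_coeff j u = (if even j then (of_real ((norm u)\<^sup>2) / 2) ^ (j div 2) / fact (j div 2) else 0)"

lemma eps_norm_le_1:
  assumes "0 < \<epsilon>" "\<epsilon> \<le> 1" "\<epsilon> * norm u ^ 3 \<le> (1 :: real)"
  shows "\<epsilon> * norm u \<le> 1"
proof (cases "norm u \<le> 1")
  case True then show ?thesis using assms by (simp add: mult_le_one)
next
  case False
  then have "norm u ^ 1 \<le> norm u ^ 3" by (intro power_increasing) auto
  then have "\<epsilon> * norm u ^ 1 \<le> \<epsilon> * norm u ^ 3" using assms(1) by (intro mult_left_mono) auto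
  then show ?thesis using assms(3) by simp
qed

lemma expands_exp_norm_sq:
  "expands (\<lambda>\<epsilon> u. of_real (exp ((norm (\<epsilon> *\<^sub>R u))\<^sup>2 / 2))) exp_norm_sq_coeff"
  unfolding expands_def
proof
  fix N :: nat
  define L where "L = N div 2"
  have even_sum: "(\<Sum>j\<le>N. if even j then a (j div 2) else 0) = (\<Sum>l\<le>N div 2. a l)" for a :: "nat \<Rightarrow> complex" and N
    by (induction N) (auto elim!: evenE oddE)
  show "poly_growth (Suc N) (\<lambda>\<epsilon> u. of_real (exp ((norm (\<epsilon> *\<^sub>R u))\<^sup>2 / 2)) - (\<Sum>j\<le>N. of_real \<epsilon> ^ j * exp_norm_sq_coeff j u))"
  proof (rule poly_growthI[of "exp (1/2)" _ _ "2 * Suc L"])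
    fix \<epsilon> :: real and u :: "real \<times> real"
    assume e: "0 < \<epsilon>" "\<epsilon> \<le> 1" "\<epsilon> * norm u ^ 3 \<le> 1"
    define z :: complex where "z = of_real ((\<epsilon> * norm u)\<^sup>2 / 2)"
    have z: "(norm (\<epsilon> *\<^sub>R u))\<^sup>2 / 2 = (\<epsilon> * norm u)\<^sup>2 / 2"
      using e by simp
    have exp_z: "of_real (exp ((\<epsilon> * norm u)\<^sup>2 / 2)) = exp z"
      unfolding z_def by (rule exp_of_real[symmetric])
    have z0: "norm z = (\<epsilon> * norm u)\<^sup>2 / 2" "Re z = (\<epsilon> * norm u)\<^sup>2 / 2"
      unfolding z_def norm_of_real by simp_all
    have "(\<epsilon> * norm u)\<^sup>2 \<le> 1\<^sup>2" using eps_norm_le_1[OF e] e by (intro power_mono) auto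
    then have z1: "exp \<bar>Re z\<bar> \<le> exp (1/2)" unfolding z0 by simp
    have sum: "(\<Sum>j\<le>N. of_real \<epsilon> ^ j * exp_norm_sq_coeff j u) = (\<Sum>l\<le>L. z ^ l / fact l)"
    proof -
      have "of_real \<epsilon> ^ j * exp_norm_sq_coeff j u = (if even j then z ^ (j div 2) / fact (j div 2) else 0)" for j
        by (auto simp: exp_norm_sq_coeff_def z_def power_mult_distrib power_divide power_mult elim!: evenE)
      then show ?thesis unfolding L_def using even_sum[of "\<lambda>l. z ^ l / fact l" N] by simp
    qed
    have "norm (exp z - (\<Sum>l\<le>L. z ^ l / fact l)) \<le> exp \<bar>Re z\<bar> * norm z ^ Suc L / fact L"
      by (rule Taylor_exp)
    also have "\<dots> \<le> exp (1/2) * norm z ^ Suc L / 1"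
      using z1 by (intro frac_le mult_right_mono) (auto simp: fact_ge_1)
    also have "\<dots> \<le> exp (1/2) * ((\<epsilon> * (1 + norm u))\<^sup>2) ^ Suc L"
    proof -
      have "(\<epsilon> * norm u)\<^sup>2 \<le> (\<epsilon> * (1 + norm u))\<^sup>2" using e by (intro power_mono mult_left_mono) auto
      moreover have "0 \<le> (\<epsilon> * norm u)\<^sup>2" by simp
      ultimately have "norm z \<le> (\<epsilon> * (1 + norm u))\<^sup>2" unfolding z0 by linarith
      then show ?thesis by (auto intro!: power_mono simp del: power_Suc)
    qed
    also have "\<dots> = exp (1/2) * (\<epsilon> ^ (2 * Suc L) * (1 + norm u) ^ (2 * Suc L))"
      by (simp only: power_mult_distrib power_mult)
    also have "\<dots> \<le> exp (1/2) * (\<epsilon> ^ Suc N * (1 + norm u) ^ (2 * Suc L))"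
      using e unfolding L_def by (intro mult_left_mono mult_right_mono power_decreasing) auto
    finally show "norm (of_real (exp ((norm (\<epsilon> *\<^sub>R u))\<^sup>2 / 2)) - (\<Sum>j\<le>N. of_real \<epsilon> ^ j * exp_norm_sq_coeff j u))
        \<le> exp (1/2) * \<epsilon> ^ Suc N * (1 + norm u) ^ (2 * Suc L)"
      using e unfolding sum by (simp add: z exp_z mult.assoc del: power_Suc mult_Suc_right)
  qed auto
qed

lemma parity_poly_exp_norm_sq_coeff: "parity_poly j (exp_norm_sq_coeff j)"
proof (cases "even j")
  case True
  have "parity_poly (j div 2 * 2) (\<lambda>u. (of_real ((norm u)\<^sup>2) / 2) ^ (j div 2) / fact (j div 2))"
    by (intro parity_poly_divide parity_poly_power parity_poly_norm_sq)
  then show ?thesis using True by (simp add: exp_norm_sq_coeff_def[abs_def])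
next
  case False then show ?thesis by (simp add: exp_norm_sq_coeff_def[abs_def] parity_poly_zero)
qed

section \<open>Powers of the characteristic function of a centred isotropic step distribution\<close>

lemma exp_partial_sum_le:
  fixes x :: real
  assumes "x \<ge> 0"
  shows "(\<Sum>k\<le>n. x ^ k / fact k) \<le> exp x"
  using sum_le_suminf[OF summable_exp[of x], of "{..n}"] assms
  by (simp add: exp_def scaleR_conv_of_real divide_inverse mult.commute)

text \<open>With \<open>x = n * norm r\<close>, the terms with \<open>k > N\<close> are dominated by those of \<open>x ^ Suc N * exp x\<close>.\<close>
lemma binomial_tail_bound:
  fixes r :: complex
  shows "norm ((1 + r) ^ n - (\<Sum>k\<le>N. of_nat (n choose k) * r ^ k))
     \<le> (real n * norm r) ^ Suc N * exp (real n * norm r)"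
proof -
  define x where "x = real n * norm r"
  have x: "x \<ge> 0" unfolding x_def by simp
  have "(1 + r) ^ n = (\<Sum>k\<le>n. of_nat (n choose k) * r ^ k)"
    by (subst add.commute) (simp add: binomial_ring)
  also have "\<dots> = (\<Sum>k\<le>n + Suc N. of_nat (n choose k) * r ^ k)"
    by (rule sum.mono_neutral_left) (auto simp: binomial_eq_0)
  also have "\<dots> = (\<Sum>k\<le>N. of_nat (n choose k) * r ^ k) + (\<Sum>k\<in>{Suc N..n + Suc N}. of_nat (n choose k) * r ^ k)"
  proof -
    have "{..n + Suc N} = {..N} \<union> {Suc N..n + Suc N}" by auto
    then show ?thesis by (simp add: sum.union_disjoint)
  qed
  finally have "norm ((1 + r) ^ n - (\<Sum>k\<le>N. of_nat (n choose k) * r ^ k))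
      = norm (\<Sum>k\<in>{Suc N..n + Suc N}. of_nat (n choose k) * r ^ k)" by simp
  also have "\<dots> \<le> (\<Sum>k\<in>{0 + Suc N..n + Suc N}. x ^ k / fact k)"
  proof (unfold add_0, rule sum_norm_le)
    fix k
    have "real (n choose k) * fact k \<le> real n ^ k"
      using binomial_fact_pow[of n k] by (metis of_nat_fact of_nat_le_iff of_nat_mult of_nat_power)
    then have "real (n choose k) \<le> real n ^ k / fact k" by (simp add: field_simps)
    from mult_right_mono[OF this, of "norm r ^ k"]
    show "norm (of_nat (n choose k) * r ^ k) \<le> x ^ k / fact k"
      by (simp add: norm_mult norm_power x_def power_mult_distrib)
  qed
  also have "\<dots> = (\<Sum>k\<le>n. x ^ (k + Suc N) / fact (k + Suc N))"
    by (subst sum.shift_bounds_cl_nat_ivl) (simp add: atLeast0AtMost)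
  also have "\<dots> \<le> (\<Sum>k\<le>n. x ^ Suc N * (x ^ k / fact k))"
  proof (rule sum_mono)
    fix k
    have "x ^ (k + Suc N) / fact (k + Suc N) \<le> x ^ (k + Suc N) / fact k"
      using x by (intro divide_left_mono fact_mono) auto
    then show "x ^ (k + Suc N) / fact (k + Suc N) \<le> x ^ Suc N * (x ^ k / fact k)"
      by (simp add: power_add mult_ac del: fact_Suc)
  qed
  also have "\<dots> = x ^ Suc N * (\<Sum>k\<le>n. x ^ k / fact k)" by (simp add: sum_distrib_left)
  also have "\<dots> \<le> x ^ Suc N * exp x"
    using x by (intro mult_left_mono exp_partial_sum_le) auto
  finally show ?thesis unfolding x_def .
qed

locale isotropic_steps =
  fixes K :: "'k set" and w :: "'k \<Rightarrow> real" and \<xi> :: "'k \<Rightarrow> real \<times> real"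
  assumes finite_K: "finite K"
    and w_nonneg: "\<And>k. k \<in> K \<Longrightarrow> 0 \<le> w k"
    and w_sum: "(\<Sum>k\<in>K. w k) = 1"
    and mean: "\<And>u. (\<Sum>k\<in>K. w k * (\<xi> k \<bullet> u)) = 0"
    and cov: "\<And>u. (\<Sum>k\<in>K. w k * (\<xi> k \<bullet> u)\<^sup>2) = (norm u)\<^sup>2"
begin

definition chi :: "real \<times> real \<Rightarrow> complex" where
  "chi u = (\<Sum>k\<in>K. of_real (w k) * iexp (\<xi> k \<bullet> u))"

text \<open>The relative error of the Gaussian approximation to one factor.\<close>
definition rem :: "real \<times> real \<Rightarrow> complex" where
  "rem u = chi u * of_real (exp ((norm u)\<^sup>2 / 2)) - 1"

definition moment_coeff :: "nat \<Rightarrow> real \<times> real \<Rightarrow> complex" where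
  "moment_coeff i u = (\<Sum>k\<in>K. of_real (w k) * ((\<i> * of_real (\<xi> k \<bullet> u)) ^ i / fact i))"

definition rem_coeff :: "nat \<Rightarrow> real \<times> real \<Rightarrow> complex" where
  "rem_coeff j u = (\<Sum>i\<le>j. moment_coeff i u * exp_norm_sq_coeff (j - i) u) - (if j = 0 then 1 else 0)"

lemma parity_poly_moment_coeff: "parity_poly i (moment_coeff i)"
proof -
  have "parity_poly (i * 1) (\<lambda>u. \<Sum>k\<in>K. of_real (w k) * ((\<i> * of_real (\<xi> k \<bullet> u)) ^ i / fact i))"
    by (intro parity_poly_sum parity_poly_scale parity_poly_divide parity_poly_power parity_poly_linear)
  then show ?thesis by (simp add: moment_coeff_def[abs_def])
qed

lemma parity_poly_rem_coeff: "parity_poly j (rem_coeff j)"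
proof -
  have "parity_poly j (\<lambda>u. moment_coeff i u * exp_norm_sq_coeff (j - i) u)" if "i \<le> j" for i
    using parity_poly_mult[OF parity_poly_moment_coeff parity_poly_exp_norm_sq_coeff, of i "j - i"] that
    by simp
  moreover have "parity_poly j (\<lambda>u. if j = 0 then 1 else 0)"
    by (auto intro: parity_poly_zero parity_poly.const)
  ultimately show ?thesis
    unfolding rem_coeff_def[abs_def] by (intro parity_poly_diff parity_poly_sum) auto
qed

lemma expands_rem: "expands (\<lambda>\<epsilon> u. rem (\<epsilon> *\<^sub>R u)) rem_coeff"
proof -
  have "expands (\<lambda>\<epsilon> u. chi (\<epsilon> *\<^sub>R u)) moment_coeff"
    unfolding chi_def moment_coeff_def[abs_def]
    by (intro expands_sum expands_scale expands_iexp)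
  from expands_add[OF expands_mult[OF this expands_exp_norm_sq
        parity_poly_moment_coeff parity_poly_exp_norm_sq_coeff] expands_const[of "-1"]]
  show ?thesis
    unfolding rem_def rem_coeff_def[abs_def]
    by (simp add: if_distrib[of "\<lambda>x. - x"] diff_conv_add_uminus cong: if_cong del: add_uminus_conv_diff)
qed

lemma exp_norm_sq_coeff_simps:
  "exp_norm_sq_coeff 0 u = 1" "exp_norm_sq_coeff (Suc 0) u = 0"
  "exp_norm_sq_coeff 2 u = of_real ((norm u)\<^sup>2) / 2" "exp_norm_sq_coeff 3 u = 0"
  "exp_norm_sq_coeff 4 u = (of_real ((norm u)\<^sup>2))\<^sup>2 / 8"
  by (simp_all add: exp_norm_sq_coeff_def power_divide)

lemma moment_coeff_simps:
  "moment_coeff 0 u = 1" "moment_coeff (Suc 0) u = 0"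
  "moment_coeff 2 u = - of_real ((norm u)\<^sup>2) / 2"
  "moment_coeff 3 u = - \<i> * of_real (\<Sum>k\<in>K. w k * (\<xi> k \<bullet> u) ^ 3) / 6"
  "moment_coeff 4 u = of_real (\<Sum>k\<in>K. w k * (\<xi> k \<bullet> u) ^ 4) / 24"
proof -
  have gen: "moment_coeff i u = \<i> ^ i / fact i * of_real (\<Sum>k\<in>K. w k * (\<xi> k \<bullet> u) ^ i)" for i
    by (simp add: moment_coeff_def sum_distrib_left power_mult_distrib mult_ac)
  show "moment_coeff 0 u = 1" "moment_coeff (Suc 0) u = 0"
    "moment_coeff 2 u = - of_real ((norm u)\<^sup>2) / 2"
    unfolding gen by (simp_all add: w_sum mean cov del: of_real_sum)
  show "moment_coeff 3 u = - \<i> * of_real (\<Sum>k\<in>K. w k * (\<xi> k \<bullet> u) ^ 3) / 6"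
    "moment_coeff 4 u = of_real (\<Sum>k\<in>K. w k * (\<xi> k \<bullet> u) ^ 4) / 24"
    unfolding gen by (simp_all add: fact_numeral power3_eq_cube power4_eq_xxxx del: of_real_sum)
qed

text \<open>The first two moments of the steps are those of the Gaussian, so the error is of third order.\<close>
lemma rem_coeff_simps:
  "rem_coeff 0 u = 0" "rem_coeff (Suc 0) u = 0" "rem_coeff 2 u = 0"
  "rem_coeff 3 u = - \<i> * of_real (\<Sum>k\<in>K. w k * (\<xi> k \<bullet> u) ^ 3) / 6"
  "rem_coeff 4 u = of_real (\<Sum>k\<in>K. w k * (\<xi> k \<bullet> u) ^ 4) / 24 - (of_real ((norm u)\<^sup>2))\<^sup>2 / 8"
proof -
  have split: "(\<Sum>i\<le>2. f i) = f 0 + f (Suc 0) + f 2" "(\<Sum>i\<le>3. f i) = f 0 + f (Suc 0) + f 2 + f 3"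
    "(\<Sum>i\<le>4. f i) = f 0 + f (Suc 0) + f 2 + f 3 + f 4" for f :: "nat \<Rightarrow> complex"
    by (simp_all add: eval_nat_numeral)
  show "rem_coeff 0 u = 0" "rem_coeff (Suc 0) u = 0" "rem_coeff 2 u = 0"
    "rem_coeff 3 u = - \<i> * of_real (\<Sum>k\<in>K. w k * (\<xi> k \<bullet> u) ^ 3) / 6"
    "rem_coeff 4 u = of_real (\<Sum>k\<in>K. w k * (\<xi> k \<bullet> u) ^ 4) / 24 - (of_real ((norm u)\<^sup>2))\<^sup>2 / 8"
    unfolding rem_coeff_def split
    by (simp_all add: exp_norm_sq_coeff_simps moment_coeff_simps power2_eq_square del: of_real_sum)
qed

lemma rem_coeff_Suc_Suc_0: "rem_coeff (Suc (Suc 0)) u = 0"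
  using rem_coeff_simps(3) by (simp add: numeral_2_eq_2)

text \<open>Rescale to a unit vector, where the expansion of \<open>rem\<close> has a uniform error term.\<close>
lemma rem_cubic_bound: "\<exists>C\<ge>0. \<forall>v. norm v \<le> 1 \<longrightarrow> norm (rem v) \<le> C * norm v ^ 3"
proof -
  have "poly_growth (Suc 2) (\<lambda>\<epsilon> u. rem (\<epsilon> *\<^sub>R u) - (\<Sum>j\<le>2. of_real \<epsilon> ^ j * rem_coeff j u))"
    using expands_rem unfolding expands_def by blast
  then have "poly_growth 3 (\<lambda>\<epsilon> u. rem (\<epsilon> *\<^sub>R u))"
    by (simp add: rem_coeff_simps(1,2) rem_coeff_Suc_Suc_0 eval_nat_numeral)
  then obtain C M where C: "C \<ge> 0" "\<And>\<epsilon> u. 0 < \<epsilon> \<Longrightarrow> \<epsilon> \<le> 1 \<Longrightarrow> \<epsilon> * norm u ^ 3 \<le> 1 \<Longrightarrow>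
      norm (rem (\<epsilon> *\<^sub>R u)) \<le> C * \<epsilon> ^ 3 * (1 + norm u) ^ M"
    unfolding poly_growth_def by blast
  have "norm (rem v) \<le> C * 2 ^ M * norm v ^ 3" if "norm v \<le> 1" for v
  proof (cases "v = 0")
    case True
    then show ?thesis using w_sum by (simp add: rem_def chi_def flip: of_real_sum)
  next
    case False
    then have "norm (v /\<^sub>R norm v) = 1" "norm v *\<^sub>R (v /\<^sub>R norm v) = v" by simp_all
    then show ?thesis using C(2)[of "norm v" "v /\<^sub>R norm v"] that False by (simp add: mult_ac)
  qed
  then show ?thesis using C(1) by (intro exI[of _ "C * 2 ^ M"]) auto
qed

text \<open>The coefficients of \<open>(n choose k) * rem ^ k\<close>, where \<open>n = 1 / \<epsilon>\<^sup>2\<close>. The recursion multiplies by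
  \<open>(n - k) * rem / (k + 1)\<close>; the factor \<open>n\<close> lowers the order of \<open>rem\<close> by two.\<close>
fun binom_coeff :: "nat \<Rightarrow> nat \<Rightarrow> real \<times> real \<Rightarrow> complex" where
  "binom_coeff 0 j u = (if j = 0 then 1 else 0)"
| "binom_coeff (Suc k) j u = (\<Sum>i\<le>j. binom_coeff k i u *
     (1 / of_nat (Suc k) * (rem_coeff (j - i + 2) u + (- of_nat k) * rem_coeff (j - i) u)))"

lemma parity_poly_step_coeff:
  "parity_poly (3 * j) (\<lambda>u. c * (rem_coeff (j + 2) u + b * rem_coeff j u))"
proof (cases "j = 0")
  case True then show ?thesis
    by (simp add: rem_coeff_simps parity_poly_zero flip: One_nat_def numeral_2_eq_2)
next
  case False
  then have "parity_poly (3 * j) (rem_coeff (j + 2))" "parity_poly (3 * j) (rem_coeff j)"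
    by (auto intro: parity_poly_mono[OF parity_poly_rem_coeff])
  then show ?thesis by (intro parity_poly_scale parity_poly.add)
qed

lemma parity_poly_binom_coeff: "parity_poly (3 * j) (binom_coeff k j)"
proof (induction k arbitrary: j)
  case 0
  then show ?case by (auto intro: parity_poly_zero parity_poly.const simp: fun_eq_iff)
next
  case (Suc k)
  have "parity_poly (3 * j) (\<lambda>u. binom_coeff k i u *
     (1 / of_nat (Suc k) * (rem_coeff (j - i + 2) u + (- of_nat k) * rem_coeff (j - i) u)))" if "i \<le> j" for i
  proof -
    have "3 * i + 3 * (j - i) = 3 * j" using that by simp
    with parity_poly_mult[OF Suc parity_poly_step_coeff[of "j - i"], of i] show ?thesis by (simp only:)
  qed
  moreover have "binom_coeff (Suc k) j = (\<lambda>u. \<Sum>i\<le>j. binom_coeff k i u *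
     (1 / of_nat (Suc k) * (rem_coeff (j - i + 2) u + (- of_nat k) * rem_coeff (j - i) u)))"
    by (rule ext) (rule binom_coeff.simps)
  ultimately show ?case by (auto intro!: parity_poly_sum simp only: atMost_iff)
qed

lemma binom_coeff_eq_0: "j < k \<Longrightarrow> binom_coeff k j u = 0"
proof (induction k arbitrary: j)
  case (Suc k)
  have "binom_coeff k i u *
     (1 / of_nat (Suc k) * (rem_coeff (j - i + 2) u + (- of_nat k) * rem_coeff (j - i) u)) = 0" if "i \<le> j" for i
  proof (cases "i < k")
    case True then show ?thesis using Suc.IH by simp
  next
    case False
    then have "i = j" using that Suc.prems by simp
    then show ?thesis by (simp add: rem_coeff_simps(1) rem_coeff_Suc_Suc_0 del: of_nat_Suc)
  qed
  then show ?case unfolding binom_coeff.simps by (intro sum.neutral) blast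
qed simp

lemma expands_rem_over_eps_sq:
  "expands (\<lambda>\<epsilon> u. of_real (1 / \<epsilon>\<^sup>2) * rem (\<epsilon> *\<^sub>R u)) (\<lambda>j. rem_coeff (j + 2))"
  unfolding expands_def
proof
  fix N :: nat
  have "poly_growth (Suc (N + 2)) (\<lambda>\<epsilon> u. rem (\<epsilon> *\<^sub>R u) - (\<Sum>j\<le>N + 2. of_real \<epsilon> ^ j * rem_coeff j u))"
    using expands_rem unfolding expands_def by blast
  then obtain C M where C: "C \<ge> 0" "\<And>\<epsilon> u. 0 < \<epsilon> \<Longrightarrow> \<epsilon> \<le> 1 \<Longrightarrow> \<epsilon> * norm u ^ 3 \<le> 1 \<Longrightarrow>
      norm (rem (\<epsilon> *\<^sub>R u) - (\<Sum>j\<le>N + 2. of_real \<epsilon> ^ j * rem_coeff j u)) \<le> C * \<epsilon> ^ Suc (N + 2) * (1 + norm u) ^ M"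
    unfolding poly_growth_def by blast
  show "poly_growth (Suc N) (\<lambda>\<epsilon> u. of_real (1 / \<epsilon>\<^sup>2) * rem (\<epsilon> *\<^sub>R u) -
      (\<Sum>j\<le>N. of_real \<epsilon> ^ j * rem_coeff (j + 2) u))"
  proof (rule poly_growthI[OF C(1), of _ _ M])
    fix \<epsilon> :: real and u :: "real \<times> real"
    assume e: "0 < \<epsilon>" "\<epsilon> \<le> 1" "\<epsilon> * norm u ^ 3 \<le> 1"
    let ?D = "rem (\<epsilon> *\<^sub>R u) - (\<Sum>j\<le>N + 2. of_real \<epsilon> ^ j * rem_coeff j u)"
    have "(\<Sum>j\<le>N + 2. of_real \<epsilon> ^ j * rem_coeff j u) = (\<Sum>j\<le>N. of_real \<epsilon> ^ (j + 2) * rem_coeff (j + 2) u)"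
      by (simp add: sum.atMost_Suc_shift rem_coeff_simps del: sum.atMost_Suc)
    also have "\<dots> = of_real (\<epsilon>\<^sup>2) * (\<Sum>j\<le>N. of_real \<epsilon> ^ j * rem_coeff (j + 2) u)"
      by (simp add: sum_distrib_left power2_eq_square mult_ac)
    finally have "of_real (1 / \<epsilon>\<^sup>2) * rem (\<epsilon> *\<^sub>R u) - (\<Sum>j\<le>N. of_real \<epsilon> ^ j * rem_coeff (j + 2) u)
        = of_real (1 / \<epsilon>\<^sup>2) * ?D"
      using e by (simp add: field_simps)
    then have "norm (of_real (1 / \<epsilon>\<^sup>2) * rem (\<epsilon> *\<^sub>R u) - (\<Sum>j\<le>N. of_real \<epsilon> ^ j * rem_coeff (j + 2) u))
        = 1 / \<epsilon>\<^sup>2 * norm ?D"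
      by (simp add: norm_mult norm_divide norm_power)
    also have "\<dots> \<le> 1 / \<epsilon>\<^sup>2 * (C * \<epsilon> ^ Suc (N + 2) * (1 + norm u) ^ M)"
      by (intro mult_left_mono C(2)[OF e]) auto
    also have "\<dots> = C * \<epsilon> ^ Suc N * (1 + norm u) ^ M"
      using e by (simp add: power2_eq_square)
    finally show "norm (of_real (1 / \<epsilon>\<^sup>2) * rem (\<epsilon> *\<^sub>R u) - (\<Sum>j\<le>N. of_real \<epsilon> ^ j * rem_coeff (j + 2) u))
        \<le> C * \<epsilon> ^ Suc N * (1 + norm u) ^ M" .
  qed
qed

lemma expands_binomial_term:
  "expands (\<lambda>\<epsilon> u. (of_real (1 / \<epsilon>\<^sup>2) gchoose k) * rem (\<epsilon> *\<^sub>R u) ^ k) (binom_coeff k)"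
proof (induction k)
  case 0
  then show ?case using expands_const[of 1] by (simp add: fun_eq_iff)
next
  case (Suc k)
  let ?a = "\<lambda>\<epsilon>. of_real (1 / \<epsilon>\<^sup>2) :: complex"
  have step: "a gchoose Suc k = (a gchoose k) * (1 / of_nat (Suc k) * (a - of_nat k))" for a :: complex
    using gbinomial_mult_1[of a k] by (simp add: field_simps del: of_nat_Suc)
  have "expands (\<lambda>\<epsilon> u. 1 / of_nat (Suc k) * (?a \<epsilon> * rem (\<epsilon> *\<^sub>R u) + (- of_nat k) * rem (\<epsilon> *\<^sub>R u)))
      (\<lambda>j u. 1 / of_nat (Suc k) * (rem_coeff (j + 2) u + (- of_nat k) * rem_coeff j u))"
    by (intro expands_scale expands_add expands_rem_over_eps_sq expands_rem)
  from expands_mult[OF Suc this parity_poly_binom_coeff parity_poly_step_coeff]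
  have "expands (\<lambda>\<epsilon> u. (?a \<epsilon> gchoose k) * rem (\<epsilon> *\<^sub>R u) ^ k *
      (1 / of_nat (Suc k) * (?a \<epsilon> * rem (\<epsilon> *\<^sub>R u) + (- of_nat k) * rem (\<epsilon> *\<^sub>R u)))) (binom_coeff (Suc k))"
    by (simp only: binom_coeff.simps[abs_def])
  moreover have "(a gchoose k) * r ^ k * (1 / of_nat (Suc k) * (a * r + (- of_nat k) * r))
      = (a gchoose Suc k) * r ^ Suc k" for a r :: complex
    unfolding step by (simp add: algebra_simps diff_divide_distrib del: of_nat_Suc)
  ultimately show ?case by (simp only:)
qed

text \<open>The terms with \<open>k > j\<close> have no coefficient at order \<open>j\<close>, so this is the \<open>j\<close>-th coefficient
  of the whole binomial sum.\<close>
definition edgeworth_coeff :: "nat \<Rightarrow> real \<times> real \<Rightarrow> complex" where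
  "edgeworth_coeff j u = (\<Sum>k\<le>j. binom_coeff k j u)"

lemma parity_poly_edgeworth_coeff: "parity_poly (3 * j) (edgeworth_coeff j)"
  unfolding edgeworth_coeff_def[abs_def] by (intro parity_poly_sum parity_poly_binom_coeff)

lemma edgeworth_coeff_simps:
  "edgeworth_coeff 0 u = 1" "edgeworth_coeff (Suc 0) u = rem_coeff 3 u"
  "edgeworth_coeff 2 u = rem_coeff 4 u + (rem_coeff 3 u)\<^sup>2 / 2"
  by (simp_all add: edgeworth_coeff_def eval_nat_numeral
      rem_coeff_simps(1,2) rem_coeff_Suc_Suc_0 power2_eq_square)

text \<open>Since \<open>chi u ^ n\<close> times the Gaussian factor is \<open>(1 + rem) ^ n\<close>, the binomial theorem yields the
  expansion; on the set where it is considered \<open>n * rem\<close> stays bounded.\<close>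
lemma chi_power_expansion:
  obtains C M where "C \<ge> 0" "\<And>n u. n \<ge> 1 \<Longrightarrow> norm u ^ 3 \<le> sqrt (real n) \<Longrightarrow>
     norm (chi ((1 / sqrt (real n)) *\<^sub>R u) ^ n * of_real (exp ((norm u)\<^sup>2 / 2))
        - (\<Sum>j\<le>N. of_real (1 / sqrt (real n)) ^ j * edgeworth_coeff j u))
     \<le> C * (1 / sqrt (real n)) ^ Suc N * (1 + norm u) ^ M"
proof -
  let ?T = "\<lambda>k \<epsilon> u. (of_real (1 / \<epsilon>\<^sup>2) gchoose k) * rem (\<epsilon> *\<^sub>R u) ^ k"
  have "poly_growth (Suc N) (\<lambda>\<epsilon> u. \<Sum>k\<le>N. ?T k \<epsilon> u - (\<Sum>j\<le>N. of_real \<epsilon> ^ j * binom_coeff k j u))"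
    using expands_binomial_term by (intro poly_growth_sum) (simp add: expands_def)
  moreover have "(\<Sum>k\<le>N. \<Sum>j\<le>N. of_real \<epsilon> ^ j * binom_coeff k j u) = (\<Sum>j\<le>N. of_real \<epsilon> ^ j * edgeworth_coeff j u)"
    for \<epsilon> :: real and u
  proof -
    have "(\<Sum>k\<le>N. binom_coeff k j u) = edgeworth_coeff j u" if "j \<le> N" for j
      unfolding edgeworth_coeff_def using that
      by (intro sum.mono_neutral_right) (auto intro: binom_coeff_eq_0)
    then show ?thesis by (subst sum.swap) (simp flip: sum_distrib_left)
  qed
  ultimately have "poly_growth (Suc N) (\<lambda>\<epsilon> u. (\<Sum>k\<le>N. ?T k \<epsilon> u) - (\<Sum>j\<le>N. of_real \<epsilon> ^ j * edgeworth_coeff j u))"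
    by (simp add: sum_subtractf)
  then obtain C M where C: "C \<ge> 0" "\<And>\<epsilon> u. 0 < \<epsilon> \<Longrightarrow> \<epsilon> \<le> 1 \<Longrightarrow> \<epsilon> * norm u ^ 3 \<le> 1 \<Longrightarrow>
      norm ((\<Sum>k\<le>N. ?T k \<epsilon> u) - (\<Sum>j\<le>N. of_real \<epsilon> ^ j * edgeworth_coeff j u)) \<le> C * \<epsilon> ^ Suc N * (1 + norm u) ^ M"
    unfolding poly_growth_def by blast
  obtain B where B: "B \<ge> 0" "\<And>v. norm v \<le> 1 \<Longrightarrow> norm (rem v) \<le> B * norm v ^ 3"
    using rem_cubic_bound by blast
  define D where "D = B ^ Suc N * exp B"
  have "norm (chi ((1 / sqrt (real n)) *\<^sub>R u) ^ n * of_real (exp ((norm u)\<^sup>2 / 2))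
        - (\<Sum>j\<le>N. of_real (1 / sqrt (real n)) ^ j * edgeworth_coeff j u))
     \<le> (C + D) * (1 / sqrt (real n)) ^ Suc N * (1 + norm u) ^ (M + 3 * Suc N)"
    if n: "n \<ge> 1" and u: "norm u ^ 3 \<le> sqrt (real n)" for n u
  proof -
    define \<epsilon> where "\<epsilon> = 1 / sqrt (real n)"
    have e: "0 < \<epsilon>" "\<epsilon> \<le> 1" "\<epsilon> * norm u ^ 3 \<le> 1"
      using n u by (auto simp: \<epsilon>_def field_simps)
    have e2: "1 / \<epsilon>\<^sup>2 = real n" using n by (simp add: \<epsilon>_def power_divide)
    have en: "real n * \<epsilon>\<^sup>2 = 1" using n by (simp add: \<epsilon>_def power_divide)
    let ?r = "rem (\<epsilon> *\<^sub>R u)"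
    have "norm (\<epsilon> *\<^sub>R u) \<le> 1" using eps_norm_le_1[OF e] e by simp
    then have "norm ?r \<le> B * (\<epsilon> * norm u) ^ 3" using B(2)[of "\<epsilon> *\<^sub>R u"] e by simp
    then have "real n * norm ?r \<le> real n * (B * (\<epsilon> * norm u) ^ 3)" by (rule mult_left_mono) simp
    also have "\<dots> = (real n * \<epsilon>\<^sup>2) * B * (\<epsilon> * norm u ^ 3)"
      by (simp add: power_mult_distrib power2_eq_square power3_eq_cube)
    finally have nr: "real n * norm ?r \<le> B * (\<epsilon> * norm u ^ 3)" by (simp add: en)
    also have nr': "\<dots> \<le> B * 1" using B(1) e by (intro mult_left_mono) auto
    finally have nr1: "real n * norm ?r \<le> B" by simp
    have "norm ((1 + ?r) ^ n - (\<Sum>k\<le>N. ?T k \<epsilon> u)) \<le> (real n * norm ?r) ^ Suc N * exp (real n * norm ?r)"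
      using binomial_tail_bound[of ?r n N] by (simp add: e2 binomial_gbinomial del: power_Suc)
    also have "\<dots> \<le> (B * (\<epsilon> * norm u ^ 3)) ^ Suc N * exp B"
      using nr nr1 B(1) e by (intro mult_mono power_mono[OF nr]) auto
    also have "\<dots> = D * \<epsilon> ^ Suc N * norm u ^ (3 * Suc N)"
      unfolding D_def power_mult_distrib power_mult by (simp only: mult_ac)
    also have "\<dots> \<le> D * \<epsilon> ^ Suc N * (1 + norm u) ^ (3 * Suc N)"
      using B(1) e by (intro mult_left_mono power_mono) (auto simp: D_def)
    finally have 1: "norm ((1 + ?r) ^ n - (\<Sum>k\<le>N. ?T k \<epsilon> u)) \<le> D * \<epsilon> ^ Suc N * (1 + norm u) ^ (3 * Suc N)" .
    have "(1 + norm u) ^ (3 * Suc N) \<le> (1 + norm u) ^ (M + 3 * Suc N)"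
      by (intro power_increasing) auto
    then have "D * \<epsilon> ^ Suc N * (1 + norm u) ^ (3 * Suc N) \<le> D * \<epsilon> ^ Suc N * (1 + norm u) ^ (M + 3 * Suc N)"
      using B(1) e by (intro mult_left_mono) (auto simp: D_def)
    moreover have "(1 + norm u) ^ M \<le> (1 + norm u) ^ (M + 3 * Suc N)"
      by (intro power_increasing) auto
    then have "C * \<epsilon> ^ Suc N * (1 + norm u) ^ M \<le> C * \<epsilon> ^ Suc N * (1 + norm u) ^ (M + 3 * Suc N)"
      using C(1) e by (intro mult_left_mono) auto
    ultimately have "norm ((1 + ?r) ^ n - (\<Sum>j\<le>N. of_real \<epsilon> ^ j * edgeworth_coeff j u))
        \<le> (C + D) * \<epsilon> ^ Suc N * (1 + norm u) ^ (M + 3 * Suc N)"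
      using norm_triangle_ineq[of "(1 + ?r) ^ n - (\<Sum>k\<le>N. ?T k \<epsilon> u)"
          "(\<Sum>k\<le>N. ?T k \<epsilon> u) - (\<Sum>j\<le>N. of_real \<epsilon> ^ j * edgeworth_coeff j u)"] 1 C(2)[OF e]
      unfolding distrib_right by simp
    moreover have "(1 + ?r) ^ n = chi (\<epsilon> *\<^sub>R u) ^ n * of_real (exp ((norm u)\<^sup>2 / 2))"
    proof -
      have "exp ((norm (\<epsilon> *\<^sub>R u))\<^sup>2 / 2) ^ n = exp (real n * \<epsilon>\<^sup>2 * ((norm u)\<^sup>2 / 2))"
        by (simp add: power_mult_distrib exp_of_nat_mult[symmetric])
      then show ?thesis by (simp add: rem_def power_mult_distrib en flip: of_real_power)
    qed
    ultimately show ?thesis unfolding \<epsilon>_def by simp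
  qed
  moreover have "C + D \<ge> 0" using B(1) C(1) by (simp add: D_def)
  ultimately show ?thesis by (rule that[rotated])
qed

end

section \<open>The Fourier integral over a compact set\<close>

lemma poly_times_gauss_bound:
  fixes c :: real
  assumes "c > 0"
  shows "\<exists>B. \<forall>x\<ge>0. (1 + x) ^ M \<le> B * exp (c * x\<^sup>2)"
proof (intro exI allI impI)
  fix x :: real assume x: "x \<ge> 0"
  have "(1 + x) ^ M / fact M \<le> exp (1 + x)"
    using member_le_sum[of M "{..M}" "\<lambda>k. (1 + x) ^ k / fact k"] exp_partial_sum_le[of "1 + x" M] x
    by simp
  moreover have "x \<le> 1 / (4 * c) + c * x\<^sup>2"
  proof -
    have "0 \<le> c * (x - 1 / (2 * c))\<^sup>2" using assms by simp
    also have "\<dots> = c * x\<^sup>2 - x + 1 / (4 * c)" using assms by (simp add: power2_eq_square field_simps)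
    finally show ?thesis by simp
  qed
  then have "exp (1 + x) \<le> exp (1 + 1 / (4 * c)) * exp (c * x\<^sup>2)" by (simp flip: exp_add)
  ultimately have "(1 + x) ^ M / fact M \<le> exp (1 + 1 / (4 * c)) * exp (c * x\<^sup>2)" by linarith
  then show "(1 + x) ^ M \<le> (fact M * exp (1 + 1 / (4 * c))) * exp (c * x\<^sup>2)"
    by (simp add: field_simps)
qed

lemma integrable_exp_neg_norm_sq:
  assumes "c > 0"
  shows "integrable lborel (\<lambda>u :: real \<times> real. exp (- c * (norm u)\<^sup>2))"
proof -
  define \<sigma> where "\<sigma> = 1 / sqrt (2 * c)"
  have \<sigma>: "\<sigma> > 0" "2 * \<sigma>\<^sup>2 = 1 / c" using assms by (auto simp: \<sigma>_def power_divide)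
  have "integrable lborel (\<lambda>x. sqrt (2 * pi * \<sigma>\<^sup>2) * normal_density 0 \<sigma> x)"
    using \<sigma> by (intro integrable_mult_right integrable_normal_density)
  moreover have "sqrt (2 * pi * \<sigma>\<^sup>2) * normal_density 0 \<sigma> x = exp (- c * x\<^sup>2)" for x
    using \<sigma> by (simp add: normal_density_def)
  ultimately have "integrable lborel (\<lambda>x. exp (- c * x\<^sup>2))" by simp
  from integral_product_lborel(1)[OF this this] show ?thesis
    by (simp add: power2_norm_eq_inner inner_prod_def ring_distribs exp_add exp_diff exp_minus field_simps flip: power2_eq_square)
qed

lemma integrable_poly_times_gauss:
  assumes "c > 0"
  shows "integrable lborel (\<lambda>u :: real \<times> real. (1 + norm u) ^ M * exp (- c * (norm u)\<^sup>2))"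
proof -
  obtain B where B: "\<And>x. x \<ge> 0 \<Longrightarrow> (1 + x) ^ M \<le> B * exp (c / 2 * x\<^sup>2)"
    using poly_times_gauss_bound[of "c / 2" M] assms by auto
  have "integrable lborel (\<lambda>u :: real \<times> real. B * exp (- (c / 2) * (norm u)\<^sup>2))"
    using assms by (intro integrable_mult_right integrable_exp_neg_norm_sq) simp
  then show ?thesis
  proof (rule Bochner_Integration.integrable_bound)
    have "norm ((1 + norm u) ^ M * exp (- c * (norm u)\<^sup>2)) \<le> norm (B * exp (- (c / 2) * (norm u)\<^sup>2))" for u :: "real \<times> real"
    proof -
      have "(1 + norm u) ^ M * exp (- c * (norm u)\<^sup>2) \<le> B * exp (c / 2 * (norm u)\<^sup>2) * exp (- c * (norm u)\<^sup>2)"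
        by (intro mult_right_mono B) auto
      also have "\<dots> = B * exp (- (c / 2) * (norm u)\<^sup>2)" by (simp add: algebra_simps flip: exp_add)
      finally show ?thesis by simp
    qed
    then show "AE u in (lborel :: (real \<times> real) measure). norm ((1 + norm u) ^ M * exp (- c * (norm u)\<^sup>2)) \<le> norm (B * exp (- (c / 2) * (norm u)\<^sup>2))"
      by (intro AE_I2)
  qed simp
qed

lemma parity_poly_partial_sum_bound:
  assumes "\<And>j. parity_poly (d j) (R j)"
  obtains C M where "C \<ge> 0" "\<And>\<epsilon> u. 0 < \<epsilon> \<Longrightarrow> \<epsilon> \<le> 1 \<Longrightarrow>
     norm (\<Sum>j\<le>N. of_real \<epsilon> ^ j * R j u) \<le> C * (1 + norm u) ^ M"
proof -
  have "\<forall>j. \<exists>C M. C \<ge> 0 \<and> (\<forall>u. norm (R j u) \<le> C * (1 + norm u) ^ M)"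
    using parity_poly_bound[OF assms] by blast
  then obtain C M where C: "\<And>j. C j \<ge> 0" "\<And>j u. norm (R j u) \<le> C j * (1 + norm u) ^ M j"
    by metis
  have "norm (\<Sum>j\<le>N. of_real \<epsilon> ^ j * R j u) \<le> (\<Sum>j\<le>N. C j) * (1 + norm u) ^ (\<Sum>j\<le>N. M j)"
    if e: "0 < \<epsilon>" "\<epsilon> \<le> 1" for \<epsilon> u
  proof -
    have "norm (\<Sum>j\<le>N. of_real \<epsilon> ^ j * R j u) \<le> (\<Sum>j\<le>N. C j * (1 + norm u) ^ (\<Sum>j\<le>N. M j))"
    proof (rule sum_norm_le)
      fix j assume "j \<in> {..N}"
      then have "M j \<le> (\<Sum>j\<le>N. M j)" by (intro member_le_sum) auto
      then have "(1 + norm u) ^ M j \<le> (1 + norm u) ^ (\<Sum>j\<le>N. M j)" by (intro power_increasing) auto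
      then have "norm (R j u) \<le> C j * (1 + norm u) ^ (\<Sum>j\<le>N. M j)"
        using C(2)[of j u] mult_left_mono[OF _ C(1)[of j]] by (meson order_trans)
      moreover have "\<epsilon> ^ j * norm (R j u) \<le> 1 * norm (R j u)"
        using e by (intro mult_right_mono power_le_one) auto
      ultimately show "norm (of_real \<epsilon> ^ j * R j u) \<le> C j * (1 + norm u) ^ (\<Sum>j\<le>N. M j)"
        using e by (simp add: norm_mult norm_power)
    qed
    then show ?thesis by (simp add: sum_distrib_right)
  qed
  moreover have "(\<Sum>j\<le>N. C j) \<ge> 0" using C(1) by (simp add: sum_nonneg)
  ultimately show ?thesis by (rule that[rotated])
qed

context isotropic_steps
begin

lemma continuous_chi: "continuous_on A chi"
  unfolding chi_def by (intro continuous_intros)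

lemma chi_gaussian_bound_near_0: "\<exists>\<rho>>0. \<forall>v. norm v \<le> \<rho> \<longrightarrow> norm (chi v) \<le> exp (- (1 / 4) * (norm v)\<^sup>2)"
proof -
  obtain B where B: "B \<ge> 0" "\<And>v. norm v \<le> 1 \<Longrightarrow> norm (rem v) \<le> B * norm v ^ 3"
    using rem_cubic_bound by blast
  \<comment> \<open>so small that \<open>B * norm v ^ 3 \<le> norm v\<^sup>2 / 4\<close>, half of the Gaussian exponent\<close>
  define \<rho> where "\<rho> = min 1 (1 / (4 * (B + 1)))"
  have "norm (chi v) \<le> exp (- (1 / 4) * (norm v)\<^sup>2)" if v: "norm v \<le> \<rho>" for v
  proof -
    have "norm v * (4 * (B + 1)) \<le> 1" using v B(1) by (simp add: \<rho>_def field_simps)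
    moreover have "norm v * (4 * (B + 1)) = 4 * (B * norm v) + 4 * norm v" by (simp add: algebra_simps)
    ultimately have Bv: "B * norm v \<le> 1 / 4" using norm_ge_zero[of v] by linarith
    have "norm (rem v) \<le> B * norm v ^ 3" using v by (intro B) (simp add: \<rho>_def)
    also have "\<dots> = (B * norm v) * (norm v)\<^sup>2" by (simp add: power2_eq_square power3_eq_cube)
    also have "\<dots> \<le> 1 / 4 * (norm v)\<^sup>2" using Bv by (intro mult_right_mono) auto
    finally have "norm (1 + rem v) \<le> 1 + 1 / 4 * (norm v)\<^sup>2"
      using norm_triangle_ineq[of 1 "rem v"] by simp
    also have "\<dots> \<le> exp (1 / 4 * (norm v)\<^sup>2)" by (rule exp_ge_add_one_self)
    finally have "norm (1 + rem v) * exp (- ((norm v)\<^sup>2 / 2)) \<le> exp (1 / 4 * (norm v)\<^sup>2) * exp (- ((norm v)\<^sup>2 / 2))"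
      by (rule mult_right_mono) simp
    moreover have "norm (1 + rem v) = norm (chi v) * exp ((norm v)\<^sup>2 / 2)"
      by (simp add: rem_def norm_mult)
    ultimately show ?thesis by (simp add: mult.assoc flip: exp_add)
  qed
  moreover have "\<rho> > 0" using B(1) by (simp add: \<rho>_def)
  ultimately show ?thesis by blast
qed

text \<open>Near the origin the cubic bound on \<open>rem\<close> gives Gaussian decay; on the remaining compact set the modulus
  stays below a constant less than 1, and \<open>norm v\<close> is bounded.\<close>
lemma chi_gaussian_bound:
  assumes D: "compact D" and less: "\<forall>v\<in>D. v \<noteq> 0 \<longrightarrow> norm (chi v) < 1"
  shows "\<exists>c>0. \<forall>v\<in>D. norm (chi v) \<le> exp (- c * (norm v)\<^sup>2)"
proof -
  obtain \<rho> where \<rho>: "\<rho> > 0" "\<And>v. norm v \<le> \<rho> \<Longrightarrow> norm (chi v) \<le> exp (- (1 / 4) * (norm v)\<^sup>2)"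
    using chi_gaussian_bound_near_0 by blast
  obtain R where R: "R > 0" "\<And>v. v \<in> D \<Longrightarrow> norm v \<le> R"
    using compact_imp_bounded[OF D] bounded_pos by metis
  let ?S = "D \<inter> {v. \<rho> \<le> norm v}"
  have "compact ?S" by (intro compact_Int_closed D closed_Collect_le continuous_intros)
  then have "\<exists>m<1. \<forall>v\<in>?S. norm (chi v) \<le> m"
  proof (cases "?S = {}")
    case False
    have "continuous_on ?S (\<lambda>v. norm (chi v))" by (intro continuous_intros continuous_chi)
    from continuous_attains_sup[OF \<open>compact ?S\<close> False this]
    obtain v where "v \<in> ?S" "\<forall>v'\<in>?S. norm (chi v') \<le> norm (chi v)" by blast
    moreover from this have "norm (chi v) < 1" using \<rho>(1) less by (cases "v = 0") auto
    ultimately show ?thesis by blast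
  qed (auto intro: exI[of _ 0])
  then obtain m0 where m0: "m0 < 1" "\<And>v. v \<in> ?S \<Longrightarrow> norm (chi v) \<le> m0" by blast
  define m where "m = max m0 (1 / 2)"
  have m: "0 < m" "m < 1" "\<And>v. v \<in> ?S \<Longrightarrow> norm (chi v) \<le> m"
    using m0(1) order_trans[OF m0(2), of _ m] by (auto simp: m_def)
  define c where "c = min (1 / 4) (- ln m / R\<^sup>2)"
  have c: "c > 0" using m R(1) by (simp add: c_def ln_less_zero field_simps)
  have "norm (chi v) \<le> exp (- c * (norm v)\<^sup>2)" if "v \<in> D" for v
  proof (cases "norm v \<le> \<rho>")
    case True
    have "norm (chi v) \<le> exp (- (1 / 4) * (norm v)\<^sup>2)" by (rule \<rho>(2)[OF True])
    moreover have "c \<le> 1 / 4" unfolding c_def by (rule min.cobounded1)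
    then have "exp (- (1 / 4) * (norm v)\<^sup>2) \<le> exp (- c * (norm v)\<^sup>2)"
      using mult_right_mono[of c "1 / 4" "(norm v)\<^sup>2"] by simp
    ultimately show ?thesis by linarith
  next
    case False
    have "c * (norm v)\<^sup>2 \<le> (- ln m / R\<^sup>2) * R\<^sup>2"
    proof (intro mult_mono power_mono)
      show "0 \<le> - ln m / R\<^sup>2" using m(1,2) by (intro divide_nonneg_nonneg) (auto simp: ln_le_zero_iff)
    qed (use R that in \<open>auto simp: c_def\<close>)
    then have "ln m \<le> - c * (norm v)\<^sup>2" using R by simp
    then have "m \<le> exp (- c * (norm v)\<^sup>2)" using m(1) by (metis exp_le_cancel_iff exp_ln)
    moreover have "norm (chi v) \<le> m" using m(3)[of v] that False by simp
    ultimately show ?thesis by linarith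
  qed
  then show ?thesis using c by blast
qed

text \<open>Away from the range of the expansion, that is for \<open>norm u ^ 3 > sqrt n\<close> or outside the scaled
  set, each of the two terms is small by itself: both have Gaussian decay. There
  \<open>(1 + norm u) ^ 3 / sqrt n\<close> is bounded from below, so its \<open>Suc N\<close>-th power may be inserted as a
  factor, at the cost of a constant.\<close>
lemma chi_power_error:
  assumes D: "compact D" and less: "\<forall>v\<in>D. v \<noteq> 0 \<longrightarrow> norm (chi v) < 1"
    and \<rho>: "\<rho> > 0" "ball 0 \<rho> \<subseteq> D"
  obtains c C M where "c > 0" "C \<ge> 0" "\<And>n u. n \<ge> 1 \<Longrightarrow>
     norm (indicator D ((1 / sqrt (real n)) *\<^sub>R u) *\<^sub>R chi ((1 / sqrt (real n)) *\<^sub>R u) ^ n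
        - (\<Sum>j\<le>N. of_real (1 / sqrt (real n)) ^ j * edgeworth_coeff j u) * of_real (exp (- ((norm u)\<^sup>2 / 2))))
     \<le> C * (1 / sqrt (real n)) ^ Suc N * ((1 + norm u) ^ M * exp (- c * (norm u)\<^sup>2))"
proof -
  obtain c0 where c0: "c0 > 0" "\<And>v. v \<in> D \<Longrightarrow> norm (chi v) \<le> exp (- c0 * (norm v)\<^sup>2)"
    using chi_gaussian_bound[OF D less] by blast
  define c where "c = min c0 (1 / 2)"
  have c: "c > 0" "c \<le> c0" "c \<le> 1 / 2" using c0(1) by (auto simp: c_def)
  obtain C1 M1 where C1: "C1 \<ge> 0" "\<And>n u. n \<ge> 1 \<Longrightarrow> norm u ^ 3 \<le> sqrt (real n) \<Longrightarrow>
     norm (chi ((1 / sqrt (real n)) *\<^sub>R u) ^ n * of_real (exp ((norm u)\<^sup>2 / 2))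
        - (\<Sum>j\<le>N. of_real (1 / sqrt (real n)) ^ j * edgeworth_coeff j u))
     \<le> C1 * (1 / sqrt (real n)) ^ Suc N * (1 + norm u) ^ M1"
    by (fact chi_power_expansion[of N])
  obtain C2 M2 where C2: "C2 \<ge> 0" "\<And>\<epsilon> u. 0 < \<epsilon> \<Longrightarrow> \<epsilon> \<le> 1 \<Longrightarrow>
      norm (\<Sum>j\<le>N. of_real \<epsilon> ^ j * edgeworth_coeff j u) \<le> C2 * (1 + norm u) ^ M2"
    by (fact parity_poly_partial_sum_bound[of "\<lambda>j. 3 * j" edgeworth_coeff, OF parity_poly_edgeworth_coeff, of N])
  \<comment> \<open>with this \<open>L\<close>, both ways of leaving the range of the expansion give \<open>1 \<le> L * \<epsilon> * (1 + norm u) ^ 3\<close>\<close>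
  define L where "L = max 1 (1 / \<rho>)"
  have L: "L \<ge> 1" "1 / \<rho> \<le> L" by (auto simp: L_def)
  define C3 where "C3 = (1 + C2) * L ^ Suc N"
  define M3 where "M3 = M2 + 3 * Suc N"
  have C3: "C3 \<ge> 0" using C2 L by (simp add: C3_def)
  have "norm (indicator D ((1 / sqrt (real n)) *\<^sub>R u) *\<^sub>R chi ((1 / sqrt (real n)) *\<^sub>R u) ^ n
        - (\<Sum>j\<le>N. of_real (1 / sqrt (real n)) ^ j * edgeworth_coeff j u) * of_real (exp (- ((norm u)\<^sup>2 / 2))))
     \<le> (C1 + C3) * (1 / sqrt (real n)) ^ Suc N * ((1 + norm u) ^ (M1 + M3) * exp (- c * (norm u)\<^sup>2))"
    if n: "n \<ge> 1" for n u
  proof -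
    define \<epsilon> where "\<epsilon> = 1 / sqrt (real n)"
    have e: "0 < \<epsilon>" "\<epsilon> \<le> 1" and en: "real n * \<epsilon>\<^sup>2 = 1"
      using n by (auto simp: \<epsilon>_def power_divide)
    let ?E = "\<Sum>j\<le>N. of_real \<epsilon> ^ j * edgeworth_coeff j u"
    let ?F = "indicator D (\<epsilon> *\<^sub>R u) *\<^sub>R chi (\<epsilon> *\<^sub>R u) ^ n"
    let ?g = "exp (- ((norm u)\<^sup>2 / 2))" and ?gc = "exp (- c * (norm u)\<^sup>2)"
    have g: "?g \<le> ?gc" using c(3) mult_right_mono[OF c(3), of "(norm u)\<^sup>2"] by simp
    have "norm (?F - ?E * of_real ?g) \<le> C1 * \<epsilon> ^ Suc N * ((1 + norm u) ^ M1 * ?gc)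
        \<or> norm (?F - ?E * of_real ?g) \<le> C3 * \<epsilon> ^ Suc N * ((1 + norm u) ^ M3 * ?gc)"
    proof (cases "norm u ^ 3 \<le> sqrt (real n) \<and> \<epsilon> *\<^sub>R u \<in> D")
      case True
      then have "?F - ?E * of_real ?g = (chi (\<epsilon> *\<^sub>R u) ^ n * of_real (exp ((norm u)\<^sup>2 / 2)) - ?E) * of_real ?g"
        by (simp add: left_diff_distrib mult.assoc flip: of_real_mult exp_add)
      then have "norm (?F - ?E * of_real ?g) = norm (chi (\<epsilon> *\<^sub>R u) ^ n * of_real (exp ((norm u)\<^sup>2 / 2)) - ?E) * ?g"
        by (simp add: norm_mult)
      also have "\<dots> \<le> (C1 * \<epsilon> ^ Suc N * (1 + norm u) ^ M1) * ?gc"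
        using C1(2)[OF n, of u] True C1(1) e g unfolding \<epsilon>_def[symmetric] by (intro mult_mono) auto
      finally show ?thesis by (simp add: mult_ac)
    next
      case False
      have far: "1 \<le> L * \<epsilon> * (1 + norm u) ^ 3"
      proof (cases "norm u ^ 3 \<le> sqrt (real n)")
        case True
        with False have "\<epsilon> *\<^sub>R u \<notin> D" by blast
        then have "\<epsilon> *\<^sub>R u \<notin> ball 0 \<rho>" using \<rho>(2) by blast
        then have "\<rho> \<le> \<epsilon> * norm u" using e by simp
        then have "1 \<le> (1 / \<rho>) * (\<epsilon> * norm u)" using \<rho>(1) by (simp add: field_simps)
        also have "\<dots> \<le> L * (\<epsilon> * (1 + norm u) ^ 3)"
        proof (intro mult_mono)
          have "(1 + norm u) ^ 1 \<le> (1 + norm u) ^ 3" by (intro power_increasing) auto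
          then show "norm u \<le> (1 + norm u) ^ 3" by simp
        qed (use e L in auto)
        finally show ?thesis by simp
      next
        case False
        then have "1 \<le> \<epsilon> * norm u ^ 3" using n by (simp add: \<epsilon>_def field_simps)
        also have "\<dots> \<le> L * (\<epsilon> * (1 + norm u) ^ 3)"
          using e L mult_mono[of 1 L "\<epsilon> * norm u ^ 3" "\<epsilon> * (1 + norm u) ^ 3"]
          by (simp add: mult_left_mono power_mono)
        finally show ?thesis by simp
      qed
      have "norm ?F \<le> ?gc"
      proof (cases "\<epsilon> *\<^sub>R u \<in> D")
        case True
        have "norm (chi (\<epsilon> *\<^sub>R u)) ^ n \<le> exp (- c0 * (norm (\<epsilon> *\<^sub>R u))\<^sup>2) ^ n"
          by (intro power_mono c0 True) auto
        also have "\<dots> = exp (- c0 * (real n * \<epsilon>\<^sup>2) * (norm u)\<^sup>2)"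
          by (simp add: power_mult_distrib mult_ac flip: exp_of_nat_mult)
        also have "\<dots> \<le> ?gc" using mult_right_mono[OF c(2), of "(norm u)\<^sup>2"] by (simp add: en)
        finally show ?thesis using True by (simp add: norm_power)
      qed simp
      moreover have "norm (?E * of_real ?g) \<le> C2 * (1 + norm u) ^ M2 * ?gc"
        unfolding norm_mult using C2(2)[OF e, of u] C2(1) g by (intro mult_mono) auto
      moreover have "1 * ?gc \<le> (1 + norm u) ^ M2 * ?gc" by (intro mult_right_mono) auto
      ultimately have "norm (?F - ?E * of_real ?g) \<le> (1 + C2) * ((1 + norm u) ^ M2 * ?gc)"
        using norm_triangle_ineq4[of ?F "?E * of_real ?g"]
        unfolding distrib_right mult_1_left mult.assoc by linarith
      also have "\<dots> \<le> (1 + C2) * ((1 + norm u) ^ M2 * ?gc) * (L * \<epsilon> * (1 + norm u) ^ 3) ^ Suc N"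
        using mult_left_mono[OF one_le_power[OF far, of "Suc N"], of "(1 + C2) * ((1 + norm u) ^ M2 * ?gc)"] C2(1)
        by simp
      also have "\<dots> = C3 * \<epsilon> ^ Suc N * ((1 + norm u) ^ M3 * ?gc)"
        unfolding C3_def M3_def power_mult_distrib power_add power_mult by (simp only: mult_ac)
      finally show ?thesis by blast
    qed
    moreover have "C1 * \<epsilon> ^ Suc N * ((1 + norm u) ^ M1 * ?gc) \<le> (C1 + C3) * \<epsilon> ^ Suc N * ((1 + norm u) ^ (M1 + M3) * ?gc)"
      using C1(1) C3 e by (intro order_refl mult_mono power_increasing) auto
    moreover have "C3 * \<epsilon> ^ Suc N * ((1 + norm u) ^ M3 * ?gc) \<le> (C1 + C3) * \<epsilon> ^ Suc N * ((1 + norm u) ^ (M1 + M3) * ?gc)"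
      using C1(1) C3 e by (intro order_refl mult_mono power_increasing) auto
    ultimately show ?thesis unfolding \<epsilon>_def by linarith
  qed
  moreover have "C1 + C3 \<ge> 0" using C1(1) C3 by simp
  ultimately show ?thesis by (rule that[OF c(1), rotated])
qed

lemma fourier_integral_expansion:
  assumes D: "compact D" and less: "\<forall>v\<in>D. v \<noteq> 0 \<longrightarrow> norm (chi v) < 1"
    and \<rho>: "\<rho> > 0" "ball 0 \<rho> \<subseteq> D"
  obtains C where "\<And>n z. n \<ge> 1 \<Longrightarrow>
     norm ((\<integral>u. indicator D ((1 / sqrt (real n)) *\<^sub>R u) *\<^sub>R chi ((1 / sqrt (real n)) *\<^sub>R u) ^ n * iexp (- (z \<bullet> u)) \<partial>lborel)
        - 2 * pi * exp (- ((norm z)\<^sup>2 / 2)) *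
          (\<Sum>j\<le>N. of_real (1 / sqrt (real n)) ^ j * gauss_transform (edgeworth_coeff j) z))
     \<le> C * (1 / sqrt (real n)) ^ Suc N"
proof -
  obtain c C M where c: "c > 0" and C: "C \<ge> 0" and bound: "\<And>n u. n \<ge> 1 \<Longrightarrow>
     norm (indicator D ((1 / sqrt (real n)) *\<^sub>R u) *\<^sub>R chi ((1 / sqrt (real n)) *\<^sub>R u) ^ n
        - (\<Sum>j\<le>N. of_real (1 / sqrt (real n)) ^ j * edgeworth_coeff j u) * of_real (exp (- ((norm u)\<^sup>2 / 2))))
     \<le> C * (1 / sqrt (real n)) ^ Suc N * ((1 + norm u) ^ M * exp (- c * (norm u)\<^sup>2))"
    by (fact chi_power_error[OF D less \<rho>, of N])
  define I where "I = (\<integral>u. (1 + norm u) ^ M * exp (- c * (norm u)\<^sup>2) \<partial>(lborel :: (real \<times> real) measure))"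
  have "norm ((\<integral>u. indicator D ((1 / sqrt (real n)) *\<^sub>R u) *\<^sub>R chi ((1 / sqrt (real n)) *\<^sub>R u) ^ n * iexp (- (z \<bullet> u)) \<partial>lborel)
        - 2 * pi * exp (- ((norm z)\<^sup>2 / 2)) *
          (\<Sum>j\<le>N. of_real (1 / sqrt (real n)) ^ j * gauss_transform (edgeworth_coeff j) z))
     \<le> (C * I) * (1 / sqrt (real n)) ^ Suc N" if n: "n \<ge> 1" for n z
  proof -
    define \<epsilon> where "\<epsilon> = 1 / sqrt (real n)"
    have e: "\<epsilon> > 0" using n by (simp add: \<epsilon>_def)
    let ?f = "\<lambda>u. indicator D (\<epsilon> *\<^sub>R u) *\<^sub>R chi (\<epsilon> *\<^sub>R u) ^ n * iexp (- (z \<bullet> u))"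
    let ?G = "\<lambda>j u. edgeworth_coeff j u * of_real (exp (- ((norm u)\<^sup>2 / 2))) * iexp (- (z \<bullet> u))"
    let ?g = "\<lambda>u. \<Sum>j\<le>N. of_real \<epsilon> ^ j * ?G j u"
    have "integrable lborel (\<lambda>u. indicator ((\<lambda>v. (1 / \<epsilon>) *\<^sub>R v) ` D) u *\<^sub>R (chi (\<epsilon> *\<^sub>R u) ^ n * iexp (- (z \<bullet> u))))"
      by (intro borel_integrable_compact compact_scaling D continuous_intros
          continuous_on_compose2[OF continuous_chi[of UNIV]]) auto
    moreover have "u \<in> (\<lambda>v. (1 / \<epsilon>) *\<^sub>R v) ` D \<longleftrightarrow> \<epsilon> *\<^sub>R u \<in> D" for u
      using e by (auto simp: image_iff intro!: bexI[of _ "\<epsilon> *\<^sub>R u"])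
    ultimately have f: "integrable lborel ?f" by (simp add: indicator_def)
    have G: "integrable lborel (?G j)" for j
    proof -
      have "?G j u = 2 * pi * (edgeworth_coeff j u * of_real (std_gauss u) * iexp (- (z \<bullet> u)))" for u
        by (simp add: std_gauss_def)
      then show ?thesis
        by (simp only:) (intro integrable_mult_right integrable_gauss_parity_poly[OF parity_poly_edgeworth_coeff])
    qed
    then have g: "integrable lborel ?g" by (intro Bochner_Integration.integrable_sum integrable_mult_right)
    have "(\<integral>u. ?g u \<partial>lborel) = (\<Sum>j\<le>N. of_real \<epsilon> ^ j * (\<integral>u. ?G j u \<partial>lborel))"
      using G by (subst Bochner_Integration.integral_sum) (auto intro!: integrable_mult_right)
    then have "(\<integral>u. ?g u \<partial>lborel) = 2 * pi * exp (- ((norm z)\<^sup>2 / 2)) *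
        (\<Sum>j\<le>N. of_real \<epsilon> ^ j * gauss_transform (edgeworth_coeff j) z)"
      unfolding fourier_gauss_parity_poly by (simp add: sum_distrib_left mult_ac)
    moreover have "norm ((\<integral>u. ?f u \<partial>lborel) - (\<integral>u. ?g u \<partial>lborel)) \<le> C * \<epsilon> ^ Suc N * I"
    proof -
      have "norm (\<integral>u. ?f u - ?g u \<partial>lborel) \<le>
          (\<integral>u. C * \<epsilon> ^ Suc N * ((1 + norm u) ^ M * exp (- c * (norm u)\<^sup>2)) \<partial>(lborel :: (real \<times> real) measure))"
      proof (rule Bochner_Integration.integral_norm_bound_integral)
        fix u :: "real \<times> real"
        have "?f u - ?g u = (indicator D (\<epsilon> *\<^sub>R u) *\<^sub>R chi (\<epsilon> *\<^sub>R u) ^ n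
          - (\<Sum>j\<le>N. of_real \<epsilon> ^ j * edgeworth_coeff j u) * of_real (exp (- ((norm u)\<^sup>2 / 2)))) * iexp (- (z \<bullet> u))"
          by (simp add: algebra_simps sum_distrib_left)
        then have "norm (?f u - ?g u) = norm (indicator D (\<epsilon> *\<^sub>R u) *\<^sub>R chi (\<epsilon> *\<^sub>R u) ^ n
          - (\<Sum>j\<le>N. of_real \<epsilon> ^ j * edgeworth_coeff j u) * of_real (exp (- ((norm u)\<^sup>2 / 2))))"
          by (simp only: norm_mult norm_exp_i_times mult_1_right)
        then show "norm (?f u - ?g u) \<le> C * \<epsilon> ^ Suc N * ((1 + norm u) ^ M * exp (- c * (norm u)\<^sup>2))"
          using bound[OF n, of u] unfolding \<epsilon>_def by simp
      qed (intro Bochner_Integration.integrable_diff f g integrable_mult_right integrable_poly_times_gauss c)+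
      then show ?thesis using f g by (simp add: I_def)
    qed
    ultimately show ?thesis unfolding \<epsilon>_def by (simp add: mult_ac)
  qed
  then show ?thesis by (rule that)
qed

end

section \<open>Lattice walks and Fourier inversion\<close>

lemma finite_edge_paths:
  assumes "\<And>x. finite {e \<in> E. fst e = x}"
  shows "finite {es. length es = n \<and> edge_path E x es y}"
proof (induction n arbitrary: x)
  case 0
  show ?case by (rule finite_subset[of _ "{[]}"]) auto
next
  case (Suc n)
  have "{es. length es = Suc n \<and> edge_path E x es y} \<subseteq>
      (\<Union>e\<in>{e \<in> E. fst e = x}. (#) e ` {es. length es = n \<and> edge_path E (snd e) es y})"
    by (auto simp: length_Suc_conv)
  then show ?case by (rule finite_subset) (intro finite_UN_I assms finite_imageI Suc)
qed

lemma nstep_prob_0: "nstep_prob E p 0 x y = (if x = y then 1 else 0)"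
proof -
  have "{es. length es = 0 \<and> edge_path E x es y} = (if x = y then {[]} else {})" by auto
  then show ?thesis by (simp add: nstep_prob_def)
qed

lemma nstep_prob_Suc:
  assumes fin: "\<And>x. finite {e \<in> E. fst e = x}"
  shows "nstep_prob E p (Suc n) x y = (\<Sum>e | e \<in> E \<and> fst e = x. p e * nstep_prob E p n (snd e) y)"
proof -
  let ?P = "\<lambda>n x. {es. length es = n \<and> edge_path E x es y}"
  have eq: "?P (Suc n) x = (\<lambda>(e, es). e # es) ` (SIGMA e:{e \<in> E. fst e = x}. ?P n (snd e))"
    by (auto simp: length_Suc_conv image_iff)
  have "nstep_prob E p (Suc n) x y =
      (\<Sum>(e, es)\<in>(SIGMA e:{e \<in> E. fst e = x}. ?P n (snd e)). p e * prod_list (map p es))"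
    unfolding nstep_prob_def eq
    by (subst sum.reindex) (auto simp: inj_on_def case_prod_beta)
  also have "\<dots> = (\<Sum>e\<in>{e \<in> E. fst e = x}. \<Sum>es\<in>?P n (snd e). p e * prod_list (map p es))"
    by (rule sum.Sigma[symmetric]) (use fin finite_edge_paths[OF fin] in auto)
  finally show ?thesis by (simp add: nstep_prob_def sum_distrib_left)
qed

definition real_pair :: "int \<times> int \<Rightarrow> real \<times> real" where
  "real_pair k = (of_int (fst k), of_int (snd k))"

primrec walk_prob :: "(int \<times> int) set \<Rightarrow> (int \<times> int \<Rightarrow> real) \<Rightarrow> nat \<Rightarrow> int \<times> int \<Rightarrow> real" where
  "walk_prob K w 0 v = (if v = 0 then 1 else 0)"
| "walk_prob K w (Suc n) v = (\<Sum>k\<in>K. w k * walk_prob K w n (v - k))"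

text \<open>A fundamental domain of the torus modulo a cyclic group of \<open>q\<close> shifts, each of which moves the first
  coordinate by a multiple of \<open>2 * pi / q\<close>.\<close>
definition torus_box :: "nat \<Rightarrow> (real \<times> real) set" where
  "torus_box q = {- (pi / q)..pi / q} \<times> {- pi..pi}"

lemma integral_iexp_int:
  fixes q :: nat and k :: int
  assumes "q > 0" "int q dvd k"
  shows "(\<integral>x. indicator {- (pi / q)..pi / q} x *\<^sub>R iexp (- (of_int k * x)) \<partial>lborel) =
     (if k = 0 then 2 * pi / q else 0)"
proof (cases "k = 0")
  case True
  then show ?thesis using assms
    by (simp add: scaleR_conv_of_real measure_lborel_Icc)
next
  case False
  define F where "F x = iexp (- (of_int k * x)) / (- \<i> * of_int k)" for x
  have "(F has_vector_derivative iexp (- (of_int k * x))) (at x within S)" for x S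
  proof -
    have "((\<lambda>x. - (of_int k * x)) has_real_derivative - of_int k) (at x within S)"
      by (auto intro!: derivative_eq_intros)
    then have "((\<lambda>x. - (of_int k * x)) has_vector_derivative - of_int k) (at x within S)"
      by (simp add: has_real_derivative_iff_has_vector_derivative)
    from vector_diff_chain_within[OF this has_vector_derivative_iexp]
    have "((\<lambda>x. iexp (- (of_int k * x))) has_vector_derivative (- of_int k) *\<^sub>R (\<i> * iexp (- (of_int k * x)))) (at x within S)"
      by (simp add: o_def)
    from has_vector_derivative_divide[OF this, of "- \<i> * of_int k"] show ?thesis
      unfolding F_def using False by (simp add: scaleR_conv_of_real mult_ac)
  qed
  moreover have "continuous_on {- (pi / q)..pi / q} (\<lambda>x. iexp (- (of_int k * x)))"
    by (intro continuous_intros)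
  ultimately have "(\<integral>x. indicator {- (pi / q)..pi / q} x *\<^sub>R iexp (- (of_int k * x)) \<partial>lborel) = F (pi / q) - F (- (pi / q))"
    by (intro integral_FTC_atLeastAtMost) auto
  moreover obtain j where j: "k = int q * j" using assms(2) by auto
  have "iexp (- (of_int k * (pi / q))) = iexp (- (of_int k * - (pi / q)))"
  proof -
    have "of_int k * (pi / q) = of_int j * pi" using assms(1) by (simp add: j)
    moreover have "iexp (- (of_int j * pi)) = iexp (of_int j * pi)"
      by (subst exp_eq) (auto intro!: exI[of _ "- j"] simp: algebra_simps)
    ultimately show ?thesis by simp
  qed
  ultimately show ?thesis using False by (simp add: F_def)
qed

lemma compact_torus_box: "compact (torus_box q)"
  unfolding torus_box_def by (intro compact_Times compact_Icc)

text \<open>The integral over the smaller box vanishes unless both coordinates are zero: a nonzero second coordinate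
  is caught by the full period in the second variable, and otherwise the first one is divisible by \<open>q\<close>.\<close>
lemma torus_orthogonality:
  assumes "q > 0" "int q dvd fst v - snd v"
  shows "(\<integral>\<theta>. indicator (torus_box q) \<theta> *\<^sub>R iexp (- (real_pair v \<bullet> \<theta>)) \<partial>lborel) =
     (if v = 0 then 4 * pi\<^sup>2 / q else 0)"
proof -
  let ?f = "\<lambda>x. indicator {- (pi / q)..pi / q} x *\<^sub>R iexp (- (of_int (fst v) * x))"
  let ?g = "\<lambda>x. indicator {- (pi / real 1)..pi / real 1} x *\<^sub>R iexp (- (of_int (snd v) * x))"
  have "integrable lborel ?f" "integrable lborel ?g"
    by (intro borel_integrable_compact continuous_intros compact_Icc)+
  from integral_product_lborel(2)[OF this]
  have "(\<integral>\<theta>. ?f (fst \<theta>) * ?g (snd \<theta>) \<partial>lborel) = (\<integral>x. ?f x \<partial>lborel) * (\<integral>x. ?g x \<partial>lborel)" .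
  moreover have "?f (fst \<theta>) * ?g (snd \<theta>) = indicator (torus_box q) \<theta> *\<^sub>R iexp (- (real_pair v \<bullet> \<theta>))" for \<theta>
    by (cases \<theta>) (auto simp: torus_box_def indicator_def real_pair_def mult_exp_exp ring_distribs)
  ultimately have eq: "(\<integral>\<theta>. indicator (torus_box q) \<theta> *\<^sub>R iexp (- (real_pair v \<bullet> \<theta>)) \<partial>lborel)
      = (\<integral>x. ?f x \<partial>lborel) * (\<integral>x. ?g x \<partial>lborel)" by simp
  have g: "(\<integral>x. ?g x \<partial>lborel) = (if snd v = 0 then 2 * pi else 0)"
    using integral_iexp_int[of 1 "snd v"] by simp
  show ?thesis
  proof (cases "snd v = 0")
    case True
    then have "int q dvd fst v" using assms(2) by simp
    from integral_iexp_int[OF assms(1) this] show ?thesis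
      unfolding eq g using True by (auto simp: prod_eq_iff power2_eq_square)
  next
    case False
    then show ?thesis unfolding eq g by (auto simp: prod_eq_iff)
  qed
qed

definition torus_char :: "(int \<times> int) set \<Rightarrow> (int \<times> int \<Rightarrow> real) \<Rightarrow> real \<times> real \<Rightarrow> complex" where
  "torus_char K w \<theta> = (\<Sum>k\<in>K. of_real (w k) * iexp (real_pair k \<bullet> \<theta>))"

lemma continuous_torus_char: "continuous_on A (torus_char K w)"
  unfolding torus_char_def by (intro continuous_intros)

text \<open>A walk whose steps all lie in the class 1 modulo \<open>q\<close> (with respect to the difference of the
  coordinates) moves through the classes cyclically. On its support the integrand is then
  invariant under a shift of order \<open>q\<close>, and a \<open>q\<close>-th part of the torus suffices. For \<open>q = 1\<close>
  this is the usual inversion formula.\<close>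
lemma walk_prob_fourier:
  assumes q: "q > 0" and K: "\<And>k. k \<in> K \<Longrightarrow> w k \<noteq> 0 \<Longrightarrow> int q dvd fst k - snd k - 1"
    and v: "int q dvd fst v - snd v - int n"
  shows "of_real (4 * pi\<^sup>2 / q * walk_prob K w n v) =
     (\<integral>\<theta>. indicator (torus_box q) \<theta> *\<^sub>R (torus_char K w \<theta> ^ n * iexp (- (real_pair v \<bullet> \<theta>))) \<partial>lborel)"
  using v
proof (induction n arbitrary: v)
  case 0
  then show ?case using torus_orthogonality[OF q] by simp
next
  case (Suc n)
  let ?F = "\<lambda>n v \<theta>. indicator (torus_box q) \<theta> *\<^sub>R (torus_char K w \<theta> ^ n * iexp (- (real_pair v \<bullet> \<theta>)))"
  have int: "integrable lborel (?F n v)" for n v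
    by (intro borel_integrable_compact compact_torus_box continuous_intros continuous_torus_char)
  have "?F (Suc n) v \<theta> = (\<Sum>k\<in>K. of_real (w k) * ?F n (v - k) \<theta>)" for \<theta>
  proof -
    have "iexp (real_pair k \<bullet> \<theta>) * iexp (- (real_pair v \<bullet> \<theta>)) = iexp (- (real_pair (v - k) \<bullet> \<theta>))" for k
      by (simp add: real_pair_def inner_prod_def mult_exp_exp algebra_simps)
    then have "torus_char K w \<theta> * iexp (- (real_pair v \<bullet> \<theta>)) = (\<Sum>k\<in>K. of_real (w k) * iexp (- (real_pair (v - k) \<bullet> \<theta>)))"
      unfolding torus_char_def sum_distrib_right by (simp only: mult.assoc)
    then have "torus_char K w \<theta> ^ Suc n * iexp (- (real_pair v \<bullet> \<theta>)) =
        torus_char K w \<theta> ^ n * (\<Sum>k\<in>K. of_real (w k) * iexp (- (real_pair (v - k) \<bullet> \<theta>)))"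
      by (simp only: power_Suc2 mult.assoc)
    then show ?thesis by (simp add: sum_distrib_left scaleR_sum_right mult_ac)
  qed
  then have "(\<integral>\<theta>. ?F (Suc n) v \<theta> \<partial>lborel) = (\<integral>\<theta>. (\<Sum>k\<in>K. of_real (w k) * ?F n (v - k) \<theta>) \<partial>lborel)"
    by (simp only:)
  also have "\<dots> = (\<Sum>k\<in>K. of_real (w k) * (\<integral>\<theta>. ?F n (v - k) \<theta> \<partial>lborel))"
    by (subst Bochner_Integration.integral_sum)
       (intro integrable_mult_right int, simp only: integral_mult_right_zero)
  also have "\<dots> = (\<Sum>k\<in>K. of_real (w k) * of_real (4 * pi\<^sup>2 / q * walk_prob K w n (v - k)))"
  proof (rule sum.cong[OF refl])
    fix k assume k: "k \<in> K"
    show "of_real (w k) * (\<integral>\<theta>. ?F n (v - k) \<theta> \<partial>lborel) =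
        of_real (w k) * of_real (4 * pi\<^sup>2 / q * walk_prob K w n (v - k))"
    proof (cases "w k = 0")
      case False
      have "fst (v - k) - snd (v - k) - int n = (fst v - snd v - int (Suc n)) - (fst k - snd k - 1)"
        by simp
      then have "int q dvd fst (v - k) - snd (v - k) - int n"
        using K[OF k False] Suc.prems by (metis dvd_diff)
      from Suc.IH[OF this] show ?thesis by simp
    qed simp
  qed
  finally show ?case by (simp add: sum_distrib_left sum_divide_distrib mult_ac)
qed

text \<open>Affine substitution in one variable at a time. Integrability of the transformed function is obtained
  from the same computation for nonnegative integrals.\<close>
lemma integral_shear:
  fixes F :: "real \<times> real \<Rightarrow> complex"
  assumes F: "integrable lborel F" and "a \<noteq> 0" "d \<noteq> 0"
  shows "(\<integral>\<theta>. F \<theta> \<partial>lborel) = of_real \<bar>a * d\<bar> * (\<integral>u. F (a * fst u, b * fst u + d * snd u) \<partial>lborel)"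
proof -
  let ?T = "\<lambda>u. (a * fst u, b * fst u + d * snd u)"
  have [measurable]: "F \<in> borel_measurable borel"
    using borel_measurable_integrable[OF F] by simp
  have F': "integrable (lborel \<Otimes>\<^sub>M lborel) F" using F by (simp add: lborel_prod)
  have T[measurable]: "?T \<in> borel_measurable borel"
    by (intro borel_measurable_continuous_onI continuous_intros)
  have "(\<integral>\<^sup>+\<theta>. norm (F \<theta>) \<partial>lborel) = (\<integral>\<^sup>+x. \<integral>\<^sup>+y. norm (F (x, y)) \<partial>lborel \<partial>lborel)"
    by (subst lborel.nn_integral_fst) (simp_all add: lborel_prod)
  also have "\<dots> = ennreal \<bar>a\<bar> * (\<integral>\<^sup>+x. \<integral>\<^sup>+y. norm (F (a * x, y)) \<partial>lborel \<partial>lborel)"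
    using assms(2) by (subst nn_integral_real_affine[where c = a and t = 0]) simp_all
  also have "(\<integral>\<^sup>+x. \<integral>\<^sup>+y. norm (F (a * x, y)) \<partial>lborel \<partial>lborel) =
      (\<integral>\<^sup>+x. ennreal \<bar>d\<bar> * (\<integral>\<^sup>+y. norm (F (a * x, b * x + d * y)) \<partial>lborel) \<partial>lborel)"
    using assms(3) by (intro nn_integral_cong nn_integral_real_affine) simp_all
  also have "\<dots> = ennreal \<bar>d\<bar> * (\<integral>\<^sup>+x. \<integral>\<^sup>+y. norm (F (?T (x, y))) \<partial>lborel \<partial>lborel)"
    by (subst nn_integral_cmult) simp_all
  also have "(\<integral>\<^sup>+x. \<integral>\<^sup>+y. norm (F (?T (x, y))) \<partial>lborel \<partial>lborel) = (\<integral>\<^sup>+u. norm (F (?T u)) \<partial>lborel)"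
    by (subst lborel.nn_integral_fst) (simp_all add: lborel_prod)
  finally have "(\<integral>\<^sup>+u. norm (F (?T u)) \<partial>lborel) < \<infinity>"
    using F assms(2,3) by (auto simp: integrable_iff_bounded ennreal_mult_less_top ennreal_mult_eq_top_iff less_top)
  then have FT: "integrable (lborel \<Otimes>\<^sub>M lborel) (\<lambda>u. F (?T u))"
    by (simp add: integrable_iff_bounded lborel_prod)
  have "(\<integral>\<theta>. F \<theta> \<partial>lborel) = (\<integral>x. \<integral>y. F (x, y) \<partial>lborel \<partial>lborel)"
    using lborel_pair.integral_fst'[OF F'] by (simp add: lborel_prod)
  also have "\<dots> = \<bar>a\<bar> *\<^sub>R (\<integral>x. \<integral>y. F (a * x, y) \<partial>lborel \<partial>lborel)"
    using lborel_integral_real_affine[OF assms(2), of "\<lambda>x. \<integral>y. F (x, y) \<partial>lborel" 0] by simp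
  also have "(\<integral>x. \<integral>y. F (a * x, y) \<partial>lborel \<partial>lborel) = (\<integral>x. \<bar>d\<bar> *\<^sub>R (\<integral>y. F (a * x, b * x + d * y) \<partial>lborel) \<partial>lborel)"
    by (intro Bochner_Integration.integral_cong refl lborel_integral_real_affine assms(3))
  also have "\<dots> = \<bar>d\<bar> *\<^sub>R (\<integral>x. \<integral>y. F (?T (x, y)) \<partial>lborel \<partial>lborel)" by simp
  also have "(\<integral>x. \<integral>y. F (?T (x, y)) \<partial>lborel \<partial>lborel) = (\<integral>u. F (?T u) \<partial>lborel)"
    using lborel_pair.integral_fst'[OF FT] by (simp add: lborel_prod)
  finally show ?thesis by (simp add: scaleR_conv_of_real abs_mult)
qed

text \<open>\<open>(x \<bullet> u, y \<bullet> u) = shear a b d u\<close> for \<open>x = (a, 0)\<close>, \<open>y = (b, d)\<close>, and \<open>shear_adj\<close> is the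
  adjoint map, sending the lattice vector \<open>(m, n)\<close> to its position \<open>m x + n y\<close> in the plane.\<close>
definition shear :: "real \<Rightarrow> real \<Rightarrow> real \<Rightarrow> real \<times> real \<Rightarrow> real \<times> real" where
  "shear a b d u = (a * fst u, b * fst u + d * snd u)"

definition shear_adj :: "real \<Rightarrow> real \<Rightarrow> real \<Rightarrow> real \<times> real \<Rightarrow> real \<times> real" where
  "shear_adj a b d u = (a * fst u + b * snd u, d * snd u)"

lemma inner_shear: "v \<bullet> shear a b d u = shear_adj a b d v \<bullet> u"
  by (simp add: shear_def shear_adj_def inner_prod_def algebra_simps)

lemma continuous_shear: "continuous_on A (shear a b d)"
  unfolding shear_def by (intro continuous_intros)

lemma compact_vimage_shear:
  assumes "compact B" "a \<noteq> 0" "d \<noteq> 0"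
  shows "compact (shear a b d -` B)"
proof -
  let ?S = "\<lambda>\<theta>. (fst \<theta> / a, (snd \<theta> - b * (fst \<theta> / a)) / d)"
  have "shear a b d -` B = ?S ` B"
  proof -
    have "?S (shear a b d u) = u" "shear a b d (?S u) = u" for u
      using assms(2,3) by (simp_all add: shear_def prod_eq_iff)
    then show ?thesis by (metis (mono_tags, lifting) image_eqI subsetI subset_antisym vimageE vimageI image_subset_iff)
  qed
  moreover have "continuous_on B ?S" using assms(2,3) by (intro continuous_intros) auto
  ultimately show ?thesis using assms(1) by (simp add: compact_continuous_image)
qed

text \<open>The assumption on \<open>torus_char\<close> says that the walk has no other periodicity than the one already
  accounted for by \<open>q\<close>.\<close>
locale sheared_lattice_walk =
  isotropic_steps K w "\<lambda>k. shear_adj a b d (real_pair k)"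
  for K :: "(int \<times> int) set" and w a b d +
  fixes q :: nat
  assumes scale_pos: "a > 0" "d > 0"
    and q_pos: "q > 0"
    and step_class: "\<And>k. k \<in> K \<Longrightarrow> w k \<noteq> 0 \<Longrightarrow> int q dvd fst k - snd k - 1"
    and aperiodic: "\<And>\<theta>. \<theta> \<in> torus_box q \<Longrightarrow> \<theta> \<noteq> 0 \<Longrightarrow> norm (torus_char K w \<theta>) < 1"
begin

lemma chi_eq_torus_char: "chi u = torus_char K w (shear a b d u)"
  by (simp add: chi_def torus_char_def inner_shear)

lemma walk_prob_expansion:
  "\<exists>C. \<forall>n\<ge>1. \<forall>v. int q dvd fst v - snd v - int n \<longrightarrow>
     \<bar>2 * pi * real n * walk_prob K w n v
       - q * a * d * exp (- ((norm (shear_adj a b d (real_pair v)))\<^sup>2 / (2 * real n))) *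
         (\<Sum>j\<le>N. (1 / sqrt (real n)) ^ j *
            Re (gauss_transform (edgeworth_coeff j) ((1 / sqrt (real n)) *\<^sub>R shear_adj a b d (real_pair v))))\<bar>
     \<le> C * (1 / sqrt (real n)) ^ Suc N"
proof -
  let ?D = "shear a b d -` torus_box q"
  have D: "compact ?D"
    using scale_pos by (intro compact_vimage_shear compact_torus_box) auto
  have less: "\<forall>v\<in>?D. v \<noteq> 0 \<longrightarrow> norm (chi v) < 1"
  proof (intro ballI impI)
    fix v assume that: "v \<in> ?D" "v \<noteq> 0"
    have "shear a b d v \<noteq> 0" using that(2) scale_pos by (auto simp: shear_def prod_eq_iff)
    then show "norm (chi v) < 1" using that(1) aperiodic by (simp add: chi_eq_torus_char)
  qed
  obtain \<rho> where \<rho>: "\<rho> > 0" "ball 0 \<rho> \<subseteq> ?D"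
  proof -
    let ?U = "{- (pi / q)<..<pi / q} \<times> {- pi<..<pi}"
    have "open (shear a b d -` ?U)"
      by (intro open_vimage open_Times continuous_shear) auto
    moreover have "0 \<in> shear a b d -` ?U" using q_pos by (simp add: shear_def)
    ultimately obtain \<rho> where "\<rho> > 0" "ball 0 \<rho> \<subseteq> shear a b d -` ?U"
      by (meson openE)
    moreover have "?U \<subseteq> torus_box q" by (auto simp: torus_box_def)
    ultimately show ?thesis using that[of \<rho>] by blast
  qed
  obtain C where C: "\<And>n z. n \<ge> 1 \<Longrightarrow>
     norm ((\<integral>u. indicator ?D ((1 / sqrt (real n)) *\<^sub>R u) *\<^sub>R chi ((1 / sqrt (real n)) *\<^sub>R u) ^ n * iexp (- (z \<bullet> u)) \<partial>lborel)
        - 2 * pi * exp (- ((norm z)\<^sup>2 / 2)) *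
          (\<Sum>j\<le>N. of_real (1 / sqrt (real n)) ^ j * gauss_transform (edgeworth_coeff j) z))
     \<le> C * (1 / sqrt (real n)) ^ Suc N"
    by (fact fourier_integral_expansion[OF D less \<rho>, of N])
  define A where "A = real q * a * d / (2 * pi)"
  have A: "A \<ge> 0" using scale_pos by (simp add: A_def)
  have "\<bar>2 * pi * real n * walk_prob K w n v
       - q * a * d * exp (- ((norm (shear_adj a b d (real_pair v)))\<^sup>2 / (2 * real n))) *
         (\<Sum>j\<le>N. (1 / sqrt (real n)) ^ j *
            Re (gauss_transform (edgeworth_coeff j) ((1 / sqrt (real n)) *\<^sub>R shear_adj a b d (real_pair v))))\<bar>
     \<le> (A * C) * (1 / sqrt (real n)) ^ Suc N"
    if n: "n \<ge> 1" and v: "int q dvd fst v - snd v - int n" for n v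
  proof -
    define \<epsilon> where "\<epsilon> = 1 / sqrt (real n)"
    have e: "\<epsilon> > 0" and en: "real n * \<epsilon>\<^sup>2 = 1"
      using n by (auto simp: \<epsilon>_def power_divide)
    define z where "z = \<epsilon> *\<^sub>R shear_adj a b d (real_pair v)"
    define J where "J = (\<integral>u. indicator ?D (\<epsilon> *\<^sub>R u) *\<^sub>R chi (\<epsilon> *\<^sub>R u) ^ n * iexp (- (z \<bullet> u)) \<partial>lborel)"
    define S where "S = (\<Sum>j\<le>N. of_real \<epsilon> ^ j * gauss_transform (edgeworth_coeff j) z)"
    let ?F = "\<lambda>\<theta>. indicator (torus_box q) \<theta> *\<^sub>R (torus_char K w \<theta> ^ n * iexp (- (real_pair v \<bullet> \<theta>)))"
    have "integrable lborel ?F"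
      by (intro borel_integrable_compact compact_torus_box continuous_intros continuous_torus_char)
    from integral_shear[OF this, of "\<epsilon> * a" "\<epsilon> * d" "\<epsilon> * b"]
    have "(\<integral>\<theta>. ?F \<theta> \<partial>lborel) = of_real (\<epsilon>\<^sup>2 * a * d) *
        (\<integral>u. ?F (\<epsilon> * a * fst u, \<epsilon> * b * fst u + \<epsilon> * d * snd u) \<partial>lborel)"
      using e scale_pos by (simp add: abs_mult power2_eq_square mult_ac)
    also have "(\<integral>u. ?F (\<epsilon> * a * fst u, \<epsilon> * b * fst u + \<epsilon> * d * snd u) \<partial>lborel) = J"
      unfolding J_def
    proof (rule Bochner_Integration.integral_cong[OF refl])
      fix u
      have "(\<epsilon> * a * fst u, \<epsilon> * b * fst u + \<epsilon> * d * snd u) = shear a b d (\<epsilon> *\<^sub>R u)"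
        by (simp add: shear_def algebra_simps)
      moreover have "real_pair v \<bullet> shear a b d (\<epsilon> *\<^sub>R u) = z \<bullet> u"
        by (simp add: z_def inner_shear)
      ultimately show "?F (\<epsilon> * a * fst u, \<epsilon> * b * fst u + \<epsilon> * d * snd u) =
          indicator ?D (\<epsilon> *\<^sub>R u) *\<^sub>R chi (\<epsilon> *\<^sub>R u) ^ n * iexp (- (z \<bullet> u))"
        by (simp only: chi_eq_torus_char indicator_def vimage_eq scaleR_scaleR mult_scaleR_left)
    qed
    finally have "of_real (4 * pi\<^sup>2 / q * walk_prob K w n v) = of_real (\<epsilon>\<^sup>2 * a * d) * J"
      using walk_prob_fourier[OF q_pos step_class v] by simp
    then have "of_real (4 * pi\<^sup>2 * walk_prob K w n v) = of_real (real q * \<epsilon>\<^sup>2 * a * d) * J"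
      using q_pos by (simp add: field_simps)
    then have "of_real (real n * (4 * pi\<^sup>2 * walk_prob K w n v)) = of_real ((real n * \<epsilon>\<^sup>2) * real q * a * d) * J"
      by (simp add: mult_ac)
    then have "of_real (2 * pi * (2 * pi * real n * walk_prob K w n v)) = of_real (2 * pi * A) * J"
      unfolding en by (simp add: A_def power2_eq_square mult_ac)
    then have walk: "of_real (2 * pi * real n * walk_prob K w n v) = of_real A * J" by (simp add: mult_ac)
    have "norm (of_real A * J - of_real A * (2 * pi * exp (- ((norm z)\<^sup>2 / 2)) * S)) \<le> A * (C * \<epsilon> ^ Suc N)"
      using mult_left_mono[OF C[OF n, of z] A] A
      unfolding J_def S_def \<epsilon>_def by (simp add: norm_mult flip: right_diff_distrib)
    moreover have "of_real A * (2 * pi * exp (- ((norm z)\<^sup>2 / 2)) * S) = of_real (q * a * d * exp (- ((norm z)\<^sup>2 / 2))) * S"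
      by (simp add: A_def)
    moreover have "\<bar>Re x\<bar> \<le> norm x" for x by (rule abs_Re_le_cmod)
    ultimately have "\<bar>Re (of_real (2 * pi * real n * walk_prob K w n v) - of_real (q * a * d * exp (- ((norm z)\<^sup>2 / 2))) * S)\<bar>
        \<le> A * (C * \<epsilon> ^ Suc N)"
      unfolding walk by (metis order_trans)
    moreover have "Re S = (\<Sum>j\<le>N. \<epsilon> ^ j * Re (gauss_transform (edgeworth_coeff j) z))"
      unfolding S_def Re_sum by (intro sum.cong refl) (simp flip: of_real_power)
    moreover have "(norm z)\<^sup>2 / 2 = (norm (shear_adj a b d (real_pair v)))\<^sup>2 / (2 * real n)"
      using n by (simp add: z_def \<epsilon>_def power_mult_distrib power_divide)
    ultimately show ?thesis unfolding \<epsilon>_def[symmetric] z_def[symmetric] by (simp add: mult_ac)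
  qed
  then show ?thesis by blast
qed

end

section \<open>The walk on the triangular lattice\<close>

lemma powr_neg_half_eq_power: "n \<ge> 1 \<Longrightarrow> real n powr (- real j / 2) = (1 / sqrt (real n)) ^ j"
proof -
  assume n: "n \<ge> 1"
  have "real n powr (- real j / 2) = (real n powr (1/2)) powr (- real j)" by (simp add: powr_powr)
  also have "\<dots> = (1 / sqrt (real n)) ^ j"
    using n by (simp add: powr_half_sqrt powr_minus powr_realpow power_divide inverse_eq_divide)
  finally show ?thesis .
qed

definition hex_steps :: "(int \<times> int) set" where
  "hex_steps = {(1, 0), (- 1, 0), (0, 1), (0, - 1), (- 1, 1), (1, - 1)}"

lemma sum_hex_steps:
  "(\<Sum>k\<in>hex_steps. f k) = f (1, 0) + f (- 1, 0) + f (0, 1) + f (0, - 1) + f (- 1, 1) + f (1, - 1)"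
  for f :: "int \<times> int \<Rightarrow> 'a :: comm_monoid_add"
  by (simp add: hex_steps_def add.assoc)

text \<open>Rotate the combination to 1: the real parts of the rotated unit vectors are at most 1 and average to 1,
  so those of positive weight are all 1. Thus only a common phase gives modulus 1.\<close>
lemma convex_unit_norm_eq_1:
  assumes "finite K" and "\<And>k. k \<in> K \<Longrightarrow> 0 \<le> w k" and "(\<Sum>k\<in>K. w k) = 1"
    and "\<not> norm (\<Sum>k\<in>K. of_real (w k) * iexp (t k)) < 1"
    and k: "k \<in> K" "w k \<noteq> 0"
  shows "iexp (t k) = (\<Sum>k\<in>K. of_real (w k) * iexp (t k))"
proof -
  define z where "z = (\<Sum>k\<in>K. of_real (w k) * iexp (t k))"
  have "norm z \<le> (\<Sum>k\<in>K. norm (of_real (w k) * iexp (t k)))"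
    unfolding z_def by (rule norm_sum)
  also have "\<dots> = (\<Sum>k\<in>K. w k)"
    using assms(2) by (intro sum.cong) (auto simp: norm_mult)
  finally have z: "norm z = 1" using assms(3,4) unfolding z_def by linarith
  then have zz: "z * cnj z = 1" by (simp add: complex_norm_square[symmetric])
  let ?r = "\<lambda>k. Re (cnj z * iexp (t k))"
  have r: "?r k \<le> 1" for k
    using complex_Re_le_cmod[of "cnj z * iexp (t k)"] z by (simp add: norm_mult)
  have "(\<Sum>k\<in>K. w k * ?r k) = Re (cnj z * z)"
    unfolding z_def[of] Re_sum[symmetric] sum_distrib_left
    by (simp add: z_def sum_distrib_left mult_ac)
  also have "\<dots> = 1" using zz by (simp add: mult.commute)
  finally have "(\<Sum>k\<in>K. w k * (1 - ?r k)) = 0"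
    using assms(3) by (simp add: right_diff_distrib sum_subtractf)
  moreover have "\<forall>k\<in>K. 0 \<le> w k * (1 - ?r k)"
    using assms(2) r by (auto intro!: mult_nonneg_nonneg)
  ultimately have "w k * (1 - ?r k) = 0"
    using assms(1) k(1) by (subst (asm) sum_nonneg_eq_0_iff) auto
  then have "?r k = 1" using k(2) by simp
  moreover have "norm (cnj z * iexp (t k)) = 1" using z by (simp add: norm_mult)
  ultimately have "cnj z * iexp (t k) = 1"
    by (metis cmod_eq_Re complex_Re_le_cmod abs_one complex_eq_iff norm_one Re_complex_of_real cmod_power2
        add_cancel_left_right one_complex.simps power_eq_0_iff power_one zero_eq_power2)
  then have "z * cnj z * iexp (t k) = z" by (simp only: mult.assoc mult_1_right)
  then show ?thesis unfolding zz mult_1_left by (simp only: z_def)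
qed

text \<open>Lists of coefficients and exponents let the simplifier evaluate the transform of an explicit
  polynomial.\<close>
lemma gauss_transform_monom_sum:
  "gauss_transform (\<lambda>u. \<Sum>(c, i, k)\<leftarrow>xs. c * monom2 i k u) z = (\<Sum>(c, i, k)\<leftarrow>xs. c * (herm i (fst z) * herm k (snd z)))"
    (is "?A xs")
  and "\<And>z. integrable lborel (\<lambda>u. (\<Sum>(c, i, k)\<leftarrow>xs. c * monom2 i k u) * of_real (std_gauss u) * iexp (- (z \<bullet> u)))"
    (is "\<And>z. ?B xs z")
proof -
  have "?A xs \<and> (\<forall>z. ?B xs z)"
  proof (induction xs)
    case Nil
    show ?case by (simp add: gauss_transform_def)
  next
    case (Cons x xs)
    obtain c i k where x: "x = (c, i, k)" by (cases x) auto
    let ?S = "\<lambda>u. \<Sum>(c, i, k)\<leftarrow>xs. c * monom2 i k u"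
    have 1: "integrable lborel (\<lambda>u. c * (monom2 i k u * of_real (std_gauss u) * iexp (- (z \<bullet> u))))" for z
      by (intro integrable_mult_right integrable_gauss_monom)
    have 2: "integrable lborel (\<lambda>u. ?S u * of_real (std_gauss u) * iexp (- (z \<bullet> u)))" for z
      using Cons.IH by blast
    have split: "(c * monom2 i k u + ?S u) * of_real (std_gauss u) * iexp (- (z \<bullet> u)) =
        c * (monom2 i k u * of_real (std_gauss u) * iexp (- (z \<bullet> u))) +
        ?S u * of_real (std_gauss u) * iexp (- (z \<bullet> u))" for u z
      by (simp only: distrib_right mult.assoc)
    have "gauss_transform (\<lambda>u. c * monom2 i k u + ?S u) z = c * gauss_transform (monom2 i k) z + gauss_transform ?S z"
      unfolding gauss_transform_def split
      by (subst Bochner_Integration.integral_add[OF 1 2]) (simp add: distrib_left mult.left_commute)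
    moreover have "integrable lborel (\<lambda>u. (c * monom2 i k u + ?S u) * of_real (std_gauss u) * iexp (- (z \<bullet> u)))" for z
      unfolding split by (intro Bochner_Integration.integrable_add 1 2)
    ultimately show ?case using Cons.IH by (simp add: x gauss_transform_monom)
  qed
  then show "?A xs" "\<And>z. ?B xs z" by blast+
qed

definition hex_weight :: "real \<Rightarrow> real \<Rightarrow> real \<Rightarrow> real \<Rightarrow> real \<Rightarrow> real \<Rightarrow> int \<times> int \<Rightarrow> real" where
  "hex_weight \<alpha> \<alpha>' \<beta> \<beta>' \<gamma> \<gamma>' k =
     (if k = (1, 0) then \<alpha> else if k = (- 1, 0) then \<alpha>' else
      if k = (0, 1) then \<beta>' else if k = (0, - 1) then \<beta> else
      if k = (- 1, 1) then \<gamma> else \<gamma>')"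

lemma hex_weight_simps [simp]:
  "hex_weight \<alpha> \<alpha>' \<beta> \<beta>' \<gamma> \<gamma>' (1, 0) = \<alpha>" "hex_weight \<alpha> \<alpha>' \<beta> \<beta>' \<gamma> \<gamma>' (- 1, 0) = \<alpha>'"
  "hex_weight \<alpha> \<alpha>' \<beta> \<beta>' \<gamma> \<gamma>' (0, 1) = \<beta>'" "hex_weight \<alpha> \<alpha>' \<beta> \<beta>' \<gamma> \<gamma>' (0, - 1) = \<beta>"
  "hex_weight \<alpha> \<alpha>' \<beta> \<beta>' \<gamma> \<gamma>' (- 1, 1) = \<gamma>" "hex_weight \<alpha> \<alpha>' \<beta> \<beta>' \<gamma> \<gamma>' (1, - 1) = \<gamma>'"
  by (simp_all add: hex_weight_def)

locale triangular_walk =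
  fixes \<alpha> \<alpha>' \<beta> \<beta>' \<gamma> \<gamma>' \<kappa> a b c :: real
    and h1 h2 :: "real^2"
    and p :: "(real^2) \<times> (real^2) \<Rightarrow> real"
  assumes abc: "a = \<alpha> + \<alpha>'" "b = \<beta> + \<beta>'" "c = \<gamma> + \<gamma>'"
    and Gam_pos: "Gam a b c > 0"
    and h1: "h1 = h1_vec a b c" and h2: "h2 = h2_vec a b c"
    and walk: "zero_mean_walk h1 h2 p \<alpha> \<alpha>' \<beta> \<beta>' \<gamma> \<gamma>' \<kappa>"
begin

lemma weights_nonneg: "0 \<le> \<alpha>" "0 \<le> \<alpha>'" "0 \<le> \<beta>" "0 \<le> \<beta>'" "0 \<le> \<gamma>" "0 \<le> \<gamma>'"
  and weights_sum: "\<alpha> + \<alpha>' + \<beta> + \<beta>' + \<gamma> + \<gamma>' = 1"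
  and drift: "\<alpha> - \<alpha>' = \<kappa>" "\<beta> - \<beta>' = \<kappa>" "\<gamma> - \<gamma>' = \<kappa>" "0 \<le> \<kappa>" "\<kappa> \<le> 1/3"
  and p_steps: "\<And>x. x \<in> tri_lattice h1 h2 \<Longrightarrow>
        p (x, x + h1) = \<alpha> \<and> p (x, x - h1) = \<alpha>' \<and> p (x, x + h2) = \<beta>' \<and> p (x, x - h2) = \<beta> \<and>
        p (x, x + (h2 - h1)) = \<gamma> \<and> p (x, x - (h2 - h1)) = \<gamma>'"
  using walk unfolding zero_mean_walk_def by blast+

lemma abc_nonneg: "0 \<le> a" "0 \<le> b" "0 \<le> c"
  using weights_nonneg abc by auto

lemma bc_pos: "b + c > 0"
proof (rule ccontr)
  assume "\<not> b + c > 0"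
  then have "b = 0" "c = 0" using abc_nonneg by auto
  then show False using Gam_pos by (simp add: Gam_def)
qed

text \<open>The vectors \<open>sqrt 3 * h1\<close> and \<open>sqrt 3 * h2\<close> are \<open>(ex, 0)\<close> and \<open>(ey, ez)\<close>.\<close>
definition ex :: real where "ex = sqrt 3 * l_const a b c"
definition ey :: real where "ey = c / (b + c) * ex"
definition ez :: real where "ez = sqrt (Gam a b c) / (b + c) * ex"

lemma ex_pos: "ex > 0"
  using bc_pos Gam_pos by (simp add: ex_def l_const_def)

lemma ez_pos: "ez > 0"
  using bc_pos Gam_pos ex_pos by (simp add: ez_def)

lemma ex_sq: "ex\<^sup>2 = (b + c) / Gam a b c"
  using bc_pos Gam_pos by (simp add: ex_def l_const_def power_mult_distrib field_simps)

lemma ez_sq: "ez\<^sup>2 = 1 / (b + c)"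
  using bc_pos Gam_pos by (simp add: ez_def power_mult_distrib power_divide ex_sq) (simp add: power2_eq_square)

lemma ex_times_ez: "ex * ez = 3 * A_G a b c"
proof -
  have "ex * ez = sqrt (Gam a b c) / (b + c) * ex\<^sup>2" by (simp add: ez_def power2_eq_square)
  also have "\<dots> = sqrt (Gam a b c) / Gam a b c" using bc_pos by (simp add: ex_sq)
  also have "\<dots> = 1 / sqrt (Gam a b c)" using Gam_pos by (simp add: real_div_sqrt field_simps)
  finally show ?thesis by (simp add: A_G_def)
qed

abbreviation "wt \<equiv> hex_weight \<alpha> \<alpha>' \<beta> \<beta>' \<gamma> \<gamma>'"
abbreviation "plane \<equiv> shear_adj ex ey ez"

text \<open>In lattice coordinates the covariance matrix has the quadratic form \<open>a x\<^sup>2 + b y\<^sup>2 + c (y - x)\<^sup>2\<close>.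
  Completing the square diagonalises it.\<close>
lemma quadratic_form:
  "a * (ex * x)\<^sup>2 + b * (ey * x + ez * y)\<^sup>2 + c * (ey * x + ez * y - ex * x)\<^sup>2 = x\<^sup>2 + y\<^sup>2"
proof -
  have 1: "(b + c) * ey = c * ex" using bc_pos by (simp add: ey_def)
  have 2: "(b + c) * ez\<^sup>2 = 1" using bc_pos by (simp add: ez_sq)
  have 3: "(a * (b + c) + b * c) * ex\<^sup>2 = b + c"
    using Gam_pos by (simp add: ex_sq Gam_def field_simps)
  have "(b + c) * (a * (ex * x)\<^sup>2 + b * (ey * x + ez * y)\<^sup>2 + c * (ey * x + ez * y - ex * x)\<^sup>2)
      = (b + c) * (x\<^sup>2 + y\<^sup>2)"
    using 1 2 3 by algebra
  then show ?thesis using bc_pos by simp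
qed

lemma plane_inner:
  "plane (real_pair k) \<bullet> u = of_int (fst k) * (ex * fst u) + of_int (snd k) * (ey * fst u + ez * snd u)"
proof -
  have "plane (real_pair k) \<bullet> u = real_pair k \<bullet> shear ex ey ez u" by (simp only: inner_shear)
  then show ?thesis by (simp add: shear_def real_pair_def inner_prod_def)
qed

sublocale isotropic_steps hex_steps wt "\<lambda>k. plane (real_pair k)"
proof
  show "finite hex_steps" by (simp add: hex_steps_def)
  show "0 \<le> wt k" for k using weights_nonneg by (simp add: hex_weight_def)
  show "(\<Sum>k\<in>hex_steps. wt k) = 1" using weights_sum by (simp add: sum_hex_steps)
  fix u :: "real \<times> real"
  define X where "X = ex * fst u"
  define Y where "Y = ey * fst u + ez * snd u"
  have inner: "plane (real_pair k) \<bullet> u = of_int (fst k) * X + of_int (snd k) * Y" for k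
    unfolding plane_inner X_def Y_def ..
  have \<alpha>': "\<alpha>' = \<alpha> - \<kappa>" "\<beta>' = \<beta> - \<kappa>" "\<gamma>' = \<gamma> - \<kappa>" using drift by simp_all
  show "(\<Sum>k\<in>hex_steps. wt k * (plane (real_pair k) \<bullet> u)) = 0"
    unfolding inner sum_hex_steps by (simp add: \<alpha>' algebra_simps)
  have "(\<Sum>k\<in>hex_steps. wt k * (plane (real_pair k) \<bullet> u)\<^sup>2) =
      (\<alpha> + \<alpha>') * X\<^sup>2 + (\<beta> + \<beta>') * Y\<^sup>2 + (\<gamma> + \<gamma>') * (Y - X)\<^sup>2"
    unfolding inner sum_hex_steps by (simp add: algebra_simps power2_eq_square)
  also have "\<dots> = a * (ex * fst u)\<^sup>2 + b * (ey * fst u + ez * snd u)\<^sup>2 + c * (ey * fst u + ez * snd u - ex * fst u)\<^sup>2"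
    by (simp only: abc X_def Y_def)
  also have "\<dots> = (norm u)\<^sup>2"
    unfolding quadratic_form by (simp add: norm_prod_def)
  finally show "(\<Sum>k\<in>hex_steps. wt k * (plane (real_pair k) \<bullet> u)\<^sup>2) = (norm u)\<^sup>2" .
qed

definition pos :: "int \<times> int \<Rightarrow> real^2" where
  "pos v = of_int (fst v) *\<^sub>R h1 + of_int (snd v) *\<^sub>R h2"

lemma plane_eq_pos: "plane (y1, y2) = (sqrt 3 * (y1 *\<^sub>R h1 + y2 *\<^sub>R h2) $ 1, sqrt 3 * (y1 *\<^sub>R h1 + y2 *\<^sub>R h2) $ 2)"
  by (simp add: shear_adj_def h1 h2 h1_vec_def h2_vec_def ex_def ey_def ez_def algebra_simps)

lemma norm_plane: "(norm (plane (y1, y2)))\<^sup>2 = 3 * (norm (y1 *\<^sub>R h1 + y2 *\<^sub>R h2))\<^sup>2"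
proof -
  have "(norm y)\<^sup>2 = (y $ 1)\<^sup>2 + (y $ 2)\<^sup>2" for y :: "real^2"
    by (simp add: norm_vec_def L2_set_def sum_2)
  then show ?thesis
    by (simp add: plane_eq_pos power2_norm_eq_inner[of "(_, _)"] inner_prod_def power_mult_distrib flip: power2_eq_square)
qed

lemma pos_eq_0: "pos v = 0 \<Longrightarrow> v = 0"
proof -
  assume "pos v = 0"
  then have "plane (of_int (fst v), of_int (snd v)) = 0"
    unfolding plane_eq_pos pos_def by (simp add: zero_prod_def)
  then show "v = 0" using ex_pos ez_pos by (auto simp: shear_adj_def prod_eq_iff)
qed

lemma pos_diff: "pos (v - k) = pos v - pos k"
  by (simp add: pos_def algebra_simps)

lemma inj_pos: "inj pos"
  by (rule injI) (metis pos_diff pos_eq_0 eq_iff_diff_eq_0)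

lemma tri_lattice_eq: "tri_lattice h1 h2 = range pos"
  by (force simp: tri_lattice_def pos_def image_def)

lemma lattice_add_pos: "x \<in> tri_lattice h1 h2 \<Longrightarrow> x + pos k \<in> tri_lattice h1 h2"
proof -
  have "pos u + pos k = pos (u + k)" for u by (simp add: pos_def algebra_simps)
  then show "x \<in> tri_lattice h1 h2 \<Longrightarrow> x + pos k \<in> tri_lattice h1 h2"
    by (auto simp: tri_lattice_eq)
qed

lemma out_edges:
  assumes "x \<in> tri_lattice h1 h2"
  shows "{e. e \<in> tri_edges h1 h2 \<and> fst e = x} = (\<lambda>k. (x, x + pos k)) ` hex_steps"
proof -
  let ?N = "{h1, - h1, h2, - h2, h2 - h1, - (h2 - h1)}"
  have N: "pos ` hex_steps = ?N" by (simp add: hex_steps_def pos_def insert_commute)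
  have sym: "x - y \<in> ?N \<longleftrightarrow> y - x \<in> ?N" for y by (auto simp: algebra_simps)
  show ?thesis
  proof (intro set_eqI iffI)
    fix e assume "e \<in> {e. e \<in> tri_edges h1 h2 \<and> fst e = x}"
    then obtain y where e: "e = (x, y)" "y - x \<in> pos ` hex_steps"
      unfolding N using sym by (cases e) (auto simp: tri_edges_def)
    then obtain k where "k \<in> hex_steps" "y = x + pos k" by (auto simp: algebra_simps)
    then show "e \<in> (\<lambda>k. (x, x + pos k)) ` hex_steps" using e by blast
  next
    fix e assume "e \<in> (\<lambda>k. (x, x + pos k)) ` hex_steps"
    then obtain k where k: "k \<in> hex_steps" "e = (x, x + pos k)" by blast
    then have "x + pos k - x \<in> ?N" unfolding N[symmetric] by simp
    then show "e \<in> {e. e \<in> tri_edges h1 h2 \<and> fst e = x}"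
      using assms lattice_add_pos[OF assms, of k] sym[of "x + pos k"] k by (simp add: tri_edges_def)
  qed
qed

lemma finite_out_edges: "finite {e. e \<in> tri_edges h1 h2 \<and> fst e = x}"
proof (cases "x \<in> tri_lattice h1 h2")
  case True then show ?thesis by (simp add: out_edges hex_steps_def)
next
  case False
  then have "{e. e \<in> tri_edges h1 h2 \<and> fst e = x} = {}" by (auto simp: tri_edges_def)
  then show ?thesis by (simp only: finite.emptyI)
qed

lemma nstep_prob_eq_walk_prob:
  assumes "x \<in> tri_lattice h1 h2"
  shows "nstep_prob (tri_edges h1 h2) p n x (x + pos v) = walk_prob hex_steps wt n v"
  using assms
proof (induction n arbitrary: x v)
  case 0
  show ?case using pos_eq_0[of v] by (auto simp: nstep_prob_0 pos_def)
next
  case (Suc n)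
  have inj: "inj_on (\<lambda>k. (x, x + pos k)) hex_steps"
    using inj_pos by (auto simp: inj_on_def)
  have p: "p (x, x + pos k) = wt k" if "k \<in> hex_steps" for k
    using that p_steps[OF Suc.prems] by (auto simp: hex_steps_def pos_def algebra_simps)
  have "nstep_prob (tri_edges h1 h2) p (Suc n) x (x + pos v) =
      (\<Sum>k\<in>hex_steps. p (x, x + pos k) * nstep_prob (tri_edges h1 h2) p n (x + pos k) (x + pos v))"
    by (simp add: nstep_prob_Suc[OF finite_out_edges] out_edges[OF Suc.prems] sum.reindex[OF inj])
  also have "\<dots> = (\<Sum>k\<in>hex_steps. wt k * walk_prob hex_steps wt n (v - k))"
  proof (rule sum.cong[OF refl])
    fix k assume k: "k \<in> hex_steps"
    have eq: "x + pos v = (x + pos k) + pos (v - k)" by (simp add: pos_diff)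
    show "p (x, x + pos k) * nstep_prob (tri_edges h1 h2) p n (x + pos k) (x + pos v) =
        wt k * walk_prob hex_steps wt n (v - k)"
      using Suc.IH[OF lattice_add_pos[OF Suc.prems, of k], of "v - k"] by (simp only: eq p[OF k])
  qed
  finally show ?case by simp
qed

text \<open>The real part loses nothing, since the quantity that is approximated is real; it makes the
  polynomials real without examining their coefficients.\<close>
definition edgeworth_poly :: "nat \<Rightarrow> real^2 \<Rightarrow> real" where
  "edgeworth_poly j y = Re (gauss_transform (edgeworth_coeff j) (sqrt 3 * y $ 1, sqrt 3 * y $ 2))"

lemma edgeworth_poly_plane:
  "edgeworth_poly j (y1 *\<^sub>R h1 + y2 *\<^sub>R h2) = Re (gauss_transform (edgeworth_coeff j) (plane (y1, y2)))"
  by (simp add: edgeworth_poly_def plane_eq_pos)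

lemma expansion_polys_edgeworth: "expansion_polys h1 h2 edgeworth_poly"
  unfolding expansion_polys_def
proof (intro allI impI conjI)
  fix j :: nat
  have pp: "parity_poly (3 * j) (gauss_transform (edgeworth_coeff j))"
    by (intro parity_poly_gauss_transform parity_poly_edgeworth_coeff)
  have "parity_poly (3 * j) (\<lambda>u. gauss_transform (edgeworth_coeff j) (plane u))"
    using parity_poly_subst[OF pp, of "(ex, ey)" "(0, ez)"]
    by (simp add: shear_adj_def inner_prod_def)
  from parity_poly_coeffs[OF this] show "poly_deg_le h1 h2 (3 * j) (edgeworth_poly j)"
    unfolding poly_deg_le_def edgeworth_poly_plane .
  have neg: "edgeworth_poly j (- y) = (-1) ^ (3 * j) * edgeworth_poly j y" for y
  proof -
    have "gauss_transform (edgeworth_coeff j) (- (sqrt 3 * y $ 1, sqrt 3 * y $ 2)) =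
        of_real ((- 1) ^ (3 * j)) * gauss_transform (edgeworth_coeff j) (sqrt 3 * y $ 1, sqrt 3 * y $ 2)"
      using parity_poly_uminus[OF pp, of "(sqrt 3 * y $ 1, sqrt 3 * y $ 2)"] by simp
    then show ?thesis unfolding edgeworth_poly_def by (simp del: of_real_power)
  qed
  show "edgeworth_poly j (- y) = - edgeworth_poly j y" if "odd j" for y
    using neg[of y] that by simp
  show "edgeworth_poly j (- y) = edgeworth_poly j y" if "even j" for y
    using neg[of y] that by simp
qed

lemma edgeworth_poly_0: "edgeworth_poly 0 y = 1"
  using gauss_transform_monom[of 0 0]
  by (simp add: edgeworth_poly_def edgeworth_coeff_simps(1)[abs_def])

text \<open>The factor \<open>q\<close> is the price of conditioning on the class of \<open>v\<close>: the walk is spread over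
  only one of \<open>q\<close> classes at each time. For \<open>q = 1\<close> there is one class.\<close>
lemma nstep_prob_expansion:
  assumes q: "q > 0" "\<forall>k\<in>hex_steps. wt k \<noteq> 0 \<longrightarrow> int q dvd fst k - snd k - 1"
    and aperiodic: "\<forall>\<theta>\<in>torus_box q. \<theta> \<noteq> 0 \<longrightarrow> norm (torus_char hex_steps wt \<theta>) < 1"
  obtains C where "\<And>n x v. n \<ge> 1 \<Longrightarrow> x \<in> tri_lattice h1 h2 \<Longrightarrow> int q dvd fst v - snd v - int n \<Longrightarrow>
     \<bar>2 * pi * real n * nstep_prob (tri_edges h1 h2) p n x (x + pos v)
       - real q * (3 * A_G a b c) * exp (- 3 / (2 * real n) * (norm (pos v))\<^sup>2)
           * (1 + correction_sum edgeworth_poly N n (pos v))\<bar>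
     \<le> C * real n powr (- (real N + 1) / 2)"
proof -
  interpret sheared_lattice_walk hex_steps wt ex ey ez q
    by unfold_locales (use ex_pos ez_pos q aperiodic in auto)
  obtain C where C: "\<forall>n\<ge>1. \<forall>v. int q dvd fst v - snd v - int n \<longrightarrow>
     \<bar>2 * pi * real n * walk_prob hex_steps wt n v
       - q * ex * ez * exp (- ((norm (plane (real_pair v)))\<^sup>2 / (2 * real n))) *
         (\<Sum>j\<le>N. (1 / sqrt (real n)) ^ j *
            Re (gauss_transform (edgeworth_coeff j) ((1 / sqrt (real n)) *\<^sub>R plane (real_pair v))))\<bar>
     \<le> C * (1 / sqrt (real n)) ^ Suc N"
    using walk_prob_expansion[of N] ..
  show ?thesis
  proof (rule that[of C])
    fix n :: nat and x v
    assume n: "n \<ge> 1" and x: "x \<in> tri_lattice h1 h2" and v: "int q dvd fst v - snd v - int n"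
    let ?\<epsilon> = "1 / sqrt (real n)"
    have "?\<epsilon> *\<^sub>R plane (real_pair v) = plane (?\<epsilon> * of_int (fst v), ?\<epsilon> * of_int (snd v))"
      by (simp add: shear_adj_def real_pair_def algebra_simps)
    moreover have "?\<epsilon> *\<^sub>R pos v = (?\<epsilon> * of_int (fst v)) *\<^sub>R h1 + (?\<epsilon> * of_int (snd v)) *\<^sub>R h2"
      by (simp add: pos_def scaleR_add_right)
    ultimately have poly: "Re (gauss_transform (edgeworth_coeff j) (?\<epsilon> *\<^sub>R plane (real_pair v))) = edgeworth_poly j (?\<epsilon> *\<^sub>R pos v)" for j
      by (simp only: edgeworth_poly_plane)
    have "(\<Sum>j\<le>N. ?\<epsilon> ^ j * edgeworth_poly j (?\<epsilon> *\<^sub>R pos v)) =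
        ?\<epsilon> ^ 0 * edgeworth_poly 0 (?\<epsilon> *\<^sub>R pos v) + (\<Sum>j = 1..N. ?\<epsilon> ^ j * edgeworth_poly j (?\<epsilon> *\<^sub>R pos v))"
      unfolding atMost_atLeast0 by (subst sum.atLeast_Suc_atMost) simp_all
    then have sum: "(\<Sum>j\<le>N. ?\<epsilon> ^ j * edgeworth_poly j (?\<epsilon> *\<^sub>R pos v)) = 1 + correction_sum edgeworth_poly N n (pos v)"
      unfolding correction_sum_def edgeworth_poly_0 powr_neg_half_eq_power[OF n] by simp
    have norm: "- ((norm (plane (real_pair v)))\<^sup>2 / (2 * real n)) = - 3 / (2 * real n) * (norm (pos v))\<^sup>2"
      unfolding real_pair_def norm_plane by (simp add: pos_def)
    have pw: "real n powr (- (real N + 1) / 2) = ?\<epsilon> ^ Suc N"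
      using powr_neg_half_eq_power[OF n, of "Suc N"] by (simp add: add.commute)
    show "\<bar>2 * pi * real n * nstep_prob (tri_edges h1 h2) p n x (x + pos v)
       - real q * (3 * A_G a b c) * exp (- 3 / (2 * real n) * (norm (pos v))\<^sup>2)
           * (1 + correction_sum edgeworth_poly N n (pos v))\<bar>
     \<le> C * real n powr (- (real N + 1) / 2)"
      using C[rule_format, OF n v]
      unfolding nstep_prob_eq_walk_prob[OF x] norm poly sum pw ex_times_ez[symmetric] by (simp only: mult.assoc)
  qed
qed

end

section \<open>The leading coefficient\<close>

text \<open>The linear part of \<open>P 1\<close> is of order \<open>1 / n\<close> like the constant part of \<open>P 2\<close>: it is evaluated at
  \<open>y / sqrt n\<close> and carries a factor \<open>1 / sqrt n\<close>.\<close>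
lemma correction_sum_limit:
  assumes cont: "\<And>j. continuous_on UNIV (P j)"
    and P1: "\<And>\<epsilon>. P 1 (\<epsilon> *\<^sub>R y) = \<epsilon> * s + \<epsilon> ^ 3 * r"
    and N: "N \<ge> 2"
  shows "(\<lambda>n. real n * (correction_sum P N n y - (s + P 2 0) * (1 / real n))) \<longlonglongrightarrow> 0"
proof -
  \<comment> \<open>\<open>n\<close> times the difference, written as a function of \<open>\<epsilon> = 1 / sqrt n\<close> that is continuous at 0\<close>
  define g where "g \<epsilon> = \<epsilon>\<^sup>2 * r + P 2 (\<epsilon> *\<^sub>R y) + (\<Sum>j = 3..N. \<epsilon> ^ (j - 2) * P j (\<epsilon> *\<^sub>R y)) - P 2 0" for \<epsilon>
  have "continuous_on UNIV g"
    unfolding g_def by (intro continuous_intros continuous_on_compose2[OF cont]) auto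
  then have "isCont g 0" by (simp add: continuous_on_eq_continuous_at)
  moreover have lim: "(\<lambda>n. 1 / sqrt (real n)) \<longlonglongrightarrow> 0"
    by (intro tendsto_divide_0[OF tendsto_const] filterlim_at_top_imp_at_infinity
        filterlim_compose[OF sqrt_at_top filterlim_real_sequentially])
  ultimately have "(\<lambda>n. g (1 / sqrt (real n))) \<longlonglongrightarrow> g 0"
    by (rule isCont_tendsto_compose)
  moreover have "g 0 = 0"
    unfolding g_def by (simp add: sum.neutral)
  moreover have "\<forall>\<^sub>F n in sequentially. g (1 / sqrt (real n)) = real n * (correction_sum P N n y - (s + P 2 0) * (1 / real n))"
    using eventually_ge_at_top[of 1]
  proof eventually_elim
    case (elim n)
    define \<epsilon> where "\<epsilon> = 1 / sqrt (real n)"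
    have e: "real n * \<epsilon>\<^sup>2 = 1" using elim by (simp add: \<epsilon>_def power_divide)
    have "correction_sum P N n y = (\<Sum>j = 1..N. \<epsilon> ^ j * P j (\<epsilon> *\<^sub>R y))"
      unfolding correction_sum_def \<epsilon>_def powr_neg_half_eq_power[OF elim] ..
    also have "\<dots> = \<epsilon> * P 1 (\<epsilon> *\<^sub>R y) + (\<epsilon>\<^sup>2 * P 2 (\<epsilon> *\<^sub>R y) + (\<Sum>j = 3..N. \<epsilon> ^ j * P j (\<epsilon> *\<^sub>R y)))"
    proof -
      have "{1..N} = insert 1 (insert 2 {3..N})" using N by auto
      then show ?thesis by simp
    qed
    also have "(\<Sum>j = 3..N. \<epsilon> ^ j * P j (\<epsilon> *\<^sub>R y)) = \<epsilon>\<^sup>2 * (\<Sum>j = 3..N. \<epsilon> ^ (j - 2) * P j (\<epsilon> *\<^sub>R y))"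
      unfolding sum_distrib_left
    proof (rule sum.cong[OF refl])
      fix j assume "j \<in> {3..N}"
      then have "j = 2 + (j - 2)" by auto
      then have "\<epsilon> ^ j = \<epsilon>\<^sup>2 * \<epsilon> ^ (j - 2)" by (metis power_add)
      then show "\<epsilon> ^ j * P j (\<epsilon> *\<^sub>R y) = \<epsilon>\<^sup>2 * (\<epsilon> ^ (j - 2) * P j (\<epsilon> *\<^sub>R y))" by simp
    qed
    finally have cs: "correction_sum P N n y = \<epsilon>\<^sup>2 * (s + g \<epsilon> + P 2 0)"
      unfolding P1 g_def by (simp add: algebra_simps power2_eq_square power3_eq_cube)
    have "real n * correction_sum P N n y = (real n * \<epsilon>\<^sup>2) * (s + g \<epsilon> + P 2 0)"
      unfolding cs by (simp only: mult.assoc)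
    also have "\<dots> = s + g \<epsilon> + P 2 0" by (simp only: e mult_1_left)
    finally show "g (1 / sqrt (real n)) = real n * (correction_sum P N n y - (s + P 2 0) * (1 / real n))"
      using elim by (simp add: right_diff_distrib flip: \<epsilon>_def)
  qed
  ultimately show ?thesis using Lim_transform_eventually by force
qed

lemma herm_simps:
  "herm 2 z = of_real (1 - z\<^sup>2)" "herm 3 z = \<i> * of_real (z ^ 3 - 3 * z)"
  by (simp_all add: eval_nat_numeral algebra_simps)

lemma herm_at_0:
  "herm (Suc 0) 0 = 0" "herm 2 0 = 1" "herm 3 0 = 0" "herm 4 0 = 3" "herm 5 0 = 0" "herm 6 0 = 15"
  by (simp_all add: eval_nat_numeral)

context triangular_walk
begin

lemma abc_sum: "a + b + c = 1"
  using weights_sum abc by simp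

abbreviation "G \<equiv> Gam a b c"

lemma G_eq: "G = a * (b + c) + b * c"
  by (simp add: Gam_def algebra_simps)

text \<open>The entries of the inverse covariance matrix in lattice coordinates are \<open>ex\<^sup>2\<close>, \<open>ex * ey\<close> and
  \<open>ey\<^sup>2 + ez\<^sup>2\<close>.\<close>
lemma e_products:
  "ex * ex = (b + c) / G" "ex * ey = c / G" "ey * ey = c * c / (G * (b + c))" "ez * ez = 1 / (b + c)"
proof -
  show 1: "ex * ex = (b + c) / G" using ex_sq by (simp add: power2_eq_square)
  show "ez * ez = 1 / (b + c)" using ez_sq by (simp add: power2_eq_square)
  define s where "s = b + c"
  have s: "s \<noteq> 0" using bc_pos by (simp add: s_def)
  have "ex * ey = c / s * (ex * ex)" "ey * ey = (c / s) * (c / s) * (ex * ex)"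
    by (simp_all add: ey_def s_def)
  then show "ex * ey = c / G" "ey * ey = c * c / (G * (b + c))"
    using s unfolding 1 s_def[symmetric] by simp_all
qed

lemma third_moment:
  "(\<Sum>k\<in>hex_steps. wt k * (plane (real_pair k) \<bullet> u) ^ 3) =
    3 * \<kappa> * (ex * ey * (ex - ey) * fst u ^ 3 + ex * ez * (ex - 2 * ey) * ((fst u)\<^sup>2 * snd u)
      - ex * ez\<^sup>2 * (fst u * (snd u)\<^sup>2))"
proof -
  define X where "X = ex * fst u"
  define Y where "Y = ey * fst u + ez * snd u"
  have inner: "plane (real_pair k) \<bullet> u = of_int (fst k) * X + of_int (snd k) * Y" for k
    unfolding plane_inner X_def Y_def ..
  have \<alpha>': "\<alpha>' = \<alpha> - \<kappa>" "\<beta>' = \<beta> - \<kappa>" "\<gamma>' = \<gamma> - \<kappa>" using drift by simp_all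
  have "(\<Sum>k\<in>hex_steps. wt k * (plane (real_pair k) \<bullet> u) ^ 3) = 3 * \<kappa> * (X * Y * (X - Y))"
    unfolding inner sum_hex_steps by (simp add: \<alpha>' algebra_simps power3_eq_cube)
  then show ?thesis
    unfolding X_def Y_def by (simp add: algebra_simps power3_eq_cube power2_eq_square)
qed

lemma fourth_moment:
  "(\<Sum>k\<in>hex_steps. wt k * (plane (real_pair k) \<bullet> u) ^ 4) =
    a * (ex * fst u) ^ 4 + b * (ey * fst u + ez * snd u) ^ 4 + c * ((ey - ex) * fst u + ez * snd u) ^ 4"
proof -
  define X where "X = ex * fst u"
  define Y where "Y = ey * fst u + ez * snd u"
  have inner: "plane (real_pair k) \<bullet> u = of_int (fst k) * X + of_int (snd k) * Y" for k
    unfolding plane_inner X_def Y_def ..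
  have "(- X) ^ 4 = X ^ 4" "(- Y) ^ 4 = Y ^ 4" "(X - Y) ^ 4 = (Y - X) ^ 4"
    by (simp, simp, algebra)
  then have "(\<Sum>k\<in>hex_steps. wt k * (plane (real_pair k) \<bullet> u) ^ 4) =
      (\<alpha> + \<alpha>') * X ^ 4 + (\<beta> + \<beta>') * Y ^ 4 + (\<gamma> + \<gamma>') * (Y - X) ^ 4"
    unfolding inner sum_hex_steps by (simp add: distrib_right)
  moreover have "Y - X = (ey - ex) * fst u + ez * snd u" by (simp add: X_def Y_def algebra_simps)
  ultimately show ?thesis unfolding X_def Y_def abc by simp
qed

lemma edgeworth_poly_1:
  "edgeworth_poly 1 (y1 *\<^sub>R h1 + y2 *\<^sub>R h2) =
    \<kappa> / 2 * (ex * ey * (ex - ey) * ((ex * y1 + ey * y2) ^ 3 - 3 * (ex * y1 + ey * y2))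
      - ex * ez * (ex - 2 * ey) * ((1 - (ex * y1 + ey * y2)\<^sup>2) * (ez * y2))
      + ex * ez\<^sup>2 * ((ex * y1 + ey * y2) * (1 - (ez * y2)\<^sup>2)))"
proof -
  define A1 where "A1 = ex * ey * (ex - ey)"
  define A2 where "A2 = ex * ez * (ex - 2 * ey)"
  define A3 where "A3 = ex * ez\<^sup>2"
  let ?c = "\<lambda>r. - \<i> * of_real (\<kappa> / 2 * r) :: complex"
  let ?xs = "[(?c A1, 3, 0), (?c A2, 2, 1), (?c (- A3), 1, 2)] :: (complex \<times> nat \<times> nat) list"
  have "edgeworth_coeff 1 u = (\<Sum>(c, i, k)\<leftarrow>?xs. c * monom2 i k u)" for u
  proof -
    have "edgeworth_coeff 1 u = - \<i> * of_real (3 * \<kappa> * (A1 * fst u ^ 3 + A2 * ((fst u)\<^sup>2 * snd u) - A3 * (fst u * (snd u)\<^sup>2))) / 6"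
      unfolding One_nat_def edgeworth_coeff_simps rem_coeff_simps third_moment A1_def A2_def A3_def ..
    also have "\<dots> = - \<i> * of_real (\<kappa> / 2 * (A1 * fst u ^ 3 + A2 * ((fst u)\<^sup>2 * snd u) - A3 * (fst u * (snd u)\<^sup>2)))"
      by simp
    also have "\<dots> = (\<Sum>(c, i, k)\<leftarrow>?xs. c * monom2 i k u)"
      by (simp add: algebra_simps diff_divide_distrib add_divide_distrib)
    finally show ?thesis .
  qed
  then have "edgeworth_coeff 1 = (\<lambda>u. \<Sum>(c, i, k)\<leftarrow>?xs. c * monom2 i k u)" by (rule ext)
  then have "edgeworth_poly 1 (y1 *\<^sub>R h1 + y2 *\<^sub>R h2) =
      Re (\<Sum>(c, i, k)\<leftarrow>?xs. c * (herm i (ex * y1 + ey * y2) * herm k (ez * y2)))"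
    unfolding edgeworth_poly_plane by (simp only: gauss_transform_monom_sum(1)) (simp add: shear_adj_def)
  then show ?thesis
    unfolding A1_def[symmetric] A2_def[symmetric] A3_def[symmetric]
    by (simp add: herm_simps algebra_simps add_divide_distrib diff_divide_distrib del: of_real_power of_real_diff)
qed

text \<open>Everything is expressed through \<open>e_products\<close>; the common denominator is then cleared with
  \<open>s = b + c\<close> as an atom.\<close>
lemma linear_part:
  "\<kappa> / 2 * (- 3 * (ex * ey * (ex - ey)) * (ex * y1 + ey * y2) - ex * ez * (ex - 2 * ey) * (ez * y2)
      + ex * ez\<^sup>2 * (ex * y1 + ey * y2)) = \<kappa> * a1_1 a b c y1 y2"
proof -
  define s where "s = b + c"
  have s: "s \<noteq> 0" and G: "G \<noteq> 0" using bc_pos Gam_pos by (auto simp: s_def)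
  let ?L = "- 3 * (ex * ey * (ex - ey)) * (ex * y1 + ey * y2) - ex * ez * (ex - 2 * ey) * (ez * y2)
      + ex * ez\<^sup>2 * (ex * y1 + ey * y2)"
  have "?L =
      (- 3 * (ex * ey) * (ex * ex - ex * ey) + (ex * ex) * (ez * ez)) * y1
      + (- 3 * (ex * ey) * (ex * ey - ey * ey) + 3 * (ex * ey) * (ez * ez) - (ex * ex) * (ez * ez)) * y2"
    by (simp add: algebra_simps power2_eq_square)
  also have "\<dots> = (- 3 * (c / G) * (s / G - c / G) + (s / G) * (1 / s)) * y1
      + (- 3 * (c / G) * (c / G - c * c / (G * s)) + 3 * (c / G) * (1 / s) - (s / G) * (1 / s)) * y2"
    unfolding e_products s_def ..
  also have "- 3 * (c / G) * (s / G - c / G) + (s / G) * (1 / s) = (G - 3 * c * b) / G\<^sup>2"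
    using s G by (simp add: field_simps power2_eq_square s_def)
  also have "- 3 * (c / G) * (c / G - c * c / (G * s)) + 3 * (c / G) * (1 / s) - (s / G) * (1 / s)
      = (- 3 * c * c * (s - c) + 3 * c * G - s * G) / (G\<^sup>2 * s)"
    using s G by (simp add: field_simps power2_eq_square)
  also have "- 3 * c * c * (s - c) + 3 * c * G - s * G = (- a * b - b * c + 2 * c * a) * s"
    unfolding G_eq s_def by (simp add: algebra_simps)
  also have "G - 3 * c * b = a * b - 2 * b * c + c * a" by (simp add: Gam_def)
  finally have L: "?L = (a * b - 2 * b * c + c * a) / G\<^sup>2 * y1 + (- a * b - b * c + 2 * c * a) * s / (G\<^sup>2 * s) * y2" .
  show ?thesis
    unfolding L using s G by (simp add: a1_1_def field_simps)
qed

text \<open>The value at the origin is the Gaussian expectation of a polynomial: its degree four part compares the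
  fourth moment with that of the Gaussian, its degree six part is the square of the third moment.\<close>
lemma edgeworth_poly_2_at_0: "edgeworth_poly 2 0 = a1_0 a b c + \<kappa>\<^sup>2 * a1_2 a b c"
proof -
  define s where "s = b + c"
  have s: "s \<noteq> 0" and G: "G \<noteq> 0" using bc_pos Gam_pos by (auto simp: s_def)
  define P where "P = ey * (ex - ey)"
  define Q where "Q = ez * (ex - 2 * ey)"
  define R where "R = - (ez\<^sup>2)"
  define T where "T = - (\<kappa>\<^sup>2 * ex\<^sup>2 / 8)"
  define f where "f = ey - ex"
  define m40 where "m40 = a * ex ^ 4 + b * ey ^ 4 + c * f ^ 4"
  define m31 where "m31 = 4 * (b * ey ^ 3 * ez + c * f ^ 3 * ez)"
  define m22 where "m22 = 6 * (b * ey\<^sup>2 * ez\<^sup>2 + c * f\<^sup>2 * ez\<^sup>2)"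
  define m13 where "m13 = 4 * (b * ey * ez ^ 3 + c * f * ez ^ 3)"
  define m04 where "m04 = b * ez ^ 4 + c * ez ^ 4"
  let ?ys = "[(m40 / 24 - 1 / 8, 4, 0), (m31 / 24, 3, 1), (m22 / 24 - 1 / 4, 2, 2), (m13 / 24, 1, 3), (m04 / 24 - 1 / 8, 0, 4),
    (T * P\<^sup>2, 6, 0), (T * (2 * P * Q), 5, 1), (T * (Q\<^sup>2 + 2 * P * R), 4, 2), (T * (2 * Q * R), 3, 3), (T * R\<^sup>2, 2, 4)]
    :: (real \<times> nat \<times> nat) list"
  let ?xs = "map (\<lambda>(c, i, k). (of_real c, i, k)) ?ys :: (complex \<times> nat \<times> nat) list"
  have "edgeworth_coeff 2 u = (\<Sum>(c, i, k)\<leftarrow>?xs. c * monom2 i k u)" for u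
  proof -
    define x where "x = fst u"
    define y where "y = snd u"
    have "edgeworth_coeff 2 u = of_real ((a * (ex * x) ^ 4 + b * (ey * x + ez * y) ^ 4 + c * (f * x + ez * y) ^ 4) / 24
        - ((norm u)\<^sup>2)\<^sup>2 / 8 - (\<kappa> / 2 * (ex * ey * (ex - ey) * x ^ 3 + ex * ez * (ex - 2 * ey) * (x\<^sup>2 * y)
      - ex * ez\<^sup>2 * (x * y\<^sup>2)))\<^sup>2 / 2)"
      unfolding edgeworth_coeff_simps rem_coeff_simps third_moment fourth_moment x_def y_def f_def
      by (simp add: power_mult_distrib power_divide)
    also have "(a * (ex * x) ^ 4 + b * (ey * x + ez * y) ^ 4 + c * (f * x + ez * y) ^ 4) =
        m40 * x ^ 4 + m31 * (x ^ 3 * y) + m22 * (x\<^sup>2 * y\<^sup>2) + m13 * (x * y ^ 3) + m04 * y ^ 4"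
      unfolding m40_def m31_def m22_def m13_def m04_def by algebra
    also have "(norm u)\<^sup>2 = x\<^sup>2 + y\<^sup>2" by (simp add: norm_prod_def x_def y_def)
    also have "(m40 * x ^ 4 + m31 * (x ^ 3 * y) + m22 * (x\<^sup>2 * y\<^sup>2) + m13 * (x * y ^ 3) + m04 * y ^ 4) / 24
        - (x\<^sup>2 + y\<^sup>2)\<^sup>2 / 8 - (\<kappa> / 2 * (ex * ey * (ex - ey) * x ^ 3 + ex * ez * (ex - 2 * ey) * (x\<^sup>2 * y)
        - ex * ez\<^sup>2 * (x * y\<^sup>2)))\<^sup>2 / 2 = (\<Sum>(c, i, k)\<leftarrow>?ys. c * (x ^ i * y ^ k))"
    proof -
      have "\<kappa> / 2 * (ex * ey * (ex - ey) * x ^ 3 + ex * ez * (ex - 2 * ey) * (x\<^sup>2 * y) - ex * ez\<^sup>2 * (x * y\<^sup>2))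
          = \<kappa> / 2 * ex * x * (P * x\<^sup>2 + Q * (x * y) + R * y\<^sup>2)"
        unfolding P_def Q_def R_def by (simp add: algebra_simps power2_eq_square power3_eq_cube)
      note eq = this
      have "(\<kappa> / 2 * (ex * ey * (ex - ey) * x ^ 3 + ex * ez * (ex - 2 * ey) * (x\<^sup>2 * y) - ex * ez\<^sup>2 * (x * y\<^sup>2)))\<^sup>2 / 2
          = - T * (x\<^sup>2 * (P * x\<^sup>2 + Q * (x * y) + R * y\<^sup>2)\<^sup>2)"
        unfolding eq T_def by (simp add: power_mult_distrib power_divide)
      moreover have "x\<^sup>2 * (P * x\<^sup>2 + Q * (x * y) + R * y\<^sup>2)\<^sup>2 =
          P\<^sup>2 * x ^ 6 + 2 * P * Q * (x ^ 5 * y) + (Q\<^sup>2 + 2 * P * R) * (x ^ 4 * y\<^sup>2) + 2 * Q * R * (x ^ 3 * y ^ 3) + R\<^sup>2 * (x\<^sup>2 * y ^ 4)"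
        by algebra
      moreover have "(x\<^sup>2 + y\<^sup>2)\<^sup>2 = x ^ 4 + 2 * (x\<^sup>2 * y\<^sup>2) + y ^ 4" by algebra
      ultimately show ?thesis by (simp add: algebra_simps add_divide_distrib)
    qed
    finally show ?thesis by (simp add: x_def y_def)
  qed
  then have "edgeworth_coeff 2 = (\<lambda>u. \<Sum>(c, i, k)\<leftarrow>?xs. c * monom2 i k u)" by (rule ext)
  then have "edgeworth_poly 2 0 = Re (\<Sum>(c, i, k)\<leftarrow>?xs. c * (herm i 0 * herm k 0))"
    unfolding edgeworth_poly_def by (simp only: gauss_transform_monom_sum(1)) simp
  also have "\<dots> = (3 * m40 + m22 + 3 * m04) / 24 - 1 + T * (15 * P\<^sup>2 + 3 * (Q\<^sup>2 + 2 * P * R) + 3 * R\<^sup>2)"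
    by (simp add: herm_at_0 algebra_simps add_divide_distrib)
  also have "3 * m40 + m22 + 3 * m04 =
      3 * (a * (ex * ex)\<^sup>2 + b * (ey * ey + ez * ez)\<^sup>2 + c * (ex * ex - 2 * (ex * ey) + ey * ey + ez * ez)\<^sup>2)"
    unfolding m40_def m22_def m04_def f_def by algebra
  also have "ey * ey + ez * ez = (a + c) / G"
  proof -
    have "(c * c + G) / (G * s) = (a + c) * s / (G * s)" unfolding G_eq s_def by (simp add: algebra_simps)
    then show ?thesis using s G unfolding e_products by (simp add: add_divide_distrib s_def)
  qed
  also have "ex * ex - 2 * (ex * ey) + ey * ey + ez * ez = (a + b) / G"
    using \<open>ey * ey + ez * ez = (a + c) / G\<close> unfolding add.assoc unfolding e_products
    by (simp add: add_divide_distrib diff_divide_distrib)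
  also have "ex * ex = (b + c) / G" by (rule e_products)
  also have "T * (15 * P\<^sup>2 + 3 * (Q\<^sup>2 + 2 * P * R) + 3 * R\<^sup>2) = \<kappa>\<^sup>2 * a1_2 a b c"
  proof -
    have "ex\<^sup>2 * (15 * P\<^sup>2 + 3 * (Q\<^sup>2 + 2 * P * R) + 3 * R\<^sup>2) =
        15 * ((ex * ey) * (ex * ey) * (ex * ex - 2 * (ex * ey) + ey * ey)) + 3 * ((ex * ex) * (ez * ez) * (ex * ex - 4 * (ex * ey) + 4 * (ey * ey)))
        - 6 * (((ex * ex) * (ex * ey) - (ex * ey) * (ex * ey)) * (ez * ez)) + 3 * ((ex * ex) * (ez * ez) * (ez * ez))"
      unfolding P_def Q_def R_def by algebra
    also have "\<dots> = 15 * ((c / G) * (c / G) * (s / G - 2 * (c / G) + c * c / (G * s))) + 3 * ((s / G) * (1 / s) * (s / G - 4 * (c / G) + 4 * (c * c / (G * s))))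
        - 6 * (((s / G) * (c / G) - (c / G) * (c / G)) * (1 / s)) + 3 * ((s / G) * (1 / s) * (1 / s))"
      unfolding e_products s_def ..
    also have "\<dots> = (15 * (c * c * ((s - c) * (s - c))) + 3 * (G * ((s - 2 * c) * (s - 2 * c))) - 6 * (G * (c * (s - c))) + 3 * (G * G)) / (G ^ 3 * s)"
      using s G by (simp add: field_simps power3_eq_cube)
    \<comment> \<open>not homogeneous: the total mass \<open>a + b + c = 1\<close> enters\<close>
    also have "15 * (c * c * ((s - c) * (s - c))) + 3 * (G * ((s - 2 * c) * (s - 2 * c))) - 6 * (G * (c * (s - c))) + 3 * (G * G)
        = (3 * G - 15 * (a * b * c)) * s"
      using abc_sum G_eq s_def by algebra
    finally have "ex\<^sup>2 * (15 * P\<^sup>2 + 3 * (Q\<^sup>2 + 2 * P * R) + 3 * R\<^sup>2) = (3 * G - 15 * (a * b * c)) / G ^ 3"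
      using s by simp
    then have "T * (15 * P\<^sup>2 + 3 * (Q\<^sup>2 + 2 * P * R) + 3 * R\<^sup>2) = - (\<kappa>\<^sup>2 / 8) * ((3 * G - 15 * (a * b * c)) / G ^ 3)"
      unfolding T_def by (simp add: mult.assoc)
    then show ?thesis using G by (simp add: a1_2_def field_simps power2_eq_square power3_eq_cube)
  qed
  finally show ?thesis
    using G by (simp add: a1_0_def power_divide field_simps)
qed

lemma continuous_edgeworth_poly: "continuous_on UNIV (edgeworth_poly j)"
  unfolding edgeworth_poly_def
  by (intro continuous_intros continuous_on_compose2[OF
        parity_poly_continuous[OF parity_poly_gauss_transform[OF parity_poly_edgeworth_coeff], of UNIV]]) auto

lemma leading_coefficient:
  assumes "N \<ge> 2"
  shows "(\<lambda>n. real n * (correction_sum edgeworth_poly N n (y1 *\<^sub>R h1 + y2 *\<^sub>R h2) - a1 a b c \<kappa> y1 y2 * (1 / real n)))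
     \<longlonglongrightarrow> 0"
proof -
  define x where "x = ex * y1 + ey * y2"
  define y where "y = ez * y2"
  define r where "r = \<kappa> / 2 * (ex * ey * (ex - ey) * x ^ 3 + ex * ez * (ex - 2 * ey) * (x\<^sup>2 * y) - ex * ez\<^sup>2 * (x * y\<^sup>2))"
  have "edgeworth_poly 1 (\<epsilon> *\<^sub>R (y1 *\<^sub>R h1 + y2 *\<^sub>R h2)) = \<epsilon> * (\<kappa> * a1_1 a b c y1 y2) + \<epsilon> ^ 3 * r" for \<epsilon>
  proof -
    have "\<epsilon> *\<^sub>R (y1 *\<^sub>R h1 + y2 *\<^sub>R h2) = (\<epsilon> * y1) *\<^sub>R h1 + (\<epsilon> * y2) *\<^sub>R h2"
      by (simp add: scaleR_add_right)
    then have "edgeworth_poly 1 (\<epsilon> *\<^sub>R (y1 *\<^sub>R h1 + y2 *\<^sub>R h2)) = edgeworth_poly 1 ((\<epsilon> * y1) *\<^sub>R h1 + (\<epsilon> * y2) *\<^sub>R h2)"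
      by simp
    also have "\<dots> = \<kappa> / 2 * (ex * ey * (ex - ey) * ((\<epsilon> * x) ^ 3 - 3 * (\<epsilon> * x)) - ex * ez * (ex - 2 * ey) * ((1 - (\<epsilon> * x)\<^sup>2) * (\<epsilon> * y))
      + ex * ez\<^sup>2 * ((\<epsilon> * x) * (1 - (\<epsilon> * y)\<^sup>2)))"
      unfolding edgeworth_poly_1 x_def y_def by (simp add: algebra_simps)
    also have "\<dots> = \<epsilon> * (\<kappa> / 2 * (- 3 * (ex * ey * (ex - ey)) * x - ex * ez * (ex - 2 * ey) * y + ex * ez\<^sup>2 * x)) + \<epsilon> ^ 3 * r"
      unfolding r_def by (simp add: algebra_simps power2_eq_square power3_eq_cube)
    finally show ?thesis using linear_part[of y1 y2] by (simp only: x_def y_def)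
  qed
  from correction_sum_limit[of edgeworth_poly, OF continuous_edgeworth_poly this assms]
  have "(\<lambda>n. real n * (correction_sum edgeworth_poly N n (y1 *\<^sub>R h1 + y2 *\<^sub>R h2)
      - (\<kappa> * a1_1 a b c y1 y2 + edgeworth_poly 2 0) * (1 / real n))) \<longlonglongrightarrow> 0" .
  moreover have "\<kappa> * a1_1 a b c y1 y2 + edgeworth_poly 2 0 = a1 a b c \<kappa> y1 y2"
    unfolding edgeworth_poly_2_at_0 a1_def by simp
  ultimately show ?thesis by simp
qed

section \<open>Aperiodicity\<close>

lemma equal_phases:
  assumes "\<not> norm (torus_char hex_steps wt \<theta>) < 1" "k \<in> hex_steps" "wt k \<noteq> 0" "l \<in> hex_steps" "wt l \<noteq> 0"
  obtains m :: int where "real_pair k \<bullet> \<theta> - real_pair l \<bullet> \<theta> = 2 * pi * of_int m"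
proof -
  have "iexp (real_pair j \<bullet> \<theta>) = torus_char hex_steps wt \<theta>" if "j \<in> hex_steps" "wt j \<noteq> 0" for j
    unfolding torus_char_def
  proof (rule convex_unit_norm_eq_1[of hex_steps wt "\<lambda>k. real_pair k \<bullet> \<theta>" j])
    show "\<not> norm (\<Sum>k\<in>hex_steps. of_real (wt k) * iexp (real_pair k \<bullet> \<theta>)) < 1"
      using assms(1) unfolding torus_char_def .
  qed (use that finite_K w_nonneg w_sum in auto)
  from this[OF assms(2,3)] this[OF assms(4,5)]
  have "iexp (real_pair k \<bullet> \<theta>) = iexp (real_pair l \<bullet> \<theta>)" by (simp only:)
  then obtain m :: int where "\<i> * of_real (real_pair k \<bullet> \<theta>) = \<i> * of_real (real_pair l \<bullet> \<theta>) + of_real (2 * of_int m * pi) * \<i>"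
    unfolding exp_eq by auto
  then have "\<i> * of_real (real_pair k \<bullet> \<theta>) = \<i> * of_real (real_pair l \<bullet> \<theta> + 2 * of_int m * pi)"
    by (simp add: algebra_simps)
  then have "real_pair k \<bullet> \<theta> = real_pair l \<bullet> \<theta> + 2 * of_int m * pi"
    by (simp only: mult_cancel_left complex_i_not_zero of_real_eq_iff simp_thms)
  then show ?thesis by (intro that[of m]) (simp add: mult_ac)
qed

text \<open>If all three cyclic steps occur, then equality of the phases forces \<open>3 * fst \<theta>\<close> and
  \<open>fst \<theta> + snd \<theta>\<close> to be multiples of \<open>2 * pi\<close>.\<close>
lemma cyclic_phases:
  assumes "\<not> norm (torus_char hex_steps wt \<theta>) < 1" "\<alpha> > 0" "\<beta> > 0" "\<gamma> > 0"
  obtains m m' :: int where "fst \<theta> + snd \<theta> = 2 * pi * of_int m" "3 * fst \<theta> = 2 * pi * of_int m'"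
proof -
  obtain m :: int where m: "fst \<theta> + snd \<theta> = 2 * pi * of_int m"
    using equal_phases[OF assms(1), of "(1, 0)" "(0, - 1)"] assms(2-)
    by (auto simp: hex_steps_def real_pair_def inner_prod_def)
  obtain m' :: int where m': "fst \<theta> - (snd \<theta> - fst \<theta>) = 2 * pi * of_int m'"
    using equal_phases[OF assms(1), of "(1, 0)" "(- 1, 1)"] assms(2-)
    by (auto simp: hex_steps_def real_pair_def inner_prod_def)
  show ?thesis
    by (rule that[OF m, of "m + m'"]) (use m m' in \<open>simp add: algebra_simps\<close>)
qed

lemma multiple_of_2pi_eq_0:
  assumes "\<bar>x\<bar> \<le> pi" "x = 2 * pi * of_int m"
  shows "x = 0"
proof -
  have "\<bar>2 * of_int m :: real\<bar> \<le> 1"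
    using assms pi_gt_zero by (simp add: abs_mult)
  then have "m = 0" by linarith
  then show ?thesis using assms(2) by simp
qed

lemma torus_char_lt_1_cyclic:
  assumes "\<alpha> > 0" "\<beta> > 0" "\<gamma> > 0" and \<theta>: "\<theta> \<in> torus_box 3" "\<theta> \<noteq> 0"
  shows "norm (torus_char hex_steps wt \<theta>) < 1"
proof (rule ccontr)
  assume "\<not> norm (torus_char hex_steps wt \<theta>) < 1"
  then obtain m m' :: int where m: "fst \<theta> + snd \<theta> = 2 * pi * of_int m" "3 * fst \<theta> = 2 * pi * of_int m'"
    by (rule cyclic_phases[OF _ assms(1-3)])
  have "\<bar>3 * fst \<theta>\<bar> \<le> pi" "\<bar>snd \<theta>\<bar> \<le> pi"
    using \<theta>(1) by (auto simp: torus_box_def)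
  then have "fst \<theta> = 0" "snd \<theta> = 0"
    using multiple_of_2pi_eq_0[OF _ m(2)] multiple_of_2pi_eq_0[of "snd \<theta>" m] m(1) by auto
  then show False using \<theta>(2) by (simp add: prod_eq_iff)
qed

lemma torus_char_lt_1:
  assumes "\<alpha> > 0" "\<beta> > 0" "\<gamma> > 0" and rev: "\<alpha>' > 0 \<or> \<beta>' > 0 \<or> \<gamma>' > 0"
    and \<theta>: "\<theta> \<in> torus_box 1" "\<theta> \<noteq> 0"
  shows "norm (torus_char hex_steps wt \<theta>) < 1"
proof (rule ccontr)
  assume not: "\<not> norm (torus_char hex_steps wt \<theta>) < 1"
  then obtain m m' :: int where m: "fst \<theta> + snd \<theta> = 2 * pi * of_int m" "3 * fst \<theta> = 2 * pi * of_int m'"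
    by (rule cyclic_phases[OF _ assms(1-3)])
  from rev obtain i :: int where "fst \<theta> = 2 * pi * of_int i"
  proof (elim disjE)
    assume "\<alpha>' > 0"
    then obtain j :: int where "2 * fst \<theta> = 2 * pi * of_int j"
      using equal_phases[OF not, of "(1, 0)" "(- 1, 0)"] assms(1)
      by (auto simp: hex_steps_def real_pair_def inner_prod_def)
    then show ?thesis using m by (intro that[of "m' - j"]) (simp add: algebra_simps)
  next
    assume "\<beta>' > 0"
    then obtain j :: int where "2 * snd \<theta> = 2 * pi * of_int j"
      using equal_phases[OF not, of "(0, 1)" "(0, - 1)"] assms(2)
      by (auto simp: hex_steps_def real_pair_def inner_prod_def)
    then show ?thesis using m by (intro that[of "m' - 2 * m + j"]) (simp add: algebra_simps)
  next
    assume "\<gamma>' > 0"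
    then obtain j :: int where "2 * (snd \<theta> - fst \<theta>) = 2 * pi * of_int j"
      using equal_phases[OF not, of "(- 1, 1)" "(1, - 1)"] assms(3)
      by (auto simp: hex_steps_def real_pair_def inner_prod_def algebra_simps)
    then show ?thesis using m by (intro that[of "2 * m - j - m'"]) (simp add: algebra_simps)
  qed
  moreover have "\<bar>fst \<theta>\<bar> \<le> pi" "\<bar>snd \<theta>\<bar> \<le> pi"
    using \<theta>(1) by (auto simp: torus_box_def)
  ultimately have "fst \<theta> = 0" "snd \<theta> = 0"
    using multiple_of_2pi_eq_0[of "fst \<theta>" i] multiple_of_2pi_eq_0[of "snd \<theta>" m] m(1) by auto
  then show False using \<theta>(2) by (simp add: prod_eq_iff)
qed

end

section \<open>The local limit theorem\<close>

context triangular_walk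
begin

text \<open>In lattice coordinates \<open>(i, j)\<close> the \<open>k\<close>-th class is given by \<open>i - j \<equiv> k\<close> modulo 3.\<close>
lemma class_lattice_diff:
  assumes "x \<in> class_lattice h1 h2 k" "y \<in> class_lattice h1 h2 s"
    and n: "int n = 3 * m + (int s - int k)"
  obtains v where "y = x + pos v" "3 dvd fst v - snd v - int n" "x \<in> tri_lattice h1 h2"
proof -
  have cls: "\<exists>i j. x = pos (2 * i + j + int k, j - i)" if "x \<in> class_lattice h1 h2 k" for x k
  proof -
    from that obtain i j :: int where "x = of_int i *\<^sub>R (2 *\<^sub>R h1 - h2) + of_int j *\<^sub>R (h1 + h2) + real k *\<^sub>R h1"
      unfolding class_lattice_def by blast
    then have "x = pos (2 * i + j + int k, j - i)"
      by (simp add: pos_def scaleR_left_distrib scaleR_right_distrib scaleR_diff_right scaleR_diff_left mult.commute)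
    then show ?thesis by blast
  qed
  obtain i j where x: "x = pos (2 * i + j + int k, j - i)" using cls[OF assms(1)] by blast
  obtain i' j' where y: "y = pos (2 * i' + j' + int s, j' - i')" using cls[OF assms(2)] by blast
  let ?v = "(2 * i' + j' + int s, j' - i') - (2 * i + j + int k, j - i)"
  have "y = x + pos ?v" unfolding pos_diff x y by simp
  moreover have "fst ?v - snd ?v - int n = 3 * (i' - i - m)" using n by simp
  then have "3 dvd fst ?v - snd ?v - int n" by (metis dvd_triv_left)
  moreover have "x \<in> tri_lattice h1 h2" unfolding tri_lattice_eq x by simp
  ultimately show ?thesis by (rule that)
qed

end

lemma cyclic_walk_vectors:
  "h1_vec (1/3) (1/3) (1/3) = vector [sqrt (2/3), 0]"
  "h2_vec (1/3) (1/3) (1/3) = vector [1 / sqrt 6, 1 / sqrt 2]"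
  "A_G (1/3) (1/3) (1/3) = 1 / sqrt 3"
proof -
  have G: "Gam (1/3) (1/3) (1/3) = 1/3" by (simp add: Gam_def)
  have l: "l_const (1/3) (1/3) (1/3) = sqrt (2/3)" by (simp add: l_const_def G)
  show "h1_vec (1/3) (1/3) (1/3) = vector [sqrt (2/3), 0]" by (simp add: h1_vec_def l)
  have "(1/3) / (1/3 + 1/3) * sqrt (2/3) = (1 / sqrt 6 :: real)"
    by (rule power2_eq_imp_eq) (simp_all add: power_mult_distrib power_divide)
  moreover have "sqrt (1/3) / (1/3 + 1/3) * sqrt (2/3) = (1 / sqrt 2 :: real)"
    by (rule power2_eq_imp_eq) (simp_all add: power_mult_distrib power_divide)
  ultimately show "h2_vec (1/3) (1/3) (1/3) = vector [1 / sqrt 6, 1 / sqrt 2]"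
    by (simp only: h2_vec_def l G)
  have "sqrt 3 * sqrt 3 = (3 :: real)" by simp
  then show "A_G (1/3) (1/3) (1/3) = 1 / sqrt 3"
    unfolding A_G_def G by (simp add: real_sqrt_divide field_simps)
qed

theorem theorem2p2:
  fixes \<alpha> \<alpha>' \<beta> \<beta>' \<gamma> \<gamma>' \<kappa> a b c :: real
    and h1 h2 :: "real^2"
    and V :: "(real^2) set"
    and E :: "((real^2) \<times> (real^2)) set"
    and p :: "(real^2) \<times> (real^2) \<Rightarrow> real"
  assumes a: "a = \<alpha> + \<alpha>'" and b: "b = \<beta> + \<beta>'" and c: "c = \<gamma> + \<gamma>'"
    and Gam_pos: "Gam a b c > 0"
    and h1: "h1 = h1_vec a b c" and h2: "h2 = h2_vec a b c"
    and V: "V = tri_lattice h1 h2" and E: "E = tri_edges h1 h2"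
    and walk: "zero_mean_walk h1 h2 p \<alpha> \<alpha>' \<beta> \<beta>' \<gamma> \<gamma>' \<kappa>"
  shows
    "(\<kappa> < 1/3 \<and> a > 0 \<and> b > 0 \<and> c > 0 \<longrightarrow>
      (\<exists>P :: nat \<Rightarrow> real^2 \<Rightarrow> real.
        expansion_polys h1 h2 P \<and>
        (\<forall>N. \<exists>C. \<forall>\<^sub>F n in sequentially. \<forall>x\<in>V. \<forall>y\<in>V.
           \<bar>2 * pi * real n * nstep_prob E p n x y
             - 3 * A_G a b c * exp (- 3 / (2 * real n) * (norm (y - x))\<^sup>2)
                 * (1 + correction_sum P N n (y - x))\<bar>
           \<le> C * real n powr (- (real N + 1) / 2)) \<and>
        (\<forall>N\<ge>2. \<forall>x\<in>V. \<forall>y\<in>V. \<forall>y1 y2. y - x = y1 *\<^sub>R h1 + y2 *\<^sub>R h2 \<longrightarrow>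
           (\<lambda>n. real n * (correction_sum P N n (y - x) - a1 a b c \<kappa> y1 y2 * (1 / real n)))
             \<longlonglongrightarrow> 0)))
   \<and> (\<kappa> = 1/3 \<longrightarrow>
      \<alpha> = 1/3 \<and> \<beta> = 1/3 \<and> \<gamma> = 1/3 \<and> \<alpha>' = 0 \<and> \<beta>' = 0 \<and> \<gamma>' = 0 \<and>
      h1 = vector [sqrt (2/3), 0] \<and> h2 = vector [1 / sqrt 6, 1 / sqrt 2] \<and>
      A_G a b c = 1 / sqrt 3 \<and>
      (\<exists>P :: nat \<Rightarrow> real^2 \<Rightarrow> real.
        expansion_polys h1 h2 P \<and>
        (\<forall>N. \<exists>C. \<forall>\<^sub>F n in sequentially.
           \<forall>k\<in>{0,1,2}. \<forall>s\<in>{0,1,2}. \<forall>x \<in> class_lattice h1 h2 k. \<forall>y \<in> class_lattice h1 h2 s.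
           (\<exists>m::int. int n = 3 * m + (int s - int k)) \<longrightarrow>
           \<bar>2 * pi * real n * nstep_prob E p n x y
             - 9 * A_G a b c * exp (- 3 / (2 * real n) * (norm (y - x))\<^sup>2)
                 * (1 + correction_sum P N n (y - x))\<bar>
           \<le> C * real n powr (- (real N + 1) / 2)) \<and>
        (\<forall>N\<ge>2. \<forall>x\<in>V. \<forall>y\<in>V.
           (\<lambda>n. real n * (correction_sum P N n (y - x) - (- 2/3) * (1 / real n)))
             \<longlonglongrightarrow> 0)))"
proof -
  interpret triangular_walk \<alpha> \<alpha>' \<beta> \<beta>' \<gamma> \<gamma>' \<kappa> a b c h1 h2 p
    by unfold_locales (use assms in auto)
  have part1: "\<exists>P :: nat \<Rightarrow> real^2 \<Rightarrow> real.
        expansion_polys h1 h2 P \<and>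
        (\<forall>N. \<exists>C. \<forall>\<^sub>F n in sequentially. \<forall>x\<in>V. \<forall>y\<in>V.
           \<bar>2 * pi * real n * nstep_prob E p n x y
             - 3 * A_G a b c * exp (- 3 / (2 * real n) * (norm (y - x))\<^sup>2)
                 * (1 + correction_sum P N n (y - x))\<bar>
           \<le> C * real n powr (- (real N + 1) / 2)) \<and>
        (\<forall>N\<ge>2. \<forall>x\<in>V. \<forall>y\<in>V. \<forall>y1 y2. y - x = y1 *\<^sub>R h1 + y2 *\<^sub>R h2 \<longrightarrow>
           (\<lambda>n. real n * (correction_sum P N n (y - x) - a1 a b c \<kappa> y1 y2 * (1 / real n)))
             \<longlonglongrightarrow> 0)"
    if "\<kappa> < 1/3" "a > 0" "b > 0" "c > 0"
  proof (intro exI[of _ edgeworth_poly] conjI allI impI ballI expansion_polys_edgeworth)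
    fix N
    have pos: "\<alpha> > 0" "\<beta> > 0" "\<gamma> > 0" using that(2-4) drift abc by auto
    have rev: "\<alpha>' > 0 \<or> \<beta>' > 0 \<or> \<gamma>' > 0"
      using that(1) drift weights_nonneg weights_sum by linarith
    have char: "\<forall>\<theta>\<in>torus_box 1. \<theta> \<noteq> 0 \<longrightarrow> norm (torus_char hex_steps wt \<theta>) < 1"
      using torus_char_lt_1[OF pos rev] by blast
    have step: "\<forall>k\<in>hex_steps. wt k \<noteq> 0 \<longrightarrow> int 1 dvd fst k - snd k - 1" by simp
    obtain C where C: "\<And>n x v. n \<ge> 1 \<Longrightarrow> x \<in> tri_lattice h1 h2 \<Longrightarrow> int 1 dvd fst v - snd v - int n \<Longrightarrow>
     \<bar>2 * pi * real n * nstep_prob (tri_edges h1 h2) p n x (x + pos v)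
       - real 1 * (3 * A_G a b c) * exp (- 3 / (2 * real n) * (norm (pos v))\<^sup>2)
           * (1 + correction_sum edgeworth_poly N n (pos v))\<bar>
     \<le> C * real n powr (- (real N + 1) / 2)"
      by (fact nstep_prob_expansion[OF zero_less_one step char, of N])
    show "\<exists>C. \<forall>\<^sub>F n in sequentially. \<forall>x\<in>V. \<forall>y\<in>V.
           \<bar>2 * pi * real n * nstep_prob E p n x y
             - 3 * A_G a b c * exp (- 3 / (2 * real n) * (norm (y - x))\<^sup>2)
                 * (1 + correction_sum edgeworth_poly N n (y - x))\<bar>
           \<le> C * real n powr (- (real N + 1) / 2)"
    proof (intro exI[of _ C] eventually_mono[OF eventually_ge_at_top[of 1]] ballI)
      fix n :: nat and x y assume n: "n \<ge> 1" and x: "x \<in> V" and y: "y \<in> V"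
      obtain u v where "x = pos u" "y = pos v" using x y unfolding V tri_lattice_eq by blast
      then have "y = x + pos (v - u)" "y - x = pos (v - u)" by (simp_all add: pos_diff)
      then show "\<bar>2 * pi * real n * nstep_prob E p n x y
             - 3 * A_G a b c * exp (- 3 / (2 * real n) * (norm (y - x))\<^sup>2)
                 * (1 + correction_sum edgeworth_poly N n (y - x))\<bar>
           \<le> C * real n powr (- (real N + 1) / 2)"
        using C[OF n, of x "v - u"] x by (simp add: V E)
    qed
  next
    fix N :: nat and x y y1 y2 assume "N \<ge> 2" "y - x = y1 *\<^sub>R h1 + y2 *\<^sub>R h2"
    then show "(\<lambda>n. real n * (correction_sum edgeworth_poly N n (y - x) - a1 a b c \<kappa> y1 y2 * (1 / real n))) \<longlonglongrightarrow> 0"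
      using leading_coefficient by simp
  qed
  have part2: "\<alpha> = 1/3 \<and> \<beta> = 1/3 \<and> \<gamma> = 1/3 \<and> \<alpha>' = 0 \<and> \<beta>' = 0 \<and> \<gamma>' = 0 \<and>
      h1 = vector [sqrt (2/3), 0] \<and> h2 = vector [1 / sqrt 6, 1 / sqrt 2] \<and>
      A_G a b c = 1 / sqrt 3 \<and>
      (\<exists>P :: nat \<Rightarrow> real^2 \<Rightarrow> real.
        expansion_polys h1 h2 P \<and>
        (\<forall>N. \<exists>C. \<forall>\<^sub>F n in sequentially.
           \<forall>k\<in>{0,1,2}. \<forall>s\<in>{0,1,2}. \<forall>x \<in> class_lattice h1 h2 k. \<forall>y \<in> class_lattice h1 h2 s.
           (\<exists>m::int. int n = 3 * m + (int s - int k)) \<longrightarrow>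
           \<bar>2 * pi * real n * nstep_prob E p n x y
             - 9 * A_G a b c * exp (- 3 / (2 * real n) * (norm (y - x))\<^sup>2)
                 * (1 + correction_sum P N n (y - x))\<bar>
           \<le> C * real n powr (- (real N + 1) / 2)) \<and>
        (\<forall>N\<ge>2. \<forall>x\<in>V. \<forall>y\<in>V.
           (\<lambda>n. real n * (correction_sum P N n (y - x) - (- 2/3) * (1 / real n)))
             \<longlonglongrightarrow> 0))"
    if \<kappa>: "\<kappa> = 1/3"
  proof -
    have w: "\<alpha> = 1/3" "\<beta> = 1/3" "\<gamma> = 1/3" "\<alpha>' = 0" "\<beta>' = 0" "\<gamma>' = 0"
      using \<kappa> drift weights_nonneg weights_sum by linarith+
    have abc3: "a = 1/3" "b = 1/3" "c = 1/3" using w abc by simp_all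
    have "expansion_polys h1 h2 edgeworth_poly \<and>
        (\<forall>N. \<exists>C. \<forall>\<^sub>F n in sequentially.
           \<forall>k\<in>{0,1,2}. \<forall>s\<in>{0,1,2}. \<forall>x \<in> class_lattice h1 h2 k. \<forall>y \<in> class_lattice h1 h2 s.
           (\<exists>m::int. int n = 3 * m + (int s - int k)) \<longrightarrow>
           \<bar>2 * pi * real n * nstep_prob E p n x y
             - 9 * A_G a b c * exp (- 3 / (2 * real n) * (norm (y - x))\<^sup>2)
                 * (1 + correction_sum edgeworth_poly N n (y - x))\<bar>
           \<le> C * real n powr (- (real N + 1) / 2)) \<and>
        (\<forall>N\<ge>2. \<forall>x\<in>V. \<forall>y\<in>V.
           (\<lambda>n. real n * (correction_sum edgeworth_poly N n (y - x) - (- 2/3) * (1 / real n)))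
             \<longlonglongrightarrow> 0)"
    proof (intro conjI allI impI ballI expansion_polys_edgeworth)
      fix N
      have step: "\<forall>k\<in>hex_steps. wt k \<noteq> 0 \<longrightarrow> int 3 dvd fst k - snd k - 1"
        using w by (auto simp: hex_steps_def)
      have pos: "\<alpha> > 0" "\<beta> > 0" "\<gamma> > 0" using w by simp_all
      have char: "\<forall>\<theta>\<in>torus_box 3. \<theta> \<noteq> 0 \<longrightarrow> norm (torus_char hex_steps wt \<theta>) < 1"
        using torus_char_lt_1_cyclic[OF pos] by blast
      obtain C where C: "\<And>n x v. n \<ge> 1 \<Longrightarrow> x \<in> tri_lattice h1 h2 \<Longrightarrow> int 3 dvd fst v - snd v - int n \<Longrightarrow>
       \<bar>2 * pi * real n * nstep_prob (tri_edges h1 h2) p n x (x + pos v)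
         - real 3 * (3 * A_G a b c) * exp (- 3 / (2 * real n) * (norm (pos v))\<^sup>2)
             * (1 + correction_sum edgeworth_poly N n (pos v))\<bar>
       \<le> C * real n powr (- (real N + 1) / 2)"
        by (fact nstep_prob_expansion[OF zero_less_numeral step char, of N])
      show "\<exists>C. \<forall>\<^sub>F n in sequentially.
           \<forall>k\<in>{0,1,2}. \<forall>s\<in>{0,1,2}. \<forall>x \<in> class_lattice h1 h2 k. \<forall>y \<in> class_lattice h1 h2 s.
           (\<exists>m::int. int n = 3 * m + (int s - int k)) \<longrightarrow>
           \<bar>2 * pi * real n * nstep_prob E p n x y
             - 9 * A_G a b c * exp (- 3 / (2 * real n) * (norm (y - x))\<^sup>2)
                 * (1 + correction_sum edgeworth_poly N n (y - x))\<bar>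
           \<le> C * real n powr (- (real N + 1) / 2)"
      proof (intro exI[of _ C] eventually_mono[OF eventually_ge_at_top[of 1]] ballI impI, elim exE)
        fix n k s :: nat and x y and m :: int
        assume n: "n \<ge> 1" and xy: "x \<in> class_lattice h1 h2 k" "y \<in> class_lattice h1 h2 s"
          and m: "int n = 3 * m + (int s - int k)"
        obtain v where v: "y = x + pos v" "3 dvd fst v - snd v - int n" "x \<in> tri_lattice h1 h2"
          by (rule class_lattice_diff[OF xy m])
        then show "\<bar>2 * pi * real n * nstep_prob E p n x y
             - 9 * A_G a b c * exp (- 3 / (2 * real n) * (norm (y - x))\<^sup>2)
                 * (1 + correction_sum edgeworth_poly N n (y - x))\<bar>
           \<le> C * real n powr (- (real N + 1) / 2)"
          using C[OF n v(3), of v] by (simp add: E)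
      qed
    next
      fix N :: nat and x y assume "N \<ge> 2" "x \<in> V" "y \<in> V"
      then obtain u v where "x = pos u" "y = pos v" unfolding V tri_lattice_eq by blast
      then have "y - x = pos (v - u)" by (simp add: pos_diff)
      moreover have "a1 a b c \<kappa> y1 y2 = - 2/3" for y1 y2
        unfolding abc3 \<kappa> by (simp add: a1_def a1_0_def a1_1_def a1_2_def Gam_def power2_eq_square)
      ultimately show "(\<lambda>n. real n * (correction_sum edgeworth_poly N n (y - x) - (- 2/3) * (1 / real n))) \<longlonglongrightarrow> 0"
        using leading_coefficient[OF \<open>N \<ge> 2\<close>, of "of_int (fst (v - u))" "of_int (snd (v - u))"]
        by (simp only: pos_def)
    qed
    then show ?thesis
      using w cyclic_walk_vectors unfolding h1 h2 abc3 by blast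
  qed
  show ?thesis using part1 part2 by blast
qed

end
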